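(* Let $G$ be a reductive linear algebraic group over an algebraically closed field $\Bbbk$ of characteristic $p>0$ such that the identity component $G^0$ is a torus or trivial. Let $P$ be a Sylow $p$-subgroup of the (finite) group $G/G^0$. Then $\delta(G)=|P|$.
   Context: A $G$-module is a finite-dimensional rational representation $V$ of $G$ over $\Bbbk$. $\Bbbk[V]\cong S(V^* )$ is the ring of polynomial functions on $V$, with $G$-action $(g\cdot f)(v)=f(g^{-1}v)$ and invariant ring $\Bbbk[V]^G$, graded by degree. $\Bbbk[V]^G_{\le d}$ is the set of invariants of degree at most $d$. For $S\subseteq \Bbbk[V]$, $S_+$ is the set of elements of $S$ with constant term zero. The nullcone $\mathcal{N}_{G,V}\subseteq V$ is the common zero set of $\Bbbk[V]^G_+$. A subset $S\subseteq\Bbbk[V]^G$ is a $\delta$-set if for every $v\in V^G\setminus\mathcal{N}_{G,V}$ there is $f\in S_+$ with $f(v)\neq 0$. Define $\delta(G,V)=\min\{d\ge 0 : \Bbbk[V]^G_{\le d}\text{ is a }\delta\text{-set}\}$ and $\delta(G)=\sup\{\delta(G,V): V\text{ a }G\text{-module}\}$ (equal to $\infty$ if unbounded). Reductive groups need not be connected. *)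

theory Defs
  imports
    "HOL-Analysis.Abstract_Topology_2"
    "HOL-Algebra.Coset"
    "HOL-Library.Extended_Nat"
    "Jordan_Normal_Form.Determinant"
begin

section \<open>Polynomial functions\<close>

text \<open>
  Polynomial functions on \<open>X\<close> of degree at most \<open>d\<close> in the coordinates \<open>x i\<close>, \<open>i \<in> I\<close>.
  They are kept extensional, so that equality of functions on \<open>X\<close> is equality in HOL.
  Over an infinite field a polynomial is determined by its function on affine space,
  hence the degree filtration on functions is that of the polynomial ring.
\<close>

definition poly_funs_le ::
    "'b set \<Rightarrow> 'i set \<Rightarrow> ('i \<Rightarrow> 'b \<Rightarrow> 'a::comm_semiring_1) \<Rightarrow> nat \<Rightarrow> ('b \<Rightarrow> 'a) set" where
  "poly_funs_le X I x d =
     {f \<in> extensional X. \<exists>A c. finite A \<and> (\<forall>\<alpha>\<in>A. sum \<alpha> I \<le> d) \<and>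
        (\<forall>b\<in>X. f b = (\<Sum>\<alpha>\<in>A. c \<alpha> * (\<Prod>i\<in>I. x i b ^ \<alpha> i)))}"

definition poly_funs ::
    "'b set \<Rightarrow> 'i set \<Rightarrow> ('i \<Rightarrow> 'b \<Rightarrow> 'a::comm_semiring_1) \<Rightarrow> ('b \<Rightarrow> 'a) set" where
  "poly_funs X I x = (\<Union>d. poly_funs_le X I x d)"

definition vec_poly_funs_le :: "nat \<Rightarrow> nat \<Rightarrow> ('a::comm_semiring_1 vec \<Rightarrow> 'a) set" where
  "vec_poly_funs_le m d = poly_funs_le (carrier_vec m) {..<m} (\<lambda>i v. v $ i) d"

definition vec_poly_funs :: "nat \<Rightarrow> ('a::comm_semiring_1 vec \<Rightarrow> 'a) set" where
  "vec_poly_funs m = (\<Union>d. vec_poly_funs_le m d)"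

definition mat_poly_funs :: "nat \<Rightarrow> ('a::comm_semiring_1 mat \<Rightarrow> 'a) set" where
  "mat_poly_funs n = poly_funs (carrier_mat n n) ({..<n} \<times> {..<n}) (\<lambda>ij A. A $$ ij)"

lemma poly_funs_const: "(\<lambda>b\<in>X. a) \<in> poly_funs X I x"
proof -
  have "(\<lambda>b\<in>X. a) \<in> poly_funs_le X I x 0"
    unfolding poly_funs_le_def
    by (auto intro!: exI[of _ "{\<lambda>_. 0}"] exI[of _ "\<lambda>_. a"])
  then show ?thesis
    unfolding poly_funs_def by blast
qed

lemma poly_funs_mult:
  fixes x :: "'i \<Rightarrow> 'b \<Rightarrow> 'a::comm_semiring_1"
  assumes "f \<in> poly_funs X I x" and "g \<in> poly_funs X I x"
  shows "(\<lambda>b\<in>X. f b * g b) \<in> poly_funs X I x"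
proof -
  obtain d A c where f: "finite A" "\<forall>\<alpha>\<in>A. sum \<alpha> I \<le> d"
      "\<forall>b\<in>X. f b = (\<Sum>\<alpha>\<in>A. c \<alpha> * (\<Prod>i\<in>I. x i b ^ \<alpha> i))"
    using assms(1) unfolding poly_funs_def poly_funs_le_def by auto
  obtain e B c' where g: "finite B" "\<forall>\<alpha>\<in>B. sum \<alpha> I \<le> e"
      "\<forall>b\<in>X. g b = (\<Sum>\<alpha>\<in>B. c' \<alpha> * (\<Prod>i\<in>I. x i b ^ \<alpha> i))"
    using assms(2) unfolding poly_funs_def poly_funs_le_def by auto
  define h where "h = (\<lambda>(\<alpha>::'i \<Rightarrow> nat, \<beta>::'i \<Rightarrow> nat). \<lambda>i. \<alpha> i + \<beta> i)"
  define k where "k = (\<lambda>\<gamma>. \<Sum>p\<in>{p \<in> A \<times> B. h p = \<gamma>}. c (fst p) * c' (snd p))"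
  have fin: "finite (A \<times> B)"
    using f(1) g(1) by simp
  have "f b * g b = (\<Sum>\<gamma>\<in>h ` (A \<times> B). k \<gamma> * (\<Prod>i\<in>I. x i b ^ \<gamma> i))" if "b \<in> X" for b
  proof -
    have "f b * g b = (\<Sum>p\<in>A \<times> B. c (fst p) * c' (snd p) * (\<Prod>i\<in>I. x i b ^ h p i))"
      unfolding f(3)[rule_format, OF that] g(3)[rule_format, OF that]
        sum_product sum.cartesian_product
      by (intro sum.cong refl) (auto simp: h_def power_add prod.distrib mult_ac)
    also have "\<dots> = (\<Sum>\<gamma>\<in>h ` (A \<times> B). \<Sum>p\<in>{p \<in> A \<times> B. h p = \<gamma>}.
        c (fst p) * c' (snd p) * (\<Prod>i\<in>I. x i b ^ h p i))"
      by (rule sum.image_gen[OF fin])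
    also have "\<dots> = (\<Sum>\<gamma>\<in>h ` (A \<times> B). k \<gamma> * (\<Prod>i\<in>I. x i b ^ \<gamma> i))"
      unfolding k_def sum_distrib_right by (intro sum.cong refl) auto
    finally show ?thesis .
  qed
  moreover have "\<forall>\<gamma>\<in>h ` (A \<times> B). sum \<gamma> I \<le> d + e"
    using f(2) g(2) by (auto simp: h_def sum.distrib intro: add_mono)
  ultimately have "(\<lambda>b\<in>X. f b * g b) \<in> poly_funs_le X I x (d + e)"
    unfolding poly_funs_le_def using fin
    by (auto intro!: exI[of _ "h ` (A \<times> B)"] exI[of _ k])
  then show ?thesis
    unfolding poly_funs_def by blast
qed


section \<open>Linear algebraic groups\<close>

definition GL :: "nat \<Rightarrow> 'a::field mat monoid" where
  "GL n = units_of (ring_mat TYPE('a) n ())"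

definition zariski_open :: "nat \<Rightarrow> 'a::field mat set \<Rightarrow> bool" where
  "zariski_open n U \<longleftrightarrow>
     (\<exists>S \<subseteq> mat_poly_funs n. U = {A \<in> carrier (GL n). \<exists>f\<in>S. f A \<noteq> 0})"

definition zariski :: "nat \<Rightarrow> 'a::field mat topology" where
  "zariski n = topology (zariski_open n)"

lemma carrier_GL_subset: "carrier (GL n) \<subseteq> carrier_mat n n"
  by (auto simp: GL_def units_of_def Units_def ring_mat_simps)

lemma istopology_zariski_open: "istopology (zariski_open n)"
  unfolding istopology_def
proof (intro conjI allI impI)
  fix U V :: "'a mat set"
  assume "zariski_open n U" "zariski_open n V"
  then obtain S T where
    S: "S \<subseteq> mat_poly_funs n" "U = {A \<in> carrier (GL n). \<exists>f\<in>S. f A \<noteq> 0}" and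
    T: "T \<subseteq> mat_poly_funs n" "V = {A \<in> carrier (GL n). \<exists>f\<in>T. f A \<noteq> 0}"
    unfolding zariski_open_def by blast
  let ?R = "{(\<lambda>A\<in>carrier_mat n n. f A * g A) | f g. f \<in> S \<and> g \<in> T}"
  have "?R \<subseteq> mat_poly_funs n"
    using S(1) T(1) unfolding mat_poly_funs_def by (auto intro!: poly_funs_mult)
  moreover have "U \<inter> V = {A \<in> carrier (GL n). \<exists>f\<in>?R. f A \<noteq> 0}"
  proof (intro equalityI subsetI)
    fix A assume "A \<in> U \<inter> V"
    then obtain f g where fg: "A \<in> carrier (GL n)" "f \<in> S" "g \<in> T" "f A \<noteq> 0" "g A \<noteq> 0"
      unfolding S(2) T(2) by blast
    moreover have "A \<in> carrier_mat n n"
      using fg(1) carrier_GL_subset by blast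
    ultimately have "(\<lambda>A\<in>carrier_mat n n. f A * g A) A \<noteq> 0"
      by simp
    then show "A \<in> {A \<in> carrier (GL n). \<exists>f\<in>?R. f A \<noteq> 0}"
      using fg by blast
  next
    fix A assume "A \<in> {A \<in> carrier (GL n). \<exists>f\<in>?R. f A \<noteq> 0}"
    then obtain f g where fg: "A \<in> carrier (GL n)" "f \<in> S" "g \<in> T"
        "(\<lambda>A\<in>carrier_mat n n. f A * g A) A \<noteq> 0"
      by blast
    moreover have "A \<in> carrier_mat n n"
      using fg(1) carrier_GL_subset by blast
    ultimately have "f A \<noteq> 0" "g A \<noteq> 0"
      by auto
    then show "A \<in> U \<inter> V"
      using fg unfolding S(2) T(2) by blast
  qed
  ultimately show "zariski_open n (U \<inter> V)"
    unfolding zariski_open_def by blast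
next
  fix K :: "'a mat set set"
  assume "\<forall>U\<in>K. zariski_open n U"
  then have "\<forall>U\<in>K. \<exists>S. S \<subseteq> mat_poly_funs n \<and> U = {A \<in> carrier (GL n). \<exists>f\<in>S. f A \<noteq> 0}"
    unfolding zariski_open_def by blast
  then obtain S where S: "\<forall>U\<in>K. S U \<subseteq> mat_poly_funs n \<and>
      U = {A \<in> carrier (GL n). \<exists>f\<in>S U. f A \<noteq> 0}"
    by (rule bchoice[THEN exE])
  have mem: "A \<in> U \<longleftrightarrow> A \<in> carrier (GL n) \<and> (\<exists>f\<in>S U. f A \<noteq> 0)" if "U \<in> K" for U A
    using S[rule_format, OF that] by auto
  have "\<Union> K = {A \<in> carrier (GL n). \<exists>f\<in>(\<Union>U\<in>K. S U). f A \<noteq> 0}"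
  proof (intro equalityI subsetI)
    fix A assume "A \<in> \<Union> K"
    then obtain U where "U \<in> K" "A \<in> U"
      by blast
    then show "A \<in> {A \<in> carrier (GL n). \<exists>f\<in>(\<Union>U\<in>K. S U). f A \<noteq> 0}"
      using mem[of U A] by blast
  next
    fix A assume "A \<in> {A \<in> carrier (GL n). \<exists>f\<in>(\<Union>U\<in>K. S U). f A \<noteq> 0}"
    then obtain U f where "A \<in> carrier (GL n)" "U \<in> K" "f \<in> S U" "f A \<noteq> 0"
      by blast
    then show "A \<in> \<Union> K"
      using mem[of U A] by blast
  qed
  moreover have "(\<Union>U\<in>K. S U) \<subseteq> mat_poly_funs n"
    using S[THEN bspec, THEN conjunct1] by (rule UN_least)
  ultimately show "zariski_open n (\<Union> K)"
    unfolding zariski_open_def by blast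
qed

lemma openin_zariski: "openin (zariski n) U \<longleftrightarrow> zariski_open n U"
  unfolding zariski_def by (simp add: topology_inverse' istopology_zariski_open)

lemma topspace_zariski: "topspace (zariski n) = (carrier (GL n) :: 'a::field mat set)"
proof
  show "topspace (zariski n) \<subseteq> (carrier (GL n) :: 'a mat set)"
    unfolding topspace_def openin_zariski zariski_open_def by blast
  have "(carrier (GL n) :: 'a mat set) =
      {A \<in> carrier (GL n). \<exists>f\<in>{\<lambda>A\<in>carrier_mat n n. 1}. f A \<noteq> (0 :: 'a)}"
    using carrier_GL_subset by auto
  moreover have "(\<lambda>A\<in>carrier_mat n n. 1) \<in> (mat_poly_funs n :: ('a mat \<Rightarrow> 'a) set)"
    unfolding mat_poly_funs_def by (rule poly_funs_const)
  ultimately have "zariski_open n (carrier (GL n) :: 'a mat set)"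
    unfolding zariski_open_def by blast
  then show "(carrier (GL n) :: 'a mat set) \<subseteq> topspace (zariski n)"
    unfolding topspace_def openin_zariski by blast
qed

definition linear_algebraic_group :: "nat \<Rightarrow> 'a::field mat set \<Rightarrow> bool" where
  "linear_algebraic_group n G \<longleftrightarrow> subgroup G (GL n) \<and> closedin (zariski n) G"

abbreviation subgroup_of_GL :: "nat \<Rightarrow> 'a::field mat set \<Rightarrow> 'a mat monoid" where
  "subgroup_of_GL n G \<equiv> (GL n)\<lparr>carrier := G\<rparr>"

definition identity_component :: "nat \<Rightarrow> 'a::field mat set \<Rightarrow> 'a mat set" where
  "identity_component n G = connected_component_of_set (subtopology (zariski n) G) (1\<^sub>m n)"

text \<open>
  The coordinate ring of a closed subgroup \<open>G\<close> of \<open>GL n\<close> is generated by the matrix entries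
  and the inverse of the determinant.
\<close>

definition regular_on :: "nat \<Rightarrow> 'a::field mat set \<Rightarrow> ('a mat \<Rightarrow> 'a) \<Rightarrow> bool" where
  "regular_on n G f \<longleftrightarrow>
     (\<exists>q \<in> mat_poly_funs n. \<exists>k. \<forall>A\<in>G. f A = q A * inverse (det A) ^ k)"

definition algebraic_hom ::
    "nat \<Rightarrow> 'a::field mat set \<Rightarrow> nat \<Rightarrow> 'a mat set \<Rightarrow> ('a mat \<Rightarrow> 'a mat) \<Rightarrow> bool" where
  "algebraic_hom n G m H \<phi> \<longleftrightarrow>
     \<phi> \<in> hom (subgroup_of_GL n G) (subgroup_of_GL m H) \<and>
     (\<forall>i<m. \<forall>j<m. regular_on n G (\<lambda>A. \<phi> A $$ (i, j)))"

definition algebraic_isomorphic ::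
    "nat \<Rightarrow> 'a::field mat set \<Rightarrow> nat \<Rightarrow> 'a mat set \<Rightarrow> bool" where
  "algebraic_isomorphic n G m H \<longleftrightarrow>
     (\<exists>\<phi> \<psi>. algebraic_hom n G m H \<phi> \<and> algebraic_hom m H n G \<psi> \<and>
        (\<forall>A\<in>G. \<psi> (\<phi> A) = A) \<and> (\<forall>B\<in>H. \<phi> (\<psi> B) = B))"

definition diagonal_group :: "nat \<Rightarrow> 'a::field mat set" where
  "diagonal_group r = {A \<in> carrier (GL r). diagonal_mat A}"

definition is_torus :: "nat \<Rightarrow> 'a::field mat set \<Rightarrow> bool" where
  "is_torus n T \<longleftrightarrow> (\<exists>r. algebraic_isomorphic n T r (diagonal_group r))"

definition unipotent_mat :: "nat \<Rightarrow> 'a::field mat \<Rightarrow> bool" where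
  "unipotent_mat n A \<longleftrightarrow> (\<exists>k. (A - 1\<^sub>m n) ^\<^sub>m k = 0\<^sub>m n n)"

text \<open>Triviality of the unipotent radical, the largest closed connected normal unipotent subgroup.\<close>

definition reductive :: "nat \<Rightarrow> 'a::field mat set \<Rightarrow> bool" where
  "reductive n G \<longleftrightarrow> linear_algebraic_group n G \<and>
     (\<forall>U. U \<lhd> subgroup_of_GL n G \<and> closedin (zariski n) U \<and> connectedin (zariski n) U \<and>
        (\<forall>A\<in>U. unipotent_mat n A) \<longrightarrow> U = {1\<^sub>m n})"

definition sylow_subgroup :: "nat \<Rightarrow> 'g set \<Rightarrow> ('g, 'b) monoid_scheme \<Rightarrow> bool" where
  "sylow_subgroup p P K \<longleftrightarrow> subgroup P K \<and> card P = p ^ multiplicity p (Coset.order K)"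


section \<open>Invariants and the \<open>\<delta>\<close>-number\<close>

text \<open>A \<open>G\<close>-module is given in coordinates: \<open>V = carrier_vec m\<close>, with action \<open>\<rho> g *\<^sub>v v\<close>.\<close>

definition rational_rep :: "nat \<Rightarrow> 'a::field mat set \<Rightarrow> nat \<Rightarrow> ('a mat \<Rightarrow> 'a mat) \<Rightarrow> bool" where
  "rational_rep n G m \<rho> \<longleftrightarrow> algebraic_hom n G m (carrier (GL m)) \<rho>"

definition fun_action ::
    "nat \<Rightarrow> nat \<Rightarrow> ('a::field mat \<Rightarrow> 'a mat) \<Rightarrow> 'a mat \<Rightarrow> ('a vec \<Rightarrow> 'a) \<Rightarrow> 'a vec \<Rightarrow> 'a" where
  "fun_action n m \<rho> g f = (\<lambda>v\<in>carrier_vec m. f (\<rho> (inv\<^bsub>GL n\<^esub> g) *\<^sub>v v))"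

definition invariants ::
    "nat \<Rightarrow> 'a::field mat set \<Rightarrow> nat \<Rightarrow> ('a mat \<Rightarrow> 'a mat) \<Rightarrow> ('a vec \<Rightarrow> 'a) set" where
  "invariants n G m \<rho> = {f \<in> vec_poly_funs m. \<forall>g\<in>G. fun_action n m \<rho> g f = f}"

definition invariants_le ::
    "nat \<Rightarrow> 'a::field mat set \<Rightarrow> nat \<Rightarrow> ('a mat \<Rightarrow> 'a mat) \<Rightarrow> nat \<Rightarrow> ('a vec \<Rightarrow> 'a) set" where
  "invariants_le n G m \<rho> d = invariants n G m \<rho> \<inter> vec_poly_funs_le m d"

text \<open>The constant term of a polynomial function is its value at the origin.\<close>

definition const_term_zero :: "nat \<Rightarrow> ('a::field vec \<Rightarrow> 'a) set \<Rightarrow> ('a vec \<Rightarrow> 'a) set" where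
  "const_term_zero m S = {f \<in> S. f (0\<^sub>v m) = 0}"

definition nullcone ::
    "nat \<Rightarrow> 'a::field mat set \<Rightarrow> nat \<Rightarrow> ('a mat \<Rightarrow> 'a mat) \<Rightarrow> 'a vec set" where
  "nullcone n G m \<rho> =
     {v \<in> carrier_vec m. \<forall>f \<in> const_term_zero m (invariants n G m \<rho>). f v = 0}"

definition fixed_vecs :: "'a::field mat set \<Rightarrow> nat \<Rightarrow> ('a mat \<Rightarrow> 'a mat) \<Rightarrow> 'a vec set" where
  "fixed_vecs G m \<rho> = {v \<in> carrier_vec m. \<forall>g\<in>G. \<rho> g *\<^sub>v v = v}"

definition delta_set ::
    "nat \<Rightarrow> 'a::field mat set \<Rightarrow> nat \<Rightarrow> ('a mat \<Rightarrow> 'a mat) \<Rightarrow> ('a vec \<Rightarrow> 'a) set \<Rightarrow> bool" where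
  "delta_set n G m \<rho> S \<longleftrightarrow> S \<subseteq> invariants n G m \<rho> \<and>
     (\<forall>v \<in> fixed_vecs G m \<rho> - nullcone n G m \<rho>. \<exists>f \<in> const_term_zero m S. f v \<noteq> 0)"

definition delta_rep ::
    "nat \<Rightarrow> 'a::field mat set \<Rightarrow> nat \<Rightarrow> ('a mat \<Rightarrow> 'a mat) \<Rightarrow> enat" where
  "delta_rep n G m \<rho> = Inf {enat d | d. delta_set n G m \<rho> (invariants_le n G m \<rho> d)}"

definition delta_group :: "nat \<Rightarrow> 'a::field mat set \<Rightarrow> enat" where
  "delta_group n G = Sup {delta_rep n G m \<rho> | m \<rho>. rational_rep n G m \<rho>}"

end

theory Submission
  imports Defs "HOL-Algebra.Group_Action"
begin

text \<open>
  Let \<open>T\<close> be the identity component and \<open>F = G/T\<close>, which is finite because the Zariski topology is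
  noetherian. Parametrize \<open>T\<close> by a product of \<open>r\<close> copies of the multiplicative group. Averaging a
  Laurent polynomial over the \<open>N\<close>-torsion points, for large \<open>N\<close> prime to \<open>p\<close>, extracts one of its coefficients, and this is all the
  representation theory of tori that is needed.

  Upper bound: for \<open>0 \<noteq> v \<in> V\<^sup>G\<close>, averaging a coordinate function gives a \<open>T\<close>-invariant functional \<open>l\<close>
  with \<open>l(v) \<noteq> 0\<close>. Its translates \<open>l\<^sub>C\<close> are indexed by \<open>C \<in> F\<close>, and the sum over the cosets \<open>D\<close> of \<open>P\<close> of
  \<open>\<Prod>C\<in>D. l\<^sub>C\<close> is an invariant of degree \<open>|P|\<close> with value \<open>[F:P] l(v)\<^bsup>|P|\<^esup> \<noteq> 0\<close> at \<open>v\<close>.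

  Lower bound: take \<open>V = k[F]\<close> and \<open>v = (1,\<dots>,1)\<close>. The coefficients of an invariant are constant on the
  \<open>P\<close>-orbits of exponents. An orbit is a fixed point or has length divisible by \<open>p\<close>, and a nonzero
  fixed exponent has degree at least \<open>|P|\<close> because \<open>P\<close> acts freely on the coordinates. So in degree
  below \<open>|P|\<close> only the constant term contributes to the value at \<open>v\<close>. That \<open>k[F]\<close> is a rational
  representation of \<open>G\<close> means that coset indicators are regular functions on \<open>G\<close>; these are products
  of functions built from \<open>T\<close>-weight vectors that vanish on one coset and nowhere on another.
\<close>


section \<open>Finite linear combinations of functions\<close>

text \<open>The finite sums over torsion points take the place of a Reynolds operator for the torus.
  \<open>N\<close> is prime to \<open>p\<close> so that there are exactly \<open>N\<close> roots of
  unity, and large so that no exponent other than the extracted one is congruent to it modulo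
  \<open>N\<close>. In the upper bound two naive constructions fail: the sum of all translates of
  \<open>l\<close> vanishes at \<open>v\<close> when \<open>p\<close> divides the order of
  \<open>F\<close>, and their product has degree |F|. Multiplying inside the cosets of
  \<open>P\<close> and adding over the cosets avoids both, because \<open>v\<close> is fixed by all
  of \<open>G\<close>, so that every translate takes the same value there, and because the number of
  cosets of a Sylow subgroup is nonzero in the field. In the lower bound the obstacle is
  rationality: \<open>G\<close> is only given as a closed set of matrices, and a polynomial that
  vanishes on one coset of \<open>T\<close> still varies along the others. Averaging reduces this
  variation to a character of \<open>T\<close>, and a second factor, obtained through matrix
  inversion, cancels the character. A trivial identity component is handled as a torus of rank 0,
  which leaves a single argument for both alternatives.\<close>

definition lincomb :: "'m set \<Rightarrow> ('m \<Rightarrow> 'b \<Rightarrow> 'a::comm_semiring_1) \<Rightarrow> 'b set \<Rightarrow> ('b \<Rightarrow> 'a) \<Rightarrow> bool" where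
  "lincomb M \<phi> X f \<longleftrightarrow>
     (\<exists>A c. finite A \<and> A \<subseteq> M \<and> (\<forall>b\<in>X. f b = (\<Sum>a\<in>A. c a * \<phi> a b)))"

lemma lincomb_cong:
  "lincomb M \<phi> X f \<Longrightarrow> (\<And>b. b \<in> X \<Longrightarrow> g b = f b) \<Longrightarrow> lincomb M \<phi> X g"
  unfolding lincomb_def by (elim exE conjE) (intro exI conjI, auto)

lemma lincomb_mono: "lincomb M \<phi> X f \<Longrightarrow> M \<subseteq> M' \<Longrightarrow> lincomb M' \<phi> X f"
  unfolding lincomb_def by (meson order_trans)

lemma lincomb_base: "a \<in> M \<Longrightarrow> lincomb M \<phi> X (\<lambda>b. c * \<phi> a b)"
  unfolding lincomb_def by (intro exI[of _ "{a}"] exI[of _ "\<lambda>_. c"]) auto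

lemma lincomb_zero: "lincomb M \<phi> X (\<lambda>b. 0)"
  unfolding lincomb_def by (intro exI[of _ "{}"]) auto

lemma lincomb_add:
  assumes "lincomb M \<phi> X f" and "lincomb M \<phi> X g"
  shows "lincomb M \<phi> X (\<lambda>b. f b + g b)"
proof -
  obtain A c where A: "finite A" "A \<subseteq> M" "\<forall>b\<in>X. f b = (\<Sum>a\<in>A. c a * \<phi> a b)"
    using assms(1) unfolding lincomb_def by blast
  obtain B d where B: "finite B" "B \<subseteq> M" "\<forall>b\<in>X. g b = (\<Sum>a\<in>B. d a * \<phi> a b)"
    using assms(2) unfolding lincomb_def by blast
  define e where "e = (\<lambda>a. (if a \<in> A then c a else 0) + (if a \<in> B then d a else 0))"
  have "f b + g b = (\<Sum>a\<in>A \<union> B. e a * \<phi> a b)" if "b \<in> X" for b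
  proof -
    have "f b = (\<Sum>a\<in>A \<union> B. (if a \<in> A then c a else 0) * \<phi> a b)"
      using A B that by (auto intro!: sum.mono_neutral_cong_left)
    moreover have "g b = (\<Sum>a\<in>A \<union> B. (if a \<in> B then d a else 0) * \<phi> a b)"
      using A B that by (auto intro!: sum.mono_neutral_cong_left)
    ultimately show ?thesis
      by (simp add: e_def sum.distrib distrib_right)
  qed
  then show ?thesis
    unfolding lincomb_def using A B by (intro exI[of _ "A \<union> B"] exI[of _ e]) auto
qed

lemma lincomb_sum:
  assumes "\<And>j. j \<in> J \<Longrightarrow> lincomb M \<phi> X (f j)"
  shows "lincomb M \<phi> X (\<lambda>b. \<Sum>j\<in>J. f j b)"
  using assms
  by (induction J rule: infinite_finite_induct) (auto intro: lincomb_add lincomb_zero)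

text \<open>The index sets of the factors and of the product may differ. This lets a bound encoded
  in the index set change under multiplication: degree bounds \<open>d\<close> and \<open>e\<close>
  become \<open>d + e\<close>.\<close>

lemma lincomb_mult:
  assumes f: "lincomb M \<phi> X f" and g: "lincomb M' \<phi> X g"
    and prod: "\<And>a a'. a \<in> M \<Longrightarrow> a' \<in> M' \<Longrightarrow> \<exists>a''\<in>M''. \<forall>b\<in>X. \<phi> a b * \<phi> a' b = \<phi> a'' b"
  shows "lincomb M'' \<phi> X (\<lambda>b. f b * g b)"
proof -
  obtain A c where A: "finite A" "A \<subseteq> M" "\<forall>b\<in>X. f b = (\<Sum>a\<in>A. c a * \<phi> a b)"
    using f unfolding lincomb_def by blast
  obtain B d where B: "finite B" "B \<subseteq> M'" "\<forall>b\<in>X. g b = (\<Sum>a\<in>B. d a * \<phi> a b)"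
    using g unfolding lincomb_def by blast
  have 1: "lincomb M'' \<phi> X (\<lambda>b. (c a * d a') * (\<phi> a b * \<phi> a' b))" if aa': "a \<in> A" "a' \<in> B" for a a'
  proof -
    obtain a'' where a'': "a'' \<in> M''" "\<forall>b\<in>X. \<phi> a b * \<phi> a' b = \<phi> a'' b"
      using prod[of a a'] A(2) B(2) aa' by blast
    show ?thesis
      by (rule lincomb_cong[OF lincomb_base[OF a''(1), of _ _ "c a * d a'"]]) (use a'' in simp)
  qed
  have "lincomb M'' \<phi> X (\<lambda>b. \<Sum>a\<in>A. \<Sum>a'\<in>B. (c a * d a') * (\<phi> a b * \<phi> a' b))"
    by (intro lincomb_sum 1)
  then show ?thesis
    by (rule lincomb_cong) (simp add: A B sum_product mult_ac)
qed


section \<open>Algebras of polynomial functions\<close>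

definition monom_fun :: "'i set \<Rightarrow> ('i \<Rightarrow> 'b \<Rightarrow> 'a::comm_semiring_1) \<Rightarrow> ('i \<Rightarrow> nat) \<Rightarrow> 'b \<Rightarrow> 'a" where
  "monom_fun I x \<alpha> b = (\<Prod>i\<in>I. x i b ^ \<alpha> i)"

lemma poly_funs_le_iff:
  "f \<in> poly_funs_le X I x d \<longleftrightarrow>
     f \<in> extensional X \<and> lincomb {\<alpha>. sum \<alpha> I \<le> d} (monom_fun I x) X f"
  unfolding poly_funs_le_def lincomb_def monom_fun_def by (auto simp: subset_iff)

lemma lincomb_monom_mult:
  assumes "lincomb {\<alpha>. sum \<alpha> I \<le> d} (monom_fun I x) X f"
    and "lincomb {\<alpha>. sum \<alpha> I \<le> e} (monom_fun I x) X g"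
  shows "lincomb {\<alpha>. sum \<alpha> I \<le> d + e} (monom_fun I x) X (\<lambda>b. f b * g b)"
  by (rule lincomb_mult[OF assms], rule_tac x = "\<lambda>i. a i + a' i" in bexI)
     (auto simp: monom_fun_def power_add prod.distrib sum.distrib)

lemma lincomb_monom_const:
  "lincomb {\<alpha>. sum \<alpha> I \<le> d} (monom_fun I x) X (\<lambda>b. c)"
  by (rule lincomb_cong[OF lincomb_base[of "\<lambda>_. 0" _ _ _ c]]) (auto simp: monom_fun_def)

lemma lincomb_monom_coord:
  assumes "finite I" "i \<in> I"
  shows "lincomb {\<alpha>. sum \<alpha> I \<le> Suc 0} (monom_fun I x) X (x i)"
proof (rule lincomb_cong[OF lincomb_base[of "\<lambda>j. if j = i then 1 else 0" _ _ _ 1]])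
  show "x i b = 1 * monom_fun I x (\<lambda>j. if j = i then 1 else 0) b" for b
  proof -
    have "(\<Prod>j\<in>I. x j b ^ (if j = i then 1 else 0)) = (\<Prod>j\<in>I. if j = i then x j b else 1)"
      by (intro prod.cong) auto
    then show ?thesis
      using assms by (simp add: monom_fun_def)
  qed
qed (use assms in auto)

text \<open>Source of the degree |P|: a product of functions of degree at most 1, one for each
  element of a coset of \<open>P\<close>.\<close>

lemma lincomb_monom_prod:
  assumes "\<And>j. j \<in> J \<Longrightarrow> lincomb {\<alpha>. sum \<alpha> I \<le> Suc 0} (monom_fun I x) X (f j)"
  shows "lincomb {\<alpha>. sum \<alpha> I \<le> card J} (monom_fun I x) X (\<lambda>b. \<Prod>j\<in>J. f j b)"
  using assms
proof (induction J rule: infinite_finite_induct)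
  case (insert j J)
  then have "lincomb {\<alpha>. sum \<alpha> I \<le> Suc 0 + card J} (monom_fun I x) X (\<lambda>b. f j b * (\<Prod>j\<in>J. f j b))"
    by (intro lincomb_monom_mult) auto
  with insert show ?case
    by simp
qed (use lincomb_monom_const[where d = 0] in auto)

text \<open>Functions on the whole type, not extensional ones, so that pointwise sums and products
  stay inside. The conversions from and to \<open>poly_funs\<close> follow below.\<close>

inductive_set poly_algebra :: "'i set \<Rightarrow> ('i \<Rightarrow> 'b \<Rightarrow> 'a::comm_ring_1) \<Rightarrow> ('b \<Rightarrow> 'a) set"
  for I x where
  const: "(\<lambda>_. c) \<in> poly_algebra I x"
| coord: "i \<in> I \<Longrightarrow> (\<lambda>b. x i b) \<in> poly_algebra I x"
| add: "f \<in> poly_algebra I x \<Longrightarrow> g \<in> poly_algebra I x \<Longrightarrow> (\<lambda>b. f b + g b) \<in> poly_algebra I x"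
| mult: "f \<in> poly_algebra I x \<Longrightarrow> g \<in> poly_algebra I x \<Longrightarrow> (\<lambda>b. f b * g b) \<in> poly_algebra I x"

lemma poly_algebra_sum:
  "(\<And>j. j \<in> J \<Longrightarrow> f j \<in> poly_algebra I x) \<Longrightarrow> (\<lambda>b. \<Sum>j\<in>J. f j b) \<in> poly_algebra I x"
  by (induction J rule: infinite_finite_induct) (auto intro: poly_algebra.intros)

lemma poly_algebra_prod:
  "(\<And>j. j \<in> J \<Longrightarrow> f j \<in> poly_algebra I x) \<Longrightarrow> (\<lambda>b. \<Prod>j\<in>J. f j b) \<in> poly_algebra I x"
  by (induction J rule: infinite_finite_induct) (auto intro: poly_algebra.intros)

lemma poly_algebra_power:
  "f \<in> poly_algebra I x \<Longrightarrow> (\<lambda>b. f b ^ k) \<in> poly_algebra I x"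
  by (induction k) (auto intro: poly_algebra.intros)

lemma poly_funs_imp_poly_algebra:
  fixes x :: "'i \<Rightarrow> 'b \<Rightarrow> 'a::comm_ring_1"
  assumes "f \<in> poly_funs X I x"
  shows "\<exists>g\<in>poly_algebra I x. \<forall>b\<in>X. f b = g b"
proof -
  obtain A c where A: "\<forall>b\<in>X. f b = (\<Sum>\<alpha>\<in>A. c \<alpha> * (\<Prod>i\<in>I. x i b ^ \<alpha> i))"
    using assms unfolding poly_funs_def poly_funs_le_def by auto
  have "(\<lambda>b. \<Sum>\<alpha>\<in>A. c \<alpha> * (\<Prod>i\<in>I. x i b ^ \<alpha> i)) \<in> poly_algebra I x"
    by (intro poly_algebra_sum poly_algebra_prod poly_algebra_power poly_algebra.intros)
  with A show ?thesis
    by (rule bexI)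
qed

lemma poly_algebra_imp_poly_funs:
  fixes x :: "'i \<Rightarrow> 'b \<Rightarrow> 'a::comm_ring_1"
  assumes "finite I" "g \<in> poly_algebra I x"
  shows "restrict g X \<in> poly_funs X I x"
proof -
  have "\<exists>d. lincomb {\<alpha>. sum \<alpha> I \<le> d} (monom_fun I x) X g"
    using assms(2)
  proof induction
    case (coord i)
    then show ?case
      using lincomb_monom_coord[OF assms(1), of i x X] by (auto simp: eta_contract_eq)
  next
    case (add f g)
    then obtain d e where
      "lincomb {\<alpha>. sum \<alpha> I \<le> d} (monom_fun I x) X f" "lincomb {\<alpha>. sum \<alpha> I \<le> e} (monom_fun I x) X g"
      by blast
    then have "lincomb {\<alpha>. sum \<alpha> I \<le> max d e} (monom_fun I x) X f"
      "lincomb {\<alpha>. sum \<alpha> I \<le> max d e} (monom_fun I x) X g"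
      by (auto elim!: lincomb_mono)
    then show ?case
      by (blast intro: lincomb_add)
  qed (blast intro: lincomb_monom_const lincomb_monom_mult)+
  then obtain d where "lincomb {\<alpha>. sum \<alpha> I \<le> d} (monom_fun I x) X g"
    by blast
  then have "lincomb {\<alpha>. sum \<alpha> I \<le> d} (monom_fun I x) X (restrict g X)"
    by (rule lincomb_cong) auto
  then show ?thesis
    unfolding poly_funs_def using poly_funs_le_iff by fastforce
qed


section \<open>Hilbert's basis theorem for algebras of functions\<close>

inductive_set ideal_span :: "('b \<Rightarrow> 'a::comm_ring_1) set \<Rightarrow> ('b \<Rightarrow> 'a) set \<Rightarrow> ('b \<Rightarrow> 'a) set"
  for R S where
  zero: "(\<lambda>_. 0) \<in> ideal_span R S"
| step: "r \<in> R \<Longrightarrow> s \<in> S \<Longrightarrow> f \<in> ideal_span R S \<Longrightarrow> (\<lambda>b. r b * s b + f b) \<in> ideal_span R S"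

definition fun_algebra :: "('b \<Rightarrow> 'a::comm_ring_1) set \<Rightarrow> bool" where
  "fun_algebra R \<longleftrightarrow> (\<forall>c. (\<lambda>_. c) \<in> R) \<and>
     (\<forall>f\<in>R. \<forall>g\<in>R. (\<lambda>b. f b + g b) \<in> R \<and> (\<lambda>b. f b * g b) \<in> R)"

text \<open>The ascending chain condition, stated for sequences of functions. This is the form in
  which it meets a descending chain of closed sets.\<close>

definition noetherian_algebra :: "('b \<Rightarrow> 'a::comm_ring_1) set \<Rightarrow> bool" where
  "noetherian_algebra R \<longleftrightarrow>
     (\<forall>f. (\<forall>n::nat. f n \<in> R) \<longrightarrow> (\<exists>n. f n \<in> ideal_span R (f ` {..<n})))"

lemma ideal_span_mono:
  assumes "f \<in> ideal_span R S" "S \<subseteq> S'"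
  shows "f \<in> ideal_span R S'"
  using assms by induction (auto intro: ideal_span.intros)

lemma ideal_span_add:
  assumes "f \<in> ideal_span R S" "g \<in> ideal_span R S"
  shows "(\<lambda>b. f b + g b) \<in> ideal_span R S"
  using assms(1)
proof induction
  case (step r s f)
  then have "(\<lambda>b. r b * s b + (f b + g b)) \<in> ideal_span R S"
    by (intro ideal_span.step) auto
  then show ?case
    by (simp add: add.assoc)
qed (use assms in simp)

lemma ideal_span_scale:
  assumes "fun_algebra R" "r \<in> R" "f \<in> ideal_span R S"
  shows "(\<lambda>b. r b * f b) \<in> ideal_span R S"
  using assms(3)
proof induction
  case (step r' s f)
  then have "(\<lambda>b. (r b * r' b) * s b + r b * f b) \<in> ideal_span R S"
    using assms(1,2) by (intro ideal_span.step) (auto simp: fun_algebra_def)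
  then show ?case
    by (simp add: algebra_simps)
qed (simp add: ideal_span.zero)

lemma ideal_span_base:
  assumes "fun_algebra R" "s \<in> S"
  shows "s \<in> ideal_span R S"
  using ideal_span.step[of "\<lambda>_. 1" R s S "\<lambda>_. 0"] assms
  by (auto simp: fun_algebra_def ideal_span.zero)

lemma ideal_span_diff:
  assumes "fun_algebra R" "f \<in> ideal_span R S" "g \<in> ideal_span R S"
  shows "(\<lambda>b. f b - g b) \<in> ideal_span R S"
proof -
  have "(\<lambda>b. (-1) * g b) \<in> ideal_span R S"
    using assms by (intro ideal_span_scale[where r = "\<lambda>_. -1"]) (auto simp: fun_algebra_def)
  from ideal_span_add[OF assms(2) this] show ?thesis
    by simp
qed

lemma ideal_span_trans:
  assumes "fun_algebra R" "f \<in> ideal_span R S" "S \<subseteq> ideal_span R S'"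
  shows "f \<in> ideal_span R S'"
  using assms(2) by induction (use assms in \<open>auto intro!: ideal_span_add ideal_span.zero ideal_span_scale\<close>)

section \<open>Adjoining one generator: filtration by degree and Hilbert's argument\<close>

text \<open>A function has no degree in \<open>x\<close> of its own, since \<open>x\<close> may
  satisfy relations over \<open>R\<close>. What is bounded here is the degree of some representation
  with coefficients in \<open>R\<close>.\<close>

primrec deg_less :: "('b \<Rightarrow> 'a::comm_ring_1) set \<Rightarrow> ('b \<Rightarrow> 'a) \<Rightarrow> nat \<Rightarrow> ('b \<Rightarrow> 'a) set" where
  "deg_less R x 0 = {\<lambda>_. 0}"
| "deg_less R x (Suc d) = {\<lambda>b. a b * x b ^ d + g b | a g. a \<in> R \<and> g \<in> deg_less R x d}"

lemma deg_less_SucI: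
  "a \<in> R \<Longrightarrow> g \<in> deg_less R x d \<Longrightarrow> f = (\<lambda>b. a b * x b ^ d + g b) \<Longrightarrow> f \<in> deg_less R x (Suc d)"
  by auto

context
  fixes R :: "('b \<Rightarrow> 'a::comm_ring_1) set" and x :: "'b \<Rightarrow> 'a"
  assumes R: "fun_algebra R"
begin

lemma deg_less_Suc: "f \<in> deg_less R x d \<Longrightarrow> f \<in> deg_less R x (Suc d)"
  using R by (intro deg_less_SucI[of "\<lambda>_. 0" R f]) (auto simp: fun_algebra_def)

lemma deg_less_mono:
  assumes "f \<in> deg_less R x d" "d \<le> e"
  shows "f \<in> deg_less R x e"
  using assms(2,1) by (induction rule: dec_induct) (auto simp del: deg_less.simps intro: deg_less_Suc)

lemma deg_less_zero: "(\<lambda>_. 0) \<in> deg_less R x d"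
  using deg_less_mono[of "\<lambda>_. 0" 0 d] by simp

lemma deg_less_add:
  "f \<in> deg_less R x d \<Longrightarrow> g \<in> deg_less R x d \<Longrightarrow> (\<lambda>b. f b + g b) \<in> deg_less R x d"
proof (induction d arbitrary: f g)
  case (Suc d)
  then obtain a f' a' g' where
    "f = (\<lambda>b. a b * x b ^ d + f' b)" "a \<in> R" "f' \<in> deg_less R x d"
    "g = (\<lambda>b. a' b * x b ^ d + g' b)" "a' \<in> R" "g' \<in> deg_less R x d"
    by auto
  then show ?case
    using Suc.IH[of f' g'] R
    by (intro deg_less_SucI[of "\<lambda>b. a b + a' b" R "\<lambda>b. f' b + g' b"])
       (auto simp: fun_algebra_def algebra_simps)
qed simp

lemma deg_less_scale: "f \<in> deg_less R x d \<Longrightarrow> r \<in> R \<Longrightarrow> (\<lambda>b. r b * f b) \<in> deg_less R x d"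
proof (induction d arbitrary: f)
  case (Suc d)
  then obtain a f' where "f = (\<lambda>b. a b * x b ^ d + f' b)" "a \<in> R" "f' \<in> deg_less R x d"
    by auto
  then show ?case
    using Suc.IH[of f'] Suc.prems R
    by (intro deg_less_SucI[of "\<lambda>b. r b * a b" R "\<lambda>b. r b * f' b"])
       (auto simp: fun_algebra_def algebra_simps)
qed simp

lemma deg_less_diff:
  assumes "f \<in> deg_less R x d" "g \<in> deg_less R x d"
  shows "(\<lambda>b. f b - g b) \<in> deg_less R x d"
proof -
  have "(\<lambda>b. (-1) * g b) \<in> deg_less R x d"
    using R assms by (intro deg_less_scale[where r = "\<lambda>_. -1"]) (auto simp: fun_algebra_def)
  from deg_less_add[OF assms(1) this] show ?thesis
    by simp
qed

lemma deg_less_shift: "f \<in> deg_less R x d \<Longrightarrow> (\<lambda>b. x b * f b) \<in> deg_less R x (Suc d)"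
proof (induction d arbitrary: f)
  case 0
  then show ?case
    using deg_less_zero[of 1] by simp
next
  case (Suc d)
  then obtain a f' where f: "f = (\<lambda>b. a b * x b ^ d + f' b)" "a \<in> R" "f' \<in> deg_less R x d"
    by auto
  have "(\<lambda>b. x b * f b) = (\<lambda>b. a b * x b ^ Suc d + x b * f' b)"
    by (simp add: f algebra_simps)
  then show ?case
    by (rule deg_less_SucI[OF f(2) Suc.IH[OF f(3)]])
qed

lemma deg_less_shift_power:
  "f \<in> deg_less R x d \<Longrightarrow> (\<lambda>b. x b ^ k * f b) \<in> deg_less R x (d + k)"
proof (induction k)
  case (Suc k)
  then have "(\<lambda>b. x b * (x b ^ k * f b)) \<in> deg_less R x (Suc (d + k))"
    by (intro deg_less_shift)
  then show ?case
    by (simp add: mult.assoc del: deg_less.simps)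
qed simp

definition adjoin :: "('b \<Rightarrow> 'a) set" where
  "adjoin = (\<Union>d. deg_less R x d)"

lemma deg_less_subset_adjoin: "f \<in> deg_less R x d \<Longrightarrow> f \<in> adjoin"
  unfolding adjoin_def by blast

lemma subset_adjoin: "r \<in> R \<Longrightarrow> r \<in> adjoin"
  by (rule deg_less_subset_adjoin[of _ 1]) auto

lemma adjoin_add: "f \<in> adjoin \<Longrightarrow> g \<in> adjoin \<Longrightarrow> (\<lambda>b. f b + g b) \<in> adjoin"
proof -
  assume "f \<in> adjoin" "g \<in> adjoin"
  then obtain d e where "f \<in> deg_less R x d" "g \<in> deg_less R x e"
    unfolding adjoin_def by blast
  then have "f \<in> deg_less R x (max d e)" "g \<in> deg_less R x (max d e)"
    by (auto elim: deg_less_mono)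
  then show ?thesis
    by (blast intro: deg_less_add deg_less_subset_adjoin)
qed

lemma adjoin_mult:
  assumes "f \<in> adjoin" "g \<in> adjoin"
  shows "(\<lambda>b. f b * g b) \<in> adjoin"
proof -
  obtain d e where de: "f \<in> deg_less R x d" "g \<in> deg_less R x e"
    using assms unfolding adjoin_def by blast
  from de(1) show ?thesis
  proof (induction d arbitrary: f)
    case 0
    then show ?case
      using deg_less_zero deg_less_subset_adjoin by auto
  next
    case (Suc d)
    then obtain a f' where f: "f = (\<lambda>b. a b * x b ^ d + f' b)" "a \<in> R" "f' \<in> deg_less R x d"
      by auto
    have "(\<lambda>b. a b * (x b ^ d * g b)) \<in> adjoin"
      by (rule deg_less_subset_adjoin, rule deg_less_scale, rule deg_less_shift_power)
         (use de f in auto)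
    from adjoin_add[OF this Suc.IH[OF f(3)]] show ?case
      by (simp add: f algebra_simps)
  qed
qed

lemma fun_algebra_adjoin: "fun_algebra adjoin"
  using R subset_adjoin adjoin_add adjoin_mult unfolding fun_algebra_def by auto

text \<open>Hilbert's proof, started from a sequence \<open>f\<close> none of whose members lies in
  the ideal of its predecessors. In the ideal \<open>I\<close> of all \<open>f n\<close> one picks
  functions \<open>h n\<close> of least degree outside the ideal of the earlier picks; the chain
  condition for their top coefficients in \<open>R\<close> allows the top term of some
  \<open>h N\<close> to be cancelled, against minimality.\<close>

lemma noetherian_adjoin:
  assumes noeth: "noetherian_algebra R"
  shows "noetherian_algebra adjoin"
  unfolding noetherian_algebra_def
proof (intro allI impI, rule ccontr)
  fix f :: "nat \<Rightarrow> 'b \<Rightarrow> 'a"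
  assume f: "\<forall>n. f n \<in> adjoin" and bad: "\<nexists>n. f n \<in> ideal_span adjoin (f ` {..<n})"
  define I where "I = ideal_span adjoin (range f)"
  have I_sub: "g \<in> adjoin" if "g \<in> I" for g
    using that unfolding I_def
  proof induction
    case zero
    then show ?case
      using fun_algebra_adjoin by (auto simp: fun_algebra_def)
  qed (use f in \<open>auto intro!: adjoin_add adjoin_mult\<close>)
  have I_finite: "\<exists>k. g \<in> ideal_span adjoin (f ` {..<k})" if "g \<in> I" for g
    using that unfolding I_def
  proof induction
    case (step r s g)
    then obtain k j where kj: "g \<in> ideal_span adjoin (f ` {..<k})" "s = f j"
      by auto
    have "g \<in> ideal_span adjoin (f ` {..<max k (Suc j)})"
      by (rule ideal_span_mono[OF kj(1)]) auto
    then have "(\<lambda>b. r b * s b + g b) \<in> ideal_span adjoin (f ` {..<max k (Suc j)})"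
      by (intro ideal_span.step step) (auto simp: kj)
    then show ?case ..
  qed (auto intro: ideal_span.zero)
  \<comment> \<open>Degrees belong to representations, so minimality is taken over the top exponents
    \<open>d\<close> of all representations of functions in \<open>I\<close> outside the ideal of
    \<open>S\<close>. The coefficient \<open>a\<close> may even be zero.\<close>
  define C where "C S d \<longleftrightarrow> (\<exists>a g. a \<in> R \<and> g \<in> deg_less R x d \<and>
      (\<lambda>b. a b * x b ^ d + g b) \<in> I - ideal_span adjoin S)" for S d
  define D where "D S = (LEAST d. C S d)" for S
  have C_ex: "\<exists>d'<d. C S d'" if g: "g \<in> I - ideal_span adjoin S" "g \<in> deg_less R x d" for g S d
  proof (cases d)
    case 0
    then show ?thesis
      using that by (auto simp: ideal_span.zero)
  next
    case (Suc d')
    then obtain a h where "a \<in> R" "h \<in> deg_less R x d'" "g = (\<lambda>b. a b * x b ^ d' + h b)"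
      using g(2) by auto
    then show ?thesis
      using g(1) Suc unfolding C_def by blast
  qed
  have step: "\<exists>y. y \<in> I - ideal_span adjoin S \<and>
      (\<exists>a g. a \<in> R \<and> g \<in> deg_less R x (D S) \<and> y = (\<lambda>b. a b * x b ^ D S + g b))"
    if S: "finite S" "S \<subseteq> I" for S
  proof -
    \<comment> \<open>Picking never stops: a finite \<open>S\<close> lies in the ideal of finitely
      many \<open>f i\<close>, and the next \<open>f k\<close> escapes that ideal.\<close>
    have "\<exists>k. S \<subseteq> ideal_span adjoin (f ` {..<k})"
      using S
    proof (induction S rule: finite_induct)
      case (insert s S)
      then obtain k l where kl: "S \<subseteq> ideal_span adjoin (f ` {..<k})"
          "s \<in> ideal_span adjoin (f ` {..<l})"
        using I_finite by blast
      have "insert s S \<subseteq> ideal_span adjoin (f ` {..<max k l})"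
        using kl by (auto elim!: ideal_span_mono)
      then show ?case ..
    qed simp
    then obtain k where "S \<subseteq> ideal_span adjoin (f ` {..<k})"
      by blast
    then have "f k \<notin> ideal_span adjoin S"
      using bad ideal_span_trans[OF fun_algebra_adjoin] by blast
    moreover have fk: "f k \<in> I"
      unfolding I_def by (rule ideal_span_base[OF fun_algebra_adjoin]) simp
    moreover obtain d where "f k \<in> deg_less R x d"
      using I_sub[OF fk] unfolding adjoin_def by blast
    ultimately have "\<exists>d. C S d"
      using C_ex[of "f k" S d] by blast
    then have "C S (D S)"
      unfolding D_def by (rule LeastI_ex)
    then show ?thesis
      unfolding C_def by blast
  qed
  define pick where "pick S = (SOME y. y \<in> I - ideal_span adjoin S \<and>
      (\<exists>a g. a \<in> R \<and> g \<in> deg_less R x (D S) \<and> y = (\<lambda>b. a b * x b ^ D S + g b)))" for S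
  define St where "St = rec_nat {} (\<lambda>_ S. insert (pick S) S)"
  define h where "h n = pick (St n)" for n
  have St: "St n = h ` {..<n}" for n
    by (induction n) (auto simp: St_def h_def lessThan_Suc)
  have St_I: "finite (St n) \<and> St n \<subseteq> I" for n
  proof (induction n)
    case (Suc n)
    have "pick (St n) \<in> I"
      unfolding pick_def using someI_ex[OF step[of "St n"]] Suc by blast
    with Suc show ?case
      by (auto simp: St_def)
  qed (simp add: St_def)
  define e where "e n = D (St n)" for n
  have h: "h n \<in> I - ideal_span adjoin (St n)"
      "\<exists>a g. a \<in> R \<and> g \<in> deg_less R x (e n) \<and> h n = (\<lambda>b. a b * x b ^ e n + g b)" for n
    using someI_ex[OF step[of "St n"]] St_I[of n] unfolding h_def pick_def e_def by blast+
  then have "\<forall>n. \<exists>a g. a \<in> R \<and> g \<in> deg_less R x (e n) \<and> h n = (\<lambda>b. a b * x b ^ e n + g b)"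
    by blast
  then obtain a g where ag: "\<And>n. a n \<in> R" "\<And>n. g n \<in> deg_less R x (e n)"
      "\<And>n. h n = (\<lambda>b. a n b * x b ^ e n + g n b)"
    unfolding choice_iff by blast
  \<comment> \<open>\<open>h n\<close> also avoids the smaller ideal of the picks before
    \<open>i\<close>, so it competed in the minimum that defines \<open>e i\<close>.\<close>
  have e_mono: "e i \<le> e n" if "i < n" for i n
  proof -
    have "h n \<notin> ideal_span adjoin (St i)"
      using h(1)[of n] that ideal_span_mono[of "h n" adjoin "St i" "St n"]
      by (auto simp: St image_mono)
    then have "C (St i) (e n)"
      unfolding C_def using ag[of n] h(1)[of n] by (intro exI[of _ "a n"] exI[of _ "g n"]) auto
    then show ?thesis
      unfolding e_def D_def[of "St i"] by (rule Least_le)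
  qed
  obtain N where N: "a N \<in> ideal_span R (a ` {..<N})"
    using noeth ag(1) unfolding noetherian_algebra_def by blast
  \<comment> \<open>A relation between top coefficients lifts to the picks: multiplying
    \<open>h i\<close> by \<open>x ^ (e N - e i)\<close> aligns all top terms at exponent
    \<open>e N\<close>. The exponent is legitimate by \<open>e_mono\<close>.\<close>
  have "\<exists>w\<in>deg_less R x (e N). (\<lambda>b. c b * x b ^ e N + w b) \<in> ideal_span adjoin (St N)"
    if "c \<in> ideal_span R (a ` {..<N})" for c
    using that
  proof induction
    case zero
    then show ?case
      using deg_less_zero[of "e N"] by (auto intro!: bexI[of _ "\<lambda>_. 0"] ideal_span.zero)
  next
    case (step r s c)
    then obtain w i where w: "w \<in> deg_less R x (e N)"
        "(\<lambda>b. c b * x b ^ e N + w b) \<in> ideal_span adjoin (St N)" and i: "i < N" "s = a i"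
      by auto
    define k where "k = e N - e i"
    have k: "e N = e i + k"
      using e_mono[OF i(1)] by (simp add: k_def)
    have gk: "(\<lambda>b. x b ^ k * g i b) \<in> deg_less R x (e N)"
      unfolding k by (intro deg_less_shift_power ag)
    have rk: "(\<lambda>b. r b * x b ^ k) \<in> adjoin"
      using deg_less_subset_adjoin[OF deg_less_scale[OF deg_less_shift_power[of "\<lambda>_. 1" 1 k], of r]]
        step(1) R by (auto simp: fun_algebra_def simp del: One_nat_def) (auto simp: fun_algebra_def)
    have hi: "h i \<in> St N"
      using i by (auto simp: St)
    have "(\<lambda>b. (r b * x b ^ k) * h i b + (c b * x b ^ e N + w b)) \<in> ideal_span adjoin (St N)"
      by (intro ideal_span.step rk hi w)
    moreover have "(\<lambda>b. (r b * x b ^ k) * h i b + (c b * x b ^ e N + w b)) =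
        (\<lambda>b. (r b * s b + c b) * x b ^ e N + (r b * (x b ^ k * g i b) + w b))"
      by (simp add: ag(3)[of i] k i algebra_simps power_add)
    moreover have "(\<lambda>b. r b * (x b ^ k * g i b) + w b) \<in> deg_less R x (e N)"
      by (intro deg_less_add deg_less_scale gk w step)
    ultimately show ?case
      by (intro bexI[of _ "\<lambda>b. r b * (x b ^ k * g i b) + w b"]) auto
  qed
  from this[OF N] obtain w where w: "w \<in> deg_less R x (e N)"
      "(\<lambda>b. a N b * x b ^ e N + w b) \<in> ideal_span adjoin (St N)"
    by blast
  \<comment> \<open>The top terms of \<open>h N\<close> and of the lift coincide, so their
    difference has smaller degree. It still lies outside the ideal of the earlier picks, because the
    lift lies inside and \<open>h N\<close> does not.\<close>
  define y where "y = (\<lambda>b. g N b - w b)"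
  have y: "y = (\<lambda>b. h N b - (a N b * x b ^ e N + w b))"
    by (simp add: y_def ag(3)[of N])
  have "y \<in> I"
    unfolding y I_def
  proof (rule ideal_span_diff[OF fun_algebra_adjoin])
    show "h N \<in> ideal_span adjoin (range f)"
      using h(1) unfolding I_def by blast
    show "(\<lambda>b. a N b * x b ^ e N + w b) \<in> ideal_span adjoin (range f)"
      by (rule ideal_span_trans[OF fun_algebra_adjoin w(2)]) (use St_I in \<open>auto simp: I_def\<close>)
  qed
  moreover have "y \<notin> ideal_span adjoin (St N)"
  proof
    assume "y \<in> ideal_span adjoin (St N)"
    from ideal_span_add[OF this w(2)] have "h N \<in> ideal_span adjoin (St N)"
      by (simp add: y)
    then show False
      using h(1) by blast
  qed
  moreover have "y \<in> deg_less R x (e N)"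
    unfolding y_def by (intro deg_less_diff ag w)
  ultimately obtain d where "d < e N" "C (St N) d"
    using C_ex by blast
  then show False
    unfolding e_def D_def using not_less_Least by blast
qed

end

lemma fun_algebra_poly_algebra: "fun_algebra (poly_algebra I x)"
  unfolding fun_algebra_def by (auto intro: poly_algebra.intros)

lemma poly_algebra_mono: "f \<in> poly_algebra I x \<Longrightarrow> I \<subseteq> J \<Longrightarrow> f \<in> poly_algebra J x"
  by (induction rule: poly_algebra.induct) (auto intro: poly_algebra.intros)

lemma poly_algebra_insert:
  "poly_algebra (insert i I) x = adjoin (poly_algebra I x) (x i)"
proof (intro equalityI subsetI)
  note R = fun_algebra_poly_algebra[of I x]
  fix f assume "f \<in> poly_algebra (insert i I) x"
  then show "f \<in> adjoin (poly_algebra I x) (x i)"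
  proof induction
    case (coord j)
    then consider "j = i" | "j \<in> I"
      by blast
    then show ?case
    proof cases
      case 1
      have "(\<lambda>b. x i b ^ 1 * 1) \<in> deg_less (poly_algebra I x) (x i) (1 + 1)"
        by (rule deg_less_shift_power[OF R]) (auto intro: poly_algebra.intros)
      from deg_less_subset_adjoin[OF R this] show ?thesis
        using 1 by simp
    qed (auto intro: subset_adjoin[OF R] poly_algebra.intros)
  qed (auto intro: subset_adjoin[OF R] adjoin_add[OF R] adjoin_mult[OF R] poly_algebra.intros)
next
  note R = fun_algebra_poly_algebra[of I x]
  fix f assume "f \<in> adjoin (poly_algebra I x) (x i)"
  then obtain d where "f \<in> deg_less (poly_algebra I x) (x i) d"
    unfolding adjoin_def[OF R] by blast
  then show "f \<in> poly_algebra (insert i I) x"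
  proof (induction d arbitrary: f)
    case (Suc d)
    then obtain a g where f: "f = (\<lambda>b. a b * x i b ^ d + g b)" "a \<in> poly_algebra I x"
        "g \<in> deg_less (poly_algebra I x) (x i) d"
      by auto
    show ?case
      unfolding f(1)
      by (intro poly_algebra.add poly_algebra.mult poly_algebra_power poly_algebra.coord
          Suc.IH f poly_algebra_mono[OF f(2)]) auto
  qed (simp add: poly_algebra.const)
qed

theorem noetherian_poly_algebra:
  fixes x :: "'i \<Rightarrow> 'b \<Rightarrow> 'a::field"
  assumes "finite I"
  shows "noetherian_algebra (poly_algebra I x)"
  using assms
proof induction
  case empty
  have const: "\<exists>c. f = (\<lambda>_. c)" if "f \<in> poly_algebra {} x" for f
    using that by induction auto
  show ?case
    unfolding noetherian_algebra_def
  proof (intro allI impI)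
    fix f :: "nat \<Rightarrow> 'b \<Rightarrow> 'a" assume "\<forall>n. f n \<in> poly_algebra {} x"
    then have "\<forall>n. \<exists>c. f n = (\<lambda>_. c)"
      using const by blast
    then obtain c where "\<forall>n. f n = (\<lambda>_. c n)"
      by (rule choice[THEN exE])
    then have c: "f n = (\<lambda>_. c n)" for n
      by blast
    show "\<exists>n. f n \<in> ideal_span (poly_algebra {} x) (f ` {..<n})"
    \<comment> \<open>The constants form a field: \<open>f 0\<close> either is zero, hence in the
      span of the empty set, or generates everything.\<close>
    proof (cases "c 0 = 0")
      case True
      then show ?thesis
        by (intro exI[of _ 0]) (simp add: c ideal_span.zero)
    next
      case False
      have "(\<lambda>b. (c 1 / c 0) * f 0 b + 0) \<in> ideal_span (poly_algebra {} x) (f ` {..<1})"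
        by (intro ideal_span.intros poly_algebra.const) auto
      then show ?thesis
        using False by (intro exI[of _ 1]) (simp add: c)
    qed
  qed
next
  case (insert i I)
  then show ?case
    by (simp add: poly_algebra_insert noetherian_adjoin fun_algebra_poly_algebra)
qed

lemma fun_algebraD:
  assumes "fun_algebra R"
  shows "(\<lambda>_. c) \<in> R"
    and "f \<in> R \<Longrightarrow> g \<in> R \<Longrightarrow> (\<lambda>b. f b + g b) \<in> R"
    and "f \<in> R \<Longrightarrow> g \<in> R \<Longrightarrow> (\<lambda>b. f b * g b) \<in> R"
  using assms unfolding fun_algebra_def by auto

lemma fun_algebra_sum:
  assumes "fun_algebra R"
  shows "(\<And>j. j \<in> J \<Longrightarrow> f j \<in> R) \<Longrightarrow> (\<lambda>b. \<Sum>j\<in>J. f j b) \<in> R"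
  by (induction J rule: infinite_finite_induct) (auto intro!: fun_algebraD[OF assms])

lemma fun_algebra_prod:
  assumes "fun_algebra R"
  shows "(\<And>j. j \<in> J \<Longrightarrow> f j \<in> R) \<Longrightarrow> (\<lambda>b. \<Prod>j\<in>J. f j b) \<in> R"
  by (induction J rule: infinite_finite_induct) (auto intro!: fun_algebraD[OF assms])

lemma fun_algebra_power:
  assumes "fun_algebra R"
  shows "f \<in> R \<Longrightarrow> (\<lambda>b. f b ^ k) \<in> R"
  by (induction k) (auto intro!: fun_algebraD[OF assms])

lemma poly_algebra_compose:
  assumes "fun_algebra R" "g \<in> poly_algebra I x" "\<And>i. i \<in> I \<Longrightarrow> (\<lambda>b. x i (\<phi> b)) \<in> R"
  shows "(\<lambda>b. g (\<phi> b)) \<in> R"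
  using assms(2) by induction (auto intro!: fun_algebraD[OF assms(1)] assms(3))

text \<open>The Leibniz sum stands in for \<open>det\<close>, so that no assumption on the
  dimensions of \<open>M b\<close> is necessary; \<open>det_def'\<close> identifies the two on
  square matrices of size \<open>m\<close>.\<close>

lemma fun_algebra_det:
  assumes "fun_algebra R" "\<And>i j. i < m \<Longrightarrow> j < m \<Longrightarrow> (\<lambda>b. M b $$ (i, j)) \<in> R"
  shows "(\<lambda>b. \<Sum>p\<in>{p. p permutes {0..<m}}. signof p * (\<Prod>i = 0..<m. M b $$ (i, p i))) \<in> R"
proof (intro fun_algebra_sum[OF assms(1)] fun_algebraD(3)[OF assms(1)] fun_algebraD(1)[OF assms(1)]
    fun_algebra_prod[OF assms(1)])
  fix p i assume "p \<in> {p. p permutes {0..<m}}" "i \<in> {0..<m}"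
  then show "(\<lambda>b. M b $$ (i, p i)) \<in> R"
    using permutes_in_image[of p "{0..<m}" i] by (intro assms(2)) auto
qed

lemma fun_algebra_matrix_mult:
  assumes "fun_algebra R"
    and "\<And>k. k < m \<Longrightarrow> (\<lambda>b. M b $$ (i, k)) \<in> R"
    and "\<And>k. k < m \<Longrightarrow> (\<lambda>b. N b $$ (k, j)) \<in> R"
  shows "(\<lambda>b. \<Sum>k<m. M b $$ (i, k) * N b $$ (k, j)) \<in> R"
  by (intro fun_algebra_sum[OF assms(1)] fun_algebraD(3)[OF assms(1)] assms(2,3)) auto

lemma index_mult_mat_sum:
  assumes "A \<in> carrier_mat n m" "B \<in> carrier_mat m l" "i < n" "j < l"
  shows "(A * B) $$ (i, j) = (\<Sum>k<m. A $$ (i, k) * B $$ (k, j))"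
  using assms by (auto simp: scalar_prod_def atLeast0LessThan intro!: sum.cong)


section \<open>Polynomial functions on matrices and the Zariski topology\<close>

abbreviation entry :: "nat \<times> nat \<Rightarrow> 'a mat \<Rightarrow> 'a" where
  "entry \<equiv> \<lambda>ij A. A $$ ij"

text \<open>Values off \<open>carrier_mat n n\<close> are unconstrained, whereas
  \<open>mat_poly_funs\<close> prescribes \<open>undefined\<close> there and is therefore not closed
  under pointwise operations.\<close>

definition mat_polynomials :: "nat \<Rightarrow> ('a::field mat \<Rightarrow> 'a) set" where
  "mat_polynomials n =
     {f. \<exists>g\<in>poly_algebra ({..<n} \<times> {..<n}) entry. \<forall>A\<in>carrier_mat n n. f A = g A}"

lemma mat_polynomials_cong:
  assumes "f \<in> mat_polynomials n" "\<And>A. A \<in> carrier_mat n n \<Longrightarrow> g A = f A"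
  shows "g \<in> mat_polynomials n"
  using assms unfolding mat_polynomials_def by auto

lemma fun_algebra_mat_polynomials: "fun_algebra (mat_polynomials n)"
  unfolding fun_algebra_def
proof (intro conjI ballI allI)
  fix f g :: "'a mat \<Rightarrow> 'a"
  assume "f \<in> mat_polynomials n" "g \<in> mat_polynomials n"
  then obtain f' g' where
    "f' \<in> poly_algebra ({..<n} \<times> {..<n}) entry" "\<forall>A\<in>carrier_mat n n. f A = f' A"
    "g' \<in> poly_algebra ({..<n} \<times> {..<n}) entry" "\<forall>A\<in>carrier_mat n n. g A = g' A"
    unfolding mat_polynomials_def by blast
  then show "(\<lambda>b. f b + g b) \<in> mat_polynomials n" "(\<lambda>b. f b * g b) \<in> mat_polynomials n"
    unfolding mat_polynomials_def
    by (auto intro: bexI[OF _ poly_algebra.add] bexI[OF _ poly_algebra.mult])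
qed (auto simp: mat_polynomials_def intro!: bexI[OF _ poly_algebra.const])

lemma entry_mat_polynomials: "i < n \<Longrightarrow> j < n \<Longrightarrow> (\<lambda>A. A $$ (i, j)) \<in> mat_polynomials n"
  unfolding mat_polynomials_def by (auto intro!: bexI[OF _ poly_algebra.coord])

lemma mat_poly_funs_subset: "f \<in> mat_poly_funs n \<Longrightarrow> f \<in> mat_polynomials n"
  unfolding mat_poly_funs_def mat_polynomials_def using poly_funs_imp_poly_algebra by blast

lemma restrict_mat_polynomials:
  assumes "f \<in> mat_polynomials n"
  shows "restrict f (carrier_mat n n) \<in> mat_poly_funs n"
proof -
  obtain g where g: "g \<in> poly_algebra ({..<n} \<times> {..<n}) entry" "\<forall>A\<in>carrier_mat n n. f A = g A"
    using assms unfolding mat_polynomials_def by blast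
  then have "restrict f (carrier_mat n n) = restrict g (carrier_mat n n)"
    by (auto simp: restrict_def)
  moreover have "restrict g (carrier_mat n n) \<in> mat_poly_funs n"
    unfolding mat_poly_funs_def by (rule poly_algebra_imp_poly_funs) (use g in auto)
  ultimately show ?thesis
    by simp
qed

text \<open>A single substitution principle, applied below to matrix polynomials, Laurent
  polynomials and regular functions. The hypothesis \<open>cong\<close> says that membership in
  \<open>R\<close> depends only on values on \<open>X\<close>.\<close>

lemma mat_polynomials_compose:
  assumes R: "fun_algebra R" and q: "q \<in> mat_polynomials n"
    and cong: "\<And>f g. f \<in> R \<Longrightarrow> (\<And>b. b \<in> X \<Longrightarrow> g b = f b) \<Longrightarrow> g \<in> R"
    and \<phi>: "\<And>b. b \<in> X \<Longrightarrow> \<phi> b \<in> carrier_mat n n"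
    and entries: "\<And>i j. i < n \<Longrightarrow> j < n \<Longrightarrow> (\<lambda>b. \<phi> b $$ (i, j)) \<in> R"
  shows "(\<lambda>b. q (\<phi> b)) \<in> R"
proof -
  obtain g where g: "g \<in> poly_algebra ({..<n} \<times> {..<n}) entry" "\<forall>A\<in>carrier_mat n n. q A = g A"
    using q unfolding mat_polynomials_def by blast
  have "(\<lambda>b. g (\<phi> b)) \<in> R"
    by (rule poly_algebra_compose[OF R g(1)]) (use entries in auto)
  then show ?thesis
    by (rule cong) (use g \<phi> in auto)
qed

lemma det_mat_polynomials: "det \<in> mat_polynomials n"
  by (rule mat_polynomials_cong[OF fun_algebra_det[OF fun_algebra_mat_polynomials]])
     (auto intro: entry_mat_polynomials simp: det_def')

lemma mat_polynomials_mult_left: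
  assumes "q \<in> mat_polynomials n" "B \<in> carrier_mat n n"
  shows "(\<lambda>A. q (B * A)) \<in> mat_polynomials n"
proof (rule mat_polynomials_compose[OF fun_algebra_mat_polynomials assms(1) mat_polynomials_cong,
      where X = "carrier_mat n n"])
  fix i j assume ij: "i < n" "j < n"
  have "(\<lambda>A. \<Sum>k<n. B $$ (i, k) * A $$ (k, j)) \<in> mat_polynomials n"
    by (rule fun_algebra_matrix_mult[OF fun_algebra_mat_polynomials])
       (use ij in \<open>auto intro: entry_mat_polynomials fun_algebraD[OF fun_algebra_mat_polynomials]\<close>)
  then show "(\<lambda>A. (B * A) $$ (i, j)) \<in> mat_polynomials n"
    by (rule mat_polynomials_cong) (use assms ij in \<open>auto simp: index_mult_mat_sum[of _ n n _ n] simp del: index_mult_mat\<close>)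
qed (use assms in auto)

lemma mat_polynomials_mult_right:
  assumes "q \<in> mat_polynomials n" "B \<in> carrier_mat n n"
  shows "(\<lambda>A. q (A * B)) \<in> mat_polynomials n"
proof (rule mat_polynomials_compose[OF fun_algebra_mat_polynomials assms(1) mat_polynomials_cong,
      where X = "carrier_mat n n"])
  fix i j assume ij: "i < n" "j < n"
  have "(\<lambda>A. \<Sum>k<n. A $$ (i, k) * B $$ (k, j)) \<in> mat_polynomials n"
    by (rule fun_algebra_matrix_mult[OF fun_algebra_mat_polynomials])
       (use ij in \<open>auto intro: entry_mat_polynomials fun_algebraD[OF fun_algebra_mat_polynomials]\<close>)
  then show "(\<lambda>A. (A * B) $$ (i, j)) \<in> mat_polynomials n"
    by (rule mat_polynomials_cong) (use assms ij in \<open>auto simp: index_mult_mat_sum[of _ n n _ n] simp del: index_mult_mat\<close>)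
qed (use assms in auto)

section \<open>The general linear group and its closed sets\<close>

lemma group_GL: "group (GL n :: 'a::field mat monoid)"
proof -
  interpret ring "ring_mat TYPE('a) n ()"
    by (rule ring_mat)
  show ?thesis
    unfolding GL_def by (rule units_group)
qed

lemma mult_GL [simp]: "monoid.mult (GL n) = (*)"
  by (simp add: GL_def units_of_def ring_mat_def)

lemma one_GL [simp]: "monoid.one (GL n) = 1\<^sub>m n"
  by (simp add: GL_def units_of_def ring_mat_def)

lemma carrier_GL_iff: "A \<in> carrier (GL n) \<longleftrightarrow> A \<in> carrier_mat n n \<and> det A \<noteq> 0"
proof
  assume A: "A \<in> carrier (GL n)"
  then show "A \<in> carrier_mat n n \<and> det A \<noteq> 0"
    using carrier_GL_subset[of n] unit_imp_det_non_zero[of A n "()"]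
    by (auto simp: GL_def units_of_def)
next
  assume "A \<in> carrier_mat n n \<and> det A \<noteq> 0"
  then show "A \<in> carrier (GL n)"
    using det_non_zero_imp_unit[of A n "()"] by (auto simp: GL_def units_of_def)
qed

text \<open>The adjugate formula is what later makes the entries of the inverse matrix regular
  functions.\<close>

lemma inv_GL:
  fixes A :: "'a::field mat"
  assumes "A \<in> carrier (GL n)"
  shows "inv\<^bsub>GL n\<^esub> A = inverse (det A) \<cdot>\<^sub>m adj_mat A"
proof -
  interpret group "GL n :: 'a mat monoid"
    by (rule group_GL)
  have A: "A \<in> carrier_mat n n" "det A \<noteq> 0"
    using assms by (auto simp: carrier_GL_iff)
  let ?B = "inverse (det A) \<cdot>\<^sub>m adj_mat A"
  have B: "?B \<in> carrier_mat n n" "A * ?B = 1\<^sub>m n"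
    using A adj_mat[OF A(1)] by (auto simp: mult_smult_distrib)
  have "det A * det ?B = 1"
    using det_mult[OF A(1) B(1)] B(2) by simp
  then have "?B \<in> carrier (GL n)"
    using B by (auto simp: carrier_GL_iff)
  then show ?thesis
    using inv_solve_left[of A "\<one>\<^bsub>GL n\<^esub>" ?B] B(2) assms by (metis inv_equality inv_inv inv_closed mult_GL one_GL)
qed

lemma closedin_zariski_iff:
  "closedin (zariski n) C \<longleftrightarrow>
     (\<exists>S\<subseteq>mat_polynomials n. C = {A \<in> carrier (GL n). \<forall>f\<in>S. f A = 0})"
proof
  assume "closedin (zariski n) C"
  then have C: "C \<subseteq> carrier (GL n)" "zariski_open n (carrier (GL n) - C)"
    by (auto simp: closedin_def topspace_zariski openin_zariski)
  then obtain S where S: "S \<subseteq> mat_poly_funs n"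
      "carrier (GL n) - C = {A \<in> carrier (GL n). \<exists>f\<in>S. f A \<noteq> 0}"
    unfolding zariski_open_def by blast
  have "C = {A \<in> carrier (GL n). \<forall>f\<in>S. f A = 0}"
    using S(2) C(1) by blast
  moreover have "S \<subseteq> mat_polynomials n"
    using S(1) mat_poly_funs_subset by blast
  ultimately show "\<exists>S\<subseteq>mat_polynomials n. C = {A \<in> carrier (GL n). \<forall>f\<in>S. f A = 0}"
    by blast
next
  assume "\<exists>S\<subseteq>mat_polynomials n. C = {A \<in> carrier (GL n). \<forall>f\<in>S. f A = 0}"
  then obtain S where S: "S \<subseteq> mat_polynomials n" "C = {A \<in> carrier (GL n). \<forall>f\<in>S. f A = 0}"
    by blast
  let ?S = "(\<lambda>f. restrict f (carrier_mat n n)) ` S"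
  have "?S \<subseteq> mat_poly_funs n"
    using S restrict_mat_polynomials by blast
  moreover have "carrier (GL n) - C = {A \<in> carrier (GL n). \<exists>f\<in>?S. f A \<noteq> 0}"
    using S(2) carrier_GL_subset[of n] by (auto simp: restrict_def)
  ultimately have "zariski_open n (carrier (GL n) - C)"
    unfolding zariski_open_def by blast
  then show "closedin (zariski n) C"
    using S(2) by (auto simp: closedin_def topspace_zariski openin_zariski)
qed

lemma continuous_map_mult_left:
  fixes B :: "'a::field mat"
  assumes "B \<in> carrier (GL n)"
  shows "continuous_map (zariski n) (zariski n) (\<lambda>A. B * A)"
proof -
  interpret group "GL n :: 'a mat monoid"
    by (rule group_GL)
  have B: "B \<in> carrier_mat n n"
    using assms carrier_GL_subset by blast
  have closed: "B * A \<in> carrier (GL n)" if "A \<in> carrier (GL n)" for A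
    using m_closed[OF assms that] by simp
  show ?thesis
    unfolding continuous_map_closedin topspace_zariski
  proof (intro conjI allI impI)
    fix C :: "'a mat set" assume "closedin (zariski n) C"
    then obtain S where S: "S \<subseteq> mat_polynomials n" "C = {A \<in> carrier (GL n). \<forall>f\<in>S. f A = 0}"
      unfolding closedin_zariski_iff by blast
    then show "closedin (zariski n) {A \<in> carrier (GL n). B * A \<in> C}"
      unfolding closedin_zariski_iff using closed mat_polynomials_mult_left[OF _ B]
      by (intro exI[of _ "(\<lambda>f A. f (B * A)) ` S"]) auto
  qed (use closed in auto)
qed

lemma continuous_map_mult_right:
  fixes B :: "'a::field mat"
  assumes "B \<in> carrier (GL n)"
  shows "continuous_map (zariski n) (zariski n) (\<lambda>A. A * B)"
proof -
  interpret group "GL n :: 'a mat monoid"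
    by (rule group_GL)
  have B: "B \<in> carrier_mat n n"
    using assms carrier_GL_subset by blast
  have closed: "A * B \<in> carrier (GL n)" if "A \<in> carrier (GL n)" for A
    using m_closed[OF that assms] by simp
  show ?thesis
    unfolding continuous_map_closedin topspace_zariski
  proof (intro conjI allI impI)
    fix C :: "'a mat set" assume "closedin (zariski n) C"
    then obtain S where S: "S \<subseteq> mat_polynomials n" "C = {A \<in> carrier (GL n). \<forall>f\<in>S. f A = 0}"
      unfolding closedin_zariski_iff by blast
    then show "closedin (zariski n) {A \<in> carrier (GL n). A * B \<in> C}"
      unfolding closedin_zariski_iff using closed mat_polynomials_mult_right[OF _ B]
      by (intro exI[of _ "(\<lambda>f A. f (A * B)) ` S"]) auto
  qed (use closed in auto)
qed

section \<open>The Zariski topology is noetherian\<close>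

text \<open>Along an infinite descending chain choose \<open>f i\<close> that vanishes on
  \<open>X (Suc i)\<close> but not at \<open>A i\<close> in \<open>X i\<close>. The chain condition
  puts some \<open>f k\<close> into the ideal of the earlier ones, all of which vanish at
  \<open>A k\<close>, so \<open>f k\<close> vanishes there too.\<close>

lemma wf_closedin_zariski:
  "wf {(C, D). closedin (zariski n) C \<and> closedin (zariski n) (D :: 'a::field mat set) \<and> C \<subset> D}"
  unfolding wf_iff_no_infinite_down_chain
proof
  assume "\<exists>X. \<forall>i. (X (Suc i), X i) \<in>
      {(C, D). closedin (zariski n) C \<and> closedin (zariski n) (D :: 'a mat set) \<and> C \<subset> D}"
  then obtain X :: "nat \<Rightarrow> 'a mat set" where
    "\<forall>i. closedin (zariski n) (X (Suc i)) \<and> closedin (zariski n) (X i) \<and> X (Suc i) \<subset> X i"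
    by auto
  then have X: "closedin (zariski n) (X i)" "X (Suc i) \<subset> X i" for i
    by auto
  have X_sub: "X i \<subseteq> carrier (GL n)" for i
    using closedin_subset[OF X(1)] by (simp add: topspace_zariski)
  have "\<exists>f A. f \<in> poly_algebra ({..<n} \<times> {..<n}) entry \<and> (\<forall>B\<in>X (Suc i). f B = 0) \<and>
      A \<in> X i \<and> f A \<noteq> 0" for i
  proof -
    obtain A where A: "A \<in> X i" "A \<notin> X (Suc i)"
      using X(2) by blast
    obtain S where S: "S \<subseteq> mat_polynomials n" "X (Suc i) = {A \<in> carrier (GL n). \<forall>f\<in>S. f A = 0}"
      using X(1)[of "Suc i"] unfolding closedin_zariski_iff by blast
    then obtain f where f: "f \<in> mat_polynomials n" "f A \<noteq> 0" "\<forall>B\<in>X (Suc i). f B = 0"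
      using A X_sub by blast
    then obtain g where "g \<in> poly_algebra ({..<n} \<times> {..<n}) entry" "\<forall>A\<in>carrier_mat n n. f A = g A"
      unfolding mat_polynomials_def by blast
    then show ?thesis
      using f A X_sub[of i] X_sub[of "Suc i"] carrier_GL_subset[of n]
      by (intro exI[of _ g] exI[of _ A]) (auto simp: subset_iff)
  qed
  then obtain f A where fA: "\<And>i. f i \<in> poly_algebra ({..<n} \<times> {..<n}) entry"
      "\<And>i. \<forall>B\<in>X (Suc i). f i B = 0" "\<And>i. A i \<in> X i" "\<And>i. f i (A i) \<noteq> 0"
    by metis
  obtain k where "f k \<in> ideal_span (poly_algebra ({..<n} \<times> {..<n}) entry) (f ` {..<k})"
    using noetherian_poly_algebra[of "{..<n} \<times> {..<n}" entry] fA(1)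
    unfolding noetherian_algebra_def by blast
  moreover have fz: "f i (A k) = 0" if "i < k" for i
  proof -
    have "X k \<subseteq> X (Suc i)"
      by (rule lift_Suc_antimono_le[of X]) (use X(2) that in auto)
    then show ?thesis
      using fA(2)[of i] fA(3)[of k] by blast
  qed
  have "g (A k) = 0"
    if "g \<in> ideal_span (poly_algebra ({..<n} \<times> {..<n}) entry) (f ` {..<k})" for g
    using that by induction (use fz in auto)
  ultimately show False
    using fA(4) by blast
qed

text \<open>Noetherian induction: a closed set that is not connected is the union of two strictly
  smaller closed sets.\<close>

lemma closedin_zariski_finite_union_connected:
  assumes "closedin (zariski n) (C :: 'a::field mat set)"
  shows "\<exists>\<C>. finite \<C> \<and> (\<forall>D\<in>\<C>. connectedin (zariski n) D) \<and> C = \<Union>\<C>"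
  using wf_closedin_zariski[of n, where 'a = 'a] assms
proof (induction C rule: wf_induct_rule)
  case (less C)
  show ?case
  proof (cases "connectedin (zariski n) C")
    case True
    then show ?thesis
      by (intro exI[of _ "{C}"]) auto
  next
    case False
    then obtain E1 E2 where E: "closedin (zariski n) E1" "closedin (zariski n) E2"
        "C \<subseteq> E1 \<union> E2" "E1 \<inter> E2 \<inter> C = {}" "E1 \<inter> C \<noteq> {}" "E2 \<inter> C \<noteq> {}"
      using closedin_subset[OF less.prems] unfolding connectedin_closedin by blast
    have cl: "closedin (zariski n) (E1 \<inter> C)" "closedin (zariski n) (E2 \<inter> C)"
      using E less.prems by auto
    have sub: "E1 \<inter> C \<subset> C" "E2 \<inter> C \<subset> C"
      using E by blast+
    obtain \<C>1 \<C>2 where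
      "finite \<C>1" "\<forall>D\<in>\<C>1. connectedin (zariski n) D" "E1 \<inter> C = \<Union>\<C>1"
      "finite \<C>2" "\<forall>D\<in>\<C>2. connectedin (zariski n) D" "E2 \<inter> C = \<Union>\<C>2"
      using less.IH[of "E1 \<inter> C"] less.IH[of "E2 \<inter> C"] cl sub less.prems by blast
    moreover have "C = (E1 \<inter> C) \<union> (E2 \<inter> C)"
      using E by blast
    ultimately show ?thesis
      by (intro exI[of _ "\<C>1 \<union> \<C>2"]) auto
  qed
qed


section \<open>The identity component\<close>

lemma mem_identity_component_iff:
  "A \<in> identity_component n G \<longleftrightarrow>
     (\<exists>C. connectedin (zariski n) C \<and> C \<subseteq> G \<and> 1\<^sub>m n \<in> C \<and> A \<in> C)"
  unfolding identity_component_def connected_component_of_set connectedin_subtopology by blast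

context
  fixes n :: nat and G :: "'a::field mat set"
  assumes G: "linear_algebraic_group n G"
begin

private lemma subgroup_G: "subgroup G (GL n)"
  using G by (simp add: linear_algebraic_group_def)

interpretation GLn: group "GL n :: 'a mat monoid"
  by (rule group_GL)

private lemma mem_G:
  assumes "A \<in> G"
  shows "A \<in> carrier (GL n)" "inv\<^bsub>GL n\<^esub> A \<in> G" "inv\<^bsub>GL n\<^esub> A \<in> carrier (GL n)"
  using assms subgroup.mem_carrier[OF subgroup_G] subgroup.m_inv_closed[OF subgroup_G] by auto

lemma identity_component_subset: "identity_component n G \<subseteq> G"
  using mem_identity_component_iff by blast

lemma one_mem_identity_component: "1\<^sub>m n \<in> identity_component n G"
proof -
  have "1\<^sub>m n \<in> G"
    using subgroup.one_closed[OF subgroup_G] by simp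
  moreover from this have "(1\<^sub>m n :: 'a mat) \<in> topspace (zariski n)"
    using subgroup.mem_carrier[OF subgroup_G] by (simp add: topspace_zariski)
  ultimately show ?thesis
    unfolding mem_identity_component_iff by (intro exI[of _ "{1\<^sub>m n}"]) auto
qed

lemma connectedin_identity_component: "connectedin (zariski n) (identity_component n G)"
  using connectedin_connected_component_of[of "subtopology (zariski n) G" "1\<^sub>m n"]
  unfolding identity_component_def connectedin_subtopology by blast

lemma connectedin_subset_identity_component:
  "connectedin (zariski n) C \<Longrightarrow> C \<subseteq> G \<Longrightarrow> 1\<^sub>m n \<in> C \<Longrightarrow> C \<subseteq> identity_component n G"
  using mem_identity_component_iff by blast

lemma closedin_identity_component: "closedin (zariski n) (identity_component n G)"
  unfolding identity_component_def
  by (rule closedin_trans_full[OF closedin_connected_component_of])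
     (use G in \<open>simp add: linear_algebraic_group_def\<close>)

text \<open>Translation by the inverse of \<open>A\<close> is continuous and sends \<open>A\<close>
  to the identity, so it carries the component to a connected subset of \<open>G\<close> through the
  identity, which lies in the component again.\<close>

lemma subgroup_identity_component: "subgroup (identity_component n G) (GL n)"
proof -
  have cl: "inv\<^bsub>GL n\<^esub> A * B \<in> identity_component n G"
    if AB: "A \<in> identity_component n G" "B \<in> identity_component n G" for A B
  proof -
    have A: "A \<in> G" "A \<in> carrier (GL n)" "inv\<^bsub>GL n\<^esub> A \<in> G" "inv\<^bsub>GL n\<^esub> A \<in> carrier (GL n)"
      using AB(1) identity_component_subset mem_G[of A] by auto
    let ?C = "(\<lambda>B. inv\<^bsub>GL n\<^esub> A * B) ` identity_component n G"
    have "connectedin (zariski n) ?C"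
      by (rule connectedin_continuous_map_image[OF continuous_map_mult_left
            connectedin_identity_component]) (use A in simp)
    moreover have "?C \<subseteq> G"
      using A subgroup.m_closed[OF subgroup_G] identity_component_subset by (auto simp: subset_iff)
    moreover have "1\<^sub>m n \<in> ?C"
      using GLn.l_inv[OF A(2)] AB(1) by (auto intro!: image_eqI[of _ _ A])
    ultimately show ?thesis
      using connectedin_subset_identity_component AB(2) by blast
  qed
  have carrier: "A \<in> carrier (GL n)" if "A \<in> identity_component n G" for A
    using that identity_component_subset subgroup.mem_carrier[OF subgroup_G] by blast
  have inv: "inv\<^bsub>GL n\<^esub> A \<in> identity_component n G" if "A \<in> identity_component n G" for A
    using cl[OF that one_mem_identity_component] GLn.inv_closed[OF carrier[OF that]] GLn.r_one
    by fastforce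
  show ?thesis
  proof (rule GLn.subgroupI)
    show "A \<otimes>\<^bsub>GL n\<^esub> B \<in> identity_component n G"
      if "A \<in> identity_component n G" "B \<in> identity_component n G" for A B
      using cl[OF inv[OF that(1)] that(2)] GLn.inv_inv[OF carrier[OF that(1)]] by simp
  qed (use carrier inv one_mem_identity_component in auto)
qed

lemma group_subgroup_of_GL: "group (subgroup_of_GL n G)"
  by (rule subgroup.subgroup_is_group[OF subgroup_G group_GL])

text \<open>The same argument with conjugation, a composite of two translations that fixes the
  identity.\<close>

lemma normal_identity_component: "identity_component n G \<lhd> subgroup_of_GL n G"
proof -
  interpret H: group "subgroup_of_GL n G"
    by (rule group_subgroup_of_GL)
  have sub: "subgroup (identity_component n G) (subgroup_of_GL n G)"
    using GLn.subgroup_incl[OF subgroup_identity_component subgroup_G identity_component_subset] .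
  show ?thesis
    unfolding H.normal_inv_iff
  proof (intro conjI ballI sub)
    fix A B assume A: "A \<in> carrier (subgroup_of_GL n G)" and B: "B \<in> identity_component n G"
    then have A': "A \<in> G" "A \<in> carrier (GL n)" "inv\<^bsub>GL n\<^esub> A \<in> G" "inv\<^bsub>GL n\<^esub> A \<in> carrier (GL n)"
      using mem_G[of A] by auto
    let ?f = "(\<lambda>C. C * inv\<^bsub>GL n\<^esub> A) \<circ> (\<lambda>C. A * C)"
    have "connectedin (zariski n) (?f ` identity_component n G)"
      by (rule connectedin_continuous_map_image[OF continuous_map_compose[OF
              continuous_map_mult_left continuous_map_mult_right] connectedin_identity_component])
         (use A' in auto)
    moreover have "?f ` identity_component n G \<subseteq> G"
      using A' subgroup.m_closed[OF subgroup_G] identity_component_subset by (auto simp: subset_iff)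
    moreover have "1\<^sub>m n \<in> ?f ` identity_component n G"
      using GLn.r_inv[OF A'(2)] GLn.r_one[OF A'(2)] one_mem_identity_component
      by (auto intro!: image_eqI[of _ _ "1\<^sub>m n"])
    ultimately have "?f B \<in> identity_component n G"
      using connectedin_subset_identity_component B by blast
    then show "A \<otimes>\<^bsub>subgroup_of_GL n G\<^esub> B \<otimes>\<^bsub>subgroup_of_GL n G\<^esub> inv\<^bsub>subgroup_of_GL n G\<^esub> A
        \<in> identity_component n G"
      using GLn.m_inv_consistent[OF subgroup_G A'(1)] by simp
  qed
qed

text \<open>Each of the finitely many connected pieces of \<open>G\<close> lies in one coset:
  translating a piece by the inverse of one of its points moves it into the identity component.
  Hence there are at most as many cosets as pieces.\<close>

lemma finite_component_group: "finite (carrier (subgroup_of_GL n G Mod identity_component n G))"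
proof -
  interpret normal "identity_component n G" "subgroup_of_GL n G"
    by (rule normal_identity_component)
  obtain \<C> where \<C>: "finite \<C>" "\<forall>D\<in>\<C>. connectedin (zariski n) D" "G = \<Union>\<C>"
    using closedin_zariski_finite_union_connected G unfolding linear_algebraic_group_def by blast
  \<comment> \<open>Unspecified on an empty piece, but only used for pieces known to contain a
    point.\<close>
  define rep where "rep D = (SOME A. A \<in> D)" for D :: "'a mat set"
  have "rcosets\<^bsub>subgroup_of_GL n G\<^esub> identity_component n G \<subseteq>
      (\<lambda>D. identity_component n G #>\<^bsub>subgroup_of_GL n G\<^esub> rep D) ` \<C>"
  proof
    fix X assume "X \<in> rcosets\<^bsub>subgroup_of_GL n G\<^esub> identity_component n G"
    then obtain A where A: "A \<in> G" "X = identity_component n G #>\<^bsub>subgroup_of_GL n G\<^esub> A"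
      unfolding RCOSETS_def by auto
    then obtain D where D: "D \<in> \<C>" "A \<in> D"
      using \<C>(3) by blast
    then have rep: "rep D \<in> D"
      unfolding rep_def by (metis someI_ex)
    then have "rep D \<in> G"
      using D \<C>(3) by blast
    then have B: "rep D \<in> G" "rep D \<in> carrier (GL n)" "inv\<^bsub>GL n\<^esub> rep D \<in> G" "inv\<^bsub>GL n\<^esub> rep D \<in> carrier (GL n)"
      using mem_G[of "rep D"] by auto
    let ?C = "(\<lambda>A. A * inv\<^bsub>GL n\<^esub> rep D) ` D"
    have "connectedin (zariski n) ?C"
      by (rule connectedin_continuous_map_image[OF continuous_map_mult_right]) (use B D \<C> in auto)
    moreover have "?C \<subseteq> G"
    proof (rule image_subsetI)
      fix A assume "A \<in> D"
      then show "A * inv\<^bsub>GL n\<^esub> rep D \<in> G"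
        using subgroup.m_closed[OF subgroup_G, of A "inv\<^bsub>GL n\<^esub> rep D"] B D(1) \<C>(3) by auto
    qed
    moreover have "1\<^sub>m n \<in> ?C"
      using GLn.r_inv[OF B(2)] rep by (auto intro!: image_eqI[of _ _ "rep D"])
    ultimately have "A * inv\<^bsub>GL n\<^esub> rep D \<in> identity_component n G"
      using connectedin_subset_identity_component D(2) by blast
    then have "A \<otimes>\<^bsub>subgroup_of_GL n G\<^esub> inv\<^bsub>subgroup_of_GL n G\<^esub> rep D \<in> identity_component n G"
      using GLn.m_inv_consistent[OF subgroup_G B(1)] by simp
    then have "A \<in> identity_component n G #>\<^bsub>subgroup_of_GL n G\<^esub> rep D"
      using rcos_module_rev[of "rep D" A] A B group_subgroup_of_GL by simp
    then have "X = identity_component n G #>\<^bsub>subgroup_of_GL n G\<^esub> rep D"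
      using repr_independence[of A _ "rep D"] A B subgroup_axioms by simp
    then show "X \<in> (\<lambda>D. identity_component n G #>\<^bsub>subgroup_of_GL n G\<^esub> rep D) ` \<C>"
      using D by blast
  qed
  from finite_subset[OF this finite_imageI[OF \<C>(1)]] show ?thesis
    by (simp add: FactGroup_def)
qed

end

section \<open>Laurent polynomial functions and averages over roots of unity\<close>

definition unity_roots :: "nat \<Rightarrow> 'a::field set" where
  "unity_roots N = {z. z ^ N = 1}"

lemma poly_unity_roots: "unity_roots N = {z. poly (monom 1 N - 1) z = 0}"
  by (auto simp: unity_roots_def poly_monom)

lemma degree_monom_minus_1: "N > 0 \<Longrightarrow> degree (monom 1 N - 1 :: 'a::field poly) = N"
  using degree_add_eq_left[of "-1" "monom (1::'a) N"] by (simp add: degree_monom_eq)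

lemma finite_unity_roots: "N > 0 \<Longrightarrow> finite (unity_roots N)"
  unfolding poly_unity_roots using degree_monom_minus_1[of N, where 'a = 'a]
  by (intro poly_roots_finite) auto

lemma card_unity_roots_le: "N > 0 \<Longrightarrow> card (unity_roots N :: 'a::field set) \<le> N"
  unfolding poly_unity_roots using degree_monom_minus_1[of N, where 'a = 'a]
  by (metis card_poly_roots_bound degree_0 less_irrefl)

text \<open>The polynomial X^N - 1 splits, and it has no repeated root: such a root would be a zero
  of the derivative N X^(N-1), impossible for a nonzero \<open>z\<close> when \<open>N\<close> is
  nonzero in the field.\<close>

lemma card_unity_roots:
  assumes N: "of_nat N \<noteq> (0::'a::alg_closed_field)"
  shows "card (unity_roots N :: 'a set) = N"
proof -
  have "N > 0"
    using N by (cases N) auto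
  define p :: "'a poly" where "p = monom 1 N - 1"
  have deg: "degree p = N"
    unfolding p_def by (rule degree_monom_minus_1[OF \<open>N > 0\<close>])
  then have "p \<noteq> 0"
    using \<open>N > 0\<close> by auto
  then obtain A where A: "size A = N" "p = smult (lead_coeff p) (\<Prod>x\<in>#A. [:-x, 1:])"
    using alg_closed_imp_factorization[of p] deg by auto
  have roots: "unity_roots N = set_mset A"
  proof -
    have "poly p z = 0 \<longleftrightarrow> z \<in># A" for z
      using \<open>p \<noteq> 0\<close> by (subst A(2)) (auto simp: poly_prod_mset prod_mset_zero_iff)
    then show ?thesis
      unfolding poly_unity_roots p_def by auto
  qed
  have "count A z = 1" if z: "z \<in># A" for z
  proof (rule ccontr)
    assume "count A z \<noteq> 1"
    moreover have "count A z > 0"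
      using z by simp
    ultimately have "count A z \<ge> 2"
      by linarith
    then have "count (A - {#z#}) z > 0"
      by simp
    then have "z \<in># A - {#z#}"
      unfolding count_greater_zero_iff .
    then obtain B where "A = add_mset z (add_mset z B)"
      using z by (metis insert_DiffM)
    then have "(\<Prod>x\<in>#A. [:-x, 1:]) = [:-z, 1:] ^ 2 * (\<Prod>x\<in>#B. [:-x, 1:])"
      by (simp only: image_mset_add_mset prod_mset.add_mset power2_eq_square mult.assoc)
    then have "[:-z, 1:] ^ 2 dvd p"
      by (subst A(2)) (metis dvd_smult dvd_triv_left)
    then obtain q where q: "p = [:-z, 1:] ^ 2 * q"
      by (elim dvdE)
    have "poly (pderiv p) z = 0"
      unfolding q power2_eq_square pderiv_mult poly_add poly_mult by simp
    moreover have "poly (pderiv p) z = of_nat N * z ^ (N - 1)"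
      by (simp add: p_def pderiv_diff pderiv_monom poly_monom)
    moreover have "z ^ N = 1"
      using z roots by (auto simp: unity_roots_def)
    ultimately show False
      using N \<open>N > 0\<close> by (auto simp: power_0_left)
  qed
  then have "A = mset_set (set_mset A)"
    by (intro multiset_eqI) (auto simp: count_mset_set' count_eq_zero_iff)
  then show ?thesis
    unfolding roots using A(1) by (metis size_mset_set)
qed

text \<open>Multiplication by an N-th root of unity \<open>w\<close> permutes the summation set and
  scales the sum by \<open>w powi a\<close>; when this factor is not 1, the sum is zero.\<close>

lemma sum_unity_roots_powi:
  assumes N: "of_nat N \<noteq> (0::'a::alg_closed_field)" and a: "\<bar>a\<bar> < int N"
  shows "(\<Sum>z\<in>unity_roots N. z powi a) = (if a = 0 then of_nat N else (0::'a))"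
proof (cases "a = 0")
  case True
  then show ?thesis
    by (simp add: card_unity_roots[OF N])
next
  case False
  have "N > 0"
    using N by (cases N) auto
  have nz: "z \<noteq> 0" if "z \<in> unity_roots N" for z :: 'a
    using that \<open>N > 0\<close> by (auto simp: unity_roots_def power_0_left)
  \<comment> \<open>At most |a| < N elements satisfy z^|a| = 1, which leaves an N-th root of unity
    \<open>w\<close> that does not.\<close>
  have "card (unity_roots (nat \<bar>a\<bar>) :: 'a set) < card (unity_roots N :: 'a set)"
    using card_unity_roots_le[of "nat \<bar>a\<bar>", where 'a = 'a] card_unity_roots[OF N] a False by simp
  then obtain w :: 'a where w: "w \<in> unity_roots N" "w \<notin> unity_roots (nat \<bar>a\<bar>)"
    using card_mono[OF finite_unity_roots[of "nat \<bar>a\<bar>"], of "unity_roots N"] False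
    by (metis linorder_not_less subsetI zero_less_abs_iff zero_less_nat_eq)
  have wa: "w powi a \<noteq> 1"
  proof (cases "a \<ge> 0")
    case True
    then show ?thesis
      using w(2) by (simp add: power_int_def unity_roots_def)
  next
    case neg: False
    then show ?thesis
      using w(2) by (auto simp: power_int_def unity_roots_def power_inverse)
  qed
  have "(\<Sum>z\<in>unity_roots N. z powi a) = (\<Sum>z\<in>unity_roots N. (w * z) powi a)"
  proof (rule sum.reindex_bij_witness[of _ "\<lambda>z. w * z" "\<lambda>z. inverse w * z"])
  qed (use w(1) nz[OF w(1)] in \<open>auto simp: unity_roots_def power_mult_distrib power_inverse mult.assoc[symmetric]\<close>)
  also have "\<dots> = w powi a * (\<Sum>z\<in>unity_roots N. z powi a)"
    by (simp add: power_int_mult_distrib sum_distrib_left)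
  finally have "(1 - w powi a) * (\<Sum>z\<in>unity_roots N. z powi a) = 0"
    by (simp add: algebra_simps)
  then show ?thesis
    using wa False by simp
qed

section \<open>Laurent monomials and torsion points\<close>

text \<open>Coordinates from \<open>r\<close> on are left free, so that pointwise products and
  inverses stay inside. A point of the torus thus has many representatives.\<close>

definition torus_points :: "nat \<Rightarrow> (nat \<Rightarrow> 'a::field) set" where
  "torus_points r = {u. \<forall>i<r. u i \<noteq> 0}"

text \<open>Vanishing from \<open>r\<close> on makes an exponent determined by its first
  \<open>r\<close> entries, so that each monomial function has one exponent to extract.\<close>

definition laurent_exponents :: "nat \<Rightarrow> (nat \<Rightarrow> int) set" where
  "laurent_exponents r = {\<alpha>. \<forall>i\<ge>r. \<alpha> i = 0}"

definition laurent_monom :: "nat \<Rightarrow> (nat \<Rightarrow> int) \<Rightarrow> (nat \<Rightarrow> 'a::field) \<Rightarrow> 'a" where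
  "laurent_monom r \<alpha> u = (\<Prod>i<r. u i powi \<alpha> i)"

definition laurent :: "nat \<Rightarrow> ((nat \<Rightarrow> 'a::field) \<Rightarrow> 'a) set" where
  "laurent r = {f. lincomb (laurent_exponents r) (laurent_monom r) (torus_points r) f}"

text \<open>Extensional functions, in contrast to \<open>torus_points\<close>: each torsion point is
  counted once and the set is finite.\<close>

definition torsion_points :: "nat \<Rightarrow> nat \<Rightarrow> (nat \<Rightarrow> 'a::field) set" where
  "torsion_points r N = PiE {..<r} (\<lambda>_. unity_roots N)"

lemma laurent_monom_mult:
  "laurent_monom r \<alpha> (\<lambda>i. u i * v i) = laurent_monom r \<alpha> u * laurent_monom r \<alpha> v"
  by (simp add: laurent_monom_def power_int_mult_distrib prod.distrib)

lemma laurent_monom_add: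
  "u \<in> torus_points r \<Longrightarrow>
     laurent_monom r (\<lambda>i. \<alpha> i + \<beta> i) u = laurent_monom r \<alpha> u * laurent_monom r \<beta> u"
  by (simp add: laurent_monom_def torus_points_def power_int_add prod.distrib)

lemma laurent_monom_uminus:
  "laurent_monom r (\<lambda>i. - \<alpha> i) u = laurent_monom r \<alpha> (\<lambda>i. inverse (u i))"
  by (simp add: laurent_monom_def power_int_minus power_int_inverse)

lemma laurent_monom_inverse:
  "laurent_monom r \<alpha> (\<lambda>i. inverse (u i)) = inverse (laurent_monom r \<alpha> u)"
  by (simp add: laurent_monom_def power_int_inverse prod_inversef[symmetric])

lemma laurent_monom_nonzero: "u \<in> torus_points r \<Longrightarrow> laurent_monom r \<alpha> u \<noteq> 0"
  by (auto simp: laurent_monom_def torus_points_def)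

lemma laurent_cong:
  "f \<in> laurent r \<Longrightarrow> (\<And>u. u \<in> torus_points r \<Longrightarrow> g u = f u) \<Longrightarrow> g \<in> laurent r"
  unfolding laurent_def by (auto elim: lincomb_cong)

lemma fun_algebra_laurent: "fun_algebra (laurent r :: ((nat \<Rightarrow> 'a::field) \<Rightarrow> 'a) set)"
  unfolding fun_algebra_def
proof (intro conjI allI ballI)
  fix c :: 'a
  have "(\<lambda>u. c * laurent_monom r (\<lambda>_. 0) u) \<in> laurent r"
    unfolding laurent_def by (auto intro!: lincomb_base simp: laurent_exponents_def)
  then show "(\<lambda>u. c) \<in> laurent r"
    by (simp add: laurent_monom_def)
next
  fix f g :: "(nat \<Rightarrow> 'a) \<Rightarrow> 'a" assume fg: "f \<in> laurent r" "g \<in> laurent r"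
  then show "(\<lambda>b. f b + g b) \<in> laurent r"
    unfolding laurent_def by (auto intro: lincomb_add)
  have "lincomb (laurent_exponents r) (laurent_monom r) (torus_points r) (\<lambda>b. f b * g b)"
  proof (rule lincomb_mult)
    fix \<alpha> \<beta> assume "\<alpha> \<in> laurent_exponents r" "\<beta> \<in> laurent_exponents r"
    then show "\<exists>\<gamma>\<in>laurent_exponents r. \<forall>u\<in>torus_points r.
        laurent_monom r \<alpha> u * laurent_monom r \<beta> u = laurent_monom r \<gamma> (u :: nat \<Rightarrow> 'a)"
      by (intro bexI[of _ "\<lambda>i. \<alpha> i + \<beta> i"])
         (auto simp: laurent_exponents_def laurent_monom_add)
  qed (use fg in \<open>auto simp: laurent_def\<close>)
  then show "(\<lambda>b. f b * g b) \<in> laurent r"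
    by (simp add: laurent_def)
qed

lemma laurent_coord:
  fixes a :: int
  assumes "i < r"
  shows "(\<lambda>u. u i powi a) \<in> (laurent r :: ((nat \<Rightarrow> 'a::field) \<Rightarrow> 'a) set)"
proof -
  have "laurent_monom r (\<lambda>j. if j = i then a else 0) u = (u i powi a :: 'a)" for u
  proof -
    have "(\<Prod>j<r. u j powi (if j = i then a else 0)) = (\<Prod>j<r. if j = i then u j powi a else 1)"
      by (intro prod.cong) auto
    then show ?thesis
      using assms by (simp add: laurent_monom_def)
  qed
  moreover have "(\<lambda>u. 1 * laurent_monom r (\<lambda>j. if j = i then a else 0) u :: 'a) \<in> laurent r"
    unfolding laurent_def mem_Collect_eq
    by (rule lincomb_base) (use assms in \<open>auto simp: laurent_exponents_def\<close>)
  ultimately show ?thesis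
    by simp
qed

lemma laurent_inverse_arg:
  fixes f :: "(nat \<Rightarrow> 'a::field) \<Rightarrow> 'a"
  assumes "f \<in> laurent r"
  shows "(\<lambda>u. f (\<lambda>i. inverse (u i))) \<in> laurent r"
proof -
  obtain A c where A: "finite A" "A \<subseteq> laurent_exponents r"
      "\<forall>u\<in>torus_points r. f u = (\<Sum>\<alpha>\<in>A. c \<alpha> * laurent_monom r \<alpha> u)"
    using assms unfolding laurent_def lincomb_def by blast
  have "lincomb (laurent_exponents r) (laurent_monom r) (torus_points r)
      (\<lambda>u. \<Sum>\<alpha>\<in>A. c \<alpha> * laurent_monom r (\<lambda>i. - \<alpha> i) u)"
    using A by (intro lincomb_sum lincomb_base) (auto simp: laurent_exponents_def)
  then show ?thesis
    unfolding laurent_def mem_Collect_eq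
    by (rule lincomb_cong) (use A in \<open>auto simp: laurent_monom_uminus torus_points_def\<close>)
qed

lemma torsion_points_subset: "N > 0 \<Longrightarrow> t \<in> torsion_points r N \<Longrightarrow> t \<in> torus_points r"
  unfolding torsion_points_def torus_points_def PiE_def Pi_def unity_roots_def
  by (auto simp: power_0_left)

lemma torus_points_mult:
  "u \<in> torus_points r \<Longrightarrow> v \<in> torus_points r \<Longrightarrow> (\<lambda>i. u i * v i) \<in> torus_points r"
  by (auto simp: torus_points_def)

lemma torus_points_inverse: "u \<in> torus_points r \<Longrightarrow> (\<lambda>i. inverse (u i)) \<in> torus_points r"
  by (auto simp: torus_points_def)

lemma card_torsion_points:
  "of_nat N \<noteq> (0::'a::alg_closed_field) \<Longrightarrow> card (torsion_points r N :: (nat \<Rightarrow> 'a) set) = N ^ r"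
  by (simp add: torsion_points_def card_PiE card_unity_roots)

lemma sum_torsion_points_monom:
  assumes N: "of_nat N \<noteq> (0::'a::alg_closed_field)" and \<alpha>: "\<And>i. i < r \<Longrightarrow> \<bar>\<alpha> i\<bar> < int N"
  shows "(\<Sum>t\<in>torsion_points r N. laurent_monom r \<alpha> t) =
    (if \<forall>i<r. \<alpha> i = 0 then of_nat (N ^ r) else (0::'a))"
proof -
  have "N > 0"
    using N by (cases N) auto
  have "(\<Sum>t\<in>torsion_points r N. laurent_monom r \<alpha> t) =
      (\<Prod>i<r. \<Sum>z\<in>unity_roots N. (z :: 'a) powi \<alpha> i)"
    unfolding torsion_points_def laurent_monom_def
    by (rule prod_sum_PiE[symmetric]) (auto simp: finite_unity_roots \<open>N > 0\<close>)
  also have "\<dots> = (\<Prod>i<r. if \<alpha> i = 0 then of_nat N else 0)"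
    by (intro prod.cong refl sum_unity_roots_powi N \<alpha>) auto
  also have "\<dots> = (if \<forall>i<r. \<alpha> i = 0 then of_nat (N ^ r) else 0)"
    by (auto simp: prod_zero_iff)
  finally show ?thesis .
qed

section \<open>Extracting coefficients by averaging\<close>

text \<open>Twisting by the inverse of the monomial \<open>\<beta>\<close> turns the exponents
  \<open>\<alpha>\<close> into \<open>\<alpha> - \<beta>\<close>; beyond \<open>B\<close> all their
  entries are below \<open>N\<close> in absolute value, and orthogonality kills every term except
  \<open>\<alpha> = \<beta>\<close>.\<close>

lemma average_monom_sum:
  fixes c :: "(nat \<Rightarrow> int) \<Rightarrow> 'a::alg_closed_field"
  assumes A: "finite A" "A \<subseteq> laurent_exponents r" and \<beta>: "\<beta> \<in> laurent_exponents r"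
  shows "\<exists>B. \<forall>N>B. of_nat N \<noteq> (0::'a) \<longrightarrow> (\<forall>s\<in>torus_points r.
    (\<Sum>t\<in>torsion_points r N. laurent_monom r (\<lambda>i. - \<beta> i) t *
       (\<Sum>\<alpha>\<in>A. c \<alpha> * laurent_monom r \<alpha> (\<lambda>i. t i * s i))) =
    of_nat (N ^ r) * (if \<beta> \<in> A then c \<beta> else 0) * laurent_monom r \<beta> s)"
proof -
  \<comment> \<open>The entries that \<open>N\<close> has to exceed. The set is empty if
    \<open>A\<close> is empty or \<open>r\<close> is 0, hence \<open>insert 0\<close> under
    \<open>Max\<close>.\<close>
  define D where "D = (\<lambda>(\<alpha>, i). nat \<bar>\<alpha> i - \<beta> i\<bar>) ` (A \<times> {..<r})"
  have "finite D"
    unfolding D_def using A by auto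
  have D: "\<bar>\<alpha> i - \<beta> i\<bar> \<le> int (Max (insert 0 D))" if "\<alpha> \<in> A" "i < r" for \<alpha> i
  proof -
    have "nat \<bar>\<alpha> i - \<beta> i\<bar> \<in> D"
      using that unfolding D_def by (intro image_eqI[of _ _ "(\<alpha>, i)"]) auto
    then have "nat \<bar>\<alpha> i - \<beta> i\<bar> \<le> Max (insert 0 D)"
      using \<open>finite D\<close> by (intro Max_ge) auto
    then show ?thesis
      by linarith
  qed
  show ?thesis
  proof (intro exI[of _ "Max (insert 0 D)"] allI impI ballI)
    fix N and s :: "nat \<Rightarrow> 'a"
    assume N: "Max (insert 0 D) < N" "of_nat N \<noteq> (0::'a)" and s: "s \<in> torus_points r"
    then have "N > 0"
      by auto
    have eq: "\<alpha> = \<beta> \<longleftrightarrow> (\<forall>i<r. \<alpha> i - \<beta> i = 0)" if "\<alpha> \<in> A" for \<alpha>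
    proof -
      have "\<alpha> i = \<beta> i" if "i \<ge> r" for i
        using \<open>\<alpha> \<in> A\<close> A(2) \<beta> that by (auto simp: laurent_exponents_def)
      then show ?thesis
        by (auto simp: fun_eq_iff) (meson not_le)
    qed
    have "(\<Sum>t\<in>torsion_points r N. laurent_monom r (\<lambda>i. - \<beta> i) t *
        (\<Sum>\<alpha>\<in>A. c \<alpha> * laurent_monom r \<alpha> (\<lambda>i. t i * s i))) =
      (\<Sum>t\<in>torsion_points r N. \<Sum>\<alpha>\<in>A. c \<alpha> * laurent_monom r \<alpha> s *
        laurent_monom r (\<lambda>i. \<alpha> i + - \<beta> i) t)"
      by (intro sum.cong refl, subst laurent_monom_add)
         (auto simp: torsion_points_subset[OF \<open>N > 0\<close>] laurent_monom_mult sum_distrib_left mult_ac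
           laurent_monom_add intro!: sum.cong)
    also have "\<dots> = (\<Sum>\<alpha>\<in>A. c \<alpha> * laurent_monom r \<alpha> s *
        (\<Sum>t\<in>torsion_points r N. laurent_monom r (\<lambda>i. \<alpha> i + - \<beta> i) t))"
      by (subst sum.swap) (simp add: sum_distrib_left)
    also have "\<dots> = (\<Sum>\<alpha>\<in>A. c \<alpha> * laurent_monom r \<alpha> s * (if \<alpha> = \<beta> then of_nat (N ^ r) else 0))"
    proof (intro sum.cong refl arg_cong2[where f = "(*)"])
      fix \<alpha> assume "\<alpha> \<in> A"
      moreover from this have "\<bar>\<alpha> i + - \<beta> i\<bar> < int N" if "i < r" for i
        using D[OF _ that] N(1) by fastforce
      ultimately show "(\<Sum>t\<in>torsion_points r N. laurent_monom r (\<lambda>i. \<alpha> i + - \<beta> i) t) =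
          (if \<alpha> = \<beta> then of_nat (N ^ r) else (0::'a))"
        using sum_torsion_points_monom[OF N(2), of r "\<lambda>i. \<alpha> i + - \<beta> i"] eq by simp
    qed
    also have "\<dots> = (\<Sum>\<alpha>\<in>A. if \<alpha> = \<beta> then c \<beta> * laurent_monom r \<beta> s * of_nat (N ^ r) else 0)"
      by (intro sum.cong) auto
    also have "\<dots> = of_nat (N ^ r) * (if \<beta> \<in> A then c \<beta> else 0) * laurent_monom r \<beta> s"
      using A by (simp add: mult_ac)
    finally show "(\<Sum>t\<in>torsion_points r N. laurent_monom r (\<lambda>i. - \<beta> i) t *
       (\<Sum>\<alpha>\<in>A. c \<alpha> * laurent_monom r \<alpha> (\<lambda>i. t i * s i))) =
      of_nat (N ^ r) * (if \<beta> \<in> A then c \<beta> else 0) * laurent_monom r \<beta> s" .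
  qed
qed

text \<open>Extraction at exponent zero. That the result is the same for every \<open>s\<close> is
  the invariance of the average under translation by the torus.\<close>

lemma laurent_average_invariant:
  fixes f :: "(nat \<Rightarrow> 'a::alg_closed_field) \<Rightarrow> 'a"
  assumes "f \<in> laurent r"
  shows "\<exists>B c. \<forall>N>B. of_nat N \<noteq> (0::'a) \<longrightarrow> (\<forall>s\<in>torus_points r.
    (\<Sum>t\<in>torsion_points r N. f (\<lambda>i. t i * s i)) = of_nat (N ^ r) * c)"
proof -
  obtain A c where A: "finite A" "A \<subseteq> laurent_exponents r"
      "\<forall>u\<in>torus_points r. f u = (\<Sum>\<alpha>\<in>A. c \<alpha> * laurent_monom r \<alpha> u)"
    using assms unfolding laurent_def lincomb_def by blast
  obtain B where B: "\<forall>N>B. of_nat N \<noteq> (0::'a) \<longrightarrow> (\<forall>s\<in>torus_points r.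
    (\<Sum>t\<in>torsion_points r N. laurent_monom r (\<lambda>i. - 0) t *
       (\<Sum>\<alpha>\<in>A. c \<alpha> * laurent_monom r \<alpha> (\<lambda>i. t i * s i))) =
    of_nat (N ^ r) * (if (\<lambda>_. 0) \<in> A then c (\<lambda>_. 0) else 0) * laurent_monom r (\<lambda>_. 0) s)"
    using average_monom_sum[OF A(1,2), of "\<lambda>_. 0" c] by (auto simp: laurent_exponents_def)
  show ?thesis
  proof (intro exI[of _ B] exI[of _ "if (\<lambda>_. 0) \<in> A then c (\<lambda>_. 0) else 0"] allI impI ballI)
    fix N and s :: "nat \<Rightarrow> 'a"
    assume N: "B < N" "of_nat N \<noteq> (0::'a)" and s: "s \<in> torus_points r"
    have "(\<Sum>t\<in>torsion_points r N. f (\<lambda>i. t i * s i)) =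
        (\<Sum>t\<in>torsion_points r N. laurent_monom r (\<lambda>i. - 0) t *
          (\<Sum>\<alpha>\<in>A. c \<alpha> * laurent_monom r \<alpha> (\<lambda>i. t i * s i)))"
    proof (intro sum.cong refl)
      fix t :: "nat \<Rightarrow> 'a" assume "t \<in> torsion_points r N"
      then have "t \<in> torus_points r"
        by (intro torsion_points_subset[of N]) (use N in auto)
      then show "f (\<lambda>i. t i * s i) = laurent_monom r (\<lambda>i. - 0) t *
          (\<Sum>\<alpha>\<in>A. c \<alpha> * laurent_monom r \<alpha> (\<lambda>i. t i * s i))"
        using A(3) torus_points_mult[OF _ s] by (simp add: laurent_monom_def)
    qed
    also have "\<dots> = of_nat (N ^ r) * (if (\<lambda>_. 0) \<in> A then c (\<lambda>_. 0) else 0)"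
      using B[rule_format, OF N s] by (simp add: laurent_monom_def)
    finally show "(\<Sum>t\<in>torsion_points r N. f (\<lambda>i. t i * s i)) =
        of_nat (N ^ r) * (if (\<lambda>_. 0) \<in> A then c (\<lambda>_. 0) else 0)" .
  qed
qed

text \<open>A nonzero value at one point forces a nonzero coefficient in an expansion; the average
  at its exponent \<open>\<beta>\<close> is a nonzero multiple of the character
  \<open>\<beta>\<close>.\<close>

lemma laurent_average_weight:
  fixes f :: "(nat \<Rightarrow> 'a::alg_closed_field) \<Rightarrow> 'a"
  assumes "f \<in> laurent r" "u \<in> torus_points r" "f u \<noteq> 0"
  shows "\<exists>\<beta> B c. c \<noteq> 0 \<and> (\<forall>N>B. of_nat N \<noteq> (0::'a) \<longrightarrow> (\<forall>s\<in>torus_points r.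
    (\<Sum>t\<in>torsion_points r N. laurent_monom r (\<lambda>i. - \<beta> i) t * f (\<lambda>i. t i * s i)) =
      of_nat (N ^ r) * c * laurent_monom r \<beta> s))"
proof -
  obtain A c where A: "finite A" "A \<subseteq> laurent_exponents r"
      "\<forall>u\<in>torus_points r. f u = (\<Sum>\<alpha>\<in>A. c \<alpha> * laurent_monom r \<alpha> u)"
    using assms unfolding laurent_def lincomb_def by blast
  obtain \<beta> where \<beta>: "\<beta> \<in> A" "c \<beta> \<noteq> 0"
  proof -
    have "(\<Sum>\<alpha>\<in>A. c \<alpha> * laurent_monom r \<alpha> u) \<noteq> 0"
      using A(3) assms(2,3) by auto
    then obtain \<beta> where "\<beta> \<in> A" "c \<beta> * laurent_monom r \<beta> u \<noteq> 0"
      by (rule sum.not_neutral_contains_not_neutral)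
    then show ?thesis
      using that by auto
  qed
  obtain B where B: "\<forall>N>B. of_nat N \<noteq> (0::'a) \<longrightarrow> (\<forall>s\<in>torus_points r.
    (\<Sum>t\<in>torsion_points r N. laurent_monom r (\<lambda>i. - \<beta> i) t *
       (\<Sum>\<alpha>\<in>A. c \<alpha> * laurent_monom r \<alpha> (\<lambda>i. t i * s i))) =
    of_nat (N ^ r) * (if \<beta> \<in> A then c \<beta> else 0) * laurent_monom r \<beta> s)"
    using average_monom_sum[OF A(1,2), of \<beta> c] \<beta> A(2) by blast
  show ?thesis
  proof (intro exI[of _ \<beta>] exI[of _ B] exI[of _ "c \<beta>"] conjI allI impI ballI \<beta>)
    fix N and s :: "nat \<Rightarrow> 'a"
    assume N: "B < N" "of_nat N \<noteq> (0::'a)" and s: "s \<in> torus_points r"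
    have "(\<Sum>t\<in>torsion_points r N. laurent_monom r (\<lambda>i. - \<beta> i) t * f (\<lambda>i. t i * s i)) =
        (\<Sum>t\<in>torsion_points r N. laurent_monom r (\<lambda>i. - \<beta> i) t *
          (\<Sum>\<alpha>\<in>A. c \<alpha> * laurent_monom r \<alpha> (\<lambda>i. t i * s i)))"
    proof (intro sum.cong refl)
      fix t :: "nat \<Rightarrow> 'a" assume "t \<in> torsion_points r N"
      then have "t \<in> torus_points r"
        by (intro torsion_points_subset[of N]) (use N in auto)
      then show "laurent_monom r (\<lambda>i. - \<beta> i) t * f (\<lambda>i. t i * s i) = laurent_monom r (\<lambda>i. - \<beta> i) t *
          (\<Sum>\<alpha>\<in>A. c \<alpha> * laurent_monom r \<alpha> (\<lambda>i. t i * s i))"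
        using A(3) torus_points_mult[OF _ s] by simp
    qed
    also have "\<dots> = of_nat (N ^ r) * c \<beta> * laurent_monom r \<beta> s"
      using B[rule_format, OF N s] \<beta> by simp
    finally show "(\<Sum>t\<in>torsion_points r N. laurent_monom r (\<lambda>i. - \<beta> i) t * f (\<lambda>i. t i * s i)) =
        of_nat (N ^ r) * c \<beta> * laurent_monom r \<beta> s" .
  qed
qed

text \<open>Two consecutive integers cannot both vanish in a field.\<close>

lemma ex_large_of_nat_nonzero: "\<exists>N>B. of_nat N \<noteq> (0::'a::field)"
proof (cases "of_nat (Suc B) = (0::'a)")
  case True
  have "of_nat (Suc (Suc B)) = of_nat (Suc B) + (1::'a)"
    by simp
  with True show ?thesis
    by (intro exI[of _ "Suc (Suc B)"]) (metis add_0 less_Suc_eq one_neq_zero)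
qed (auto intro: exI[of _ "Suc B"])


section \<open>Parametrized tori\<close>

text \<open>A surjective homomorphism from points of the multiplicative group to the power
  \<open>r\<close>, with Laurent polynomial entries. In this form \<open>r = 0\<close> covers the
  trivial group.\<close>

definition torus_param :: "nat \<Rightarrow> 'a::field mat set \<Rightarrow> nat \<Rightarrow> ((nat \<Rightarrow> 'a) \<Rightarrow> 'a mat) \<Rightarrow> bool" where
  "torus_param n T r \<psi> \<longleftrightarrow> subgroup T (GL n) \<and> \<psi> ` torus_points r = T \<and>
     (\<forall>u\<in>torus_points r. \<forall>v\<in>torus_points r. \<psi> (\<lambda>i. u i * v i) = \<psi> u * \<psi> v) \<and>
     (\<forall>i<n. \<forall>j<n. (\<lambda>u. \<psi> u $$ (i, j)) \<in> laurent r)"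

lemma torus_param_trivial:
  "torus_param n {1\<^sub>m n} 0 (\<lambda>_. 1\<^sub>m n :: 'a::field mat)"
proof -
  interpret group "GL n :: 'a mat monoid"
    by (rule group_GL)
  have "subgroup {1\<^sub>m n} (GL n :: 'a mat monoid)"
    using triv_subgroup by simp
  then show ?thesis
    unfolding torus_param_def using fun_algebraD(1)[OF fun_algebra_laurent]
    by (auto simp: torus_points_def)
qed

definition diag_of :: "nat \<Rightarrow> (nat \<Rightarrow> 'a::field) \<Rightarrow> 'a mat" where
  "diag_of r u = mat r r (\<lambda>(i, j). if i = j then u i else 0)"

lemma diag_of_carrier [simp]: "diag_of r u \<in> carrier_mat r r"
  by (simp add: diag_of_def)

lemma det_diag_of: "det (diag_of r u) = (\<Prod>i<r. u i)"
proof -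
  have "det (diag_of r u) = prod_list (diag_mat (diag_of r u))"
    by (rule det_upper_triangular[of _ r]) (auto simp: diag_of_def upper_triangular_def)
  also have "\<dots> = (\<Prod>i = 0..<r. diag_of r u $$ (i, i))"
    by (simp add: prod_list_diag_prod diag_of_def)
  also have "\<dots> = (\<Prod>i<r. u i)"
    by (simp add: atLeast0LessThan diag_of_def)
  finally show ?thesis .
qed

lemma diag_of_mult: "diag_of r u * diag_of r v = diag_of r (\<lambda>i. u i * v i)"
proof (rule eq_matI)
  fix i j assume "i < dim_row (diag_of r (\<lambda>i. u i * v i))" "j < dim_col (diag_of r (\<lambda>i. u i * v i))"
  then have ij: "i < r" "j < r"
    by (auto simp: diag_of_def)
  have "(diag_of r u * diag_of r v) $$ (i, j) =
      (\<Sum>k<r. diag_of r u $$ (i, k) * diag_of r v $$ (k, j))"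
    using ij by (intro index_mult_mat_sum[of _ r r _ r]) auto
  also have "\<dots> = (\<Sum>k<r. if k = i then (if i = j then u i * v i else 0) else 0)"
    using ij by (intro sum.cong) (auto simp: diag_of_def)
  finally have "(diag_of r u * diag_of r v) $$ (i, j) =
      (\<Sum>k<r. if k = i then (if i = j then u i * v i else 0) else 0)" .
  then show "(diag_of r u * diag_of r v) $$ (i, j) = diag_of r (\<lambda>i. u i * v i) $$ (i, j)"
    using ij by (simp add: diag_of_def)
qed (auto simp: diag_of_def)

lemma diag_of_mem: "diag_of r u \<in> diagonal_group r \<longleftrightarrow> u \<in> torus_points r"
proof -
  have "diagonal_mat (diag_of r u)"
    by (simp add: diagonal_mat_def diag_of_def)
  then show ?thesis
    by (auto simp: diagonal_group_def carrier_GL_iff det_diag_of torus_points_def)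
qed

lemma diagonal_groupE:
  assumes "A \<in> diagonal_group r"
  obtains u where "u \<in> torus_points r" "A = diag_of r u"
proof -
  have "A = diag_of r (\<lambda>i. A $$ (i, i))"
    using assms by (intro eq_matI)
      (auto simp: diagonal_group_def carrier_GL_iff diagonal_mat_def diag_of_def)
  with assms show ?thesis
    using that diag_of_mem by metis
qed

text \<open>On diagonal matrices the inverse determinant is itself a Laurent monomial.\<close>

lemma laurent_regular_on_diagonal:
  assumes "regular_on r (diagonal_group r) f"
  shows "(\<lambda>u. f (diag_of r u)) \<in> laurent r"
proof -
  obtain q k where q: "q \<in> mat_poly_funs r"
      "\<forall>A\<in>diagonal_group r. f A = q A * inverse (det A) ^ k"
    using assms unfolding regular_on_def by blast
  note L = fun_algebra_laurent[of r]
  have "(\<lambda>u. q (diag_of r u)) \<in> laurent r"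
  proof (rule mat_polynomials_compose[OF L mat_poly_funs_subset[OF q(1)] laurent_cong,
        where X = "torus_points r"])
    fix i j assume "i < r" "j < r"
    then show "(\<lambda>u. diag_of r u $$ (i, j)) \<in> laurent r"
      using laurent_coord[of i r 1] by (cases "i = j") (auto simp: diag_of_def fun_algebraD(1)[OF L])
  qed auto
  moreover have "(\<lambda>u. (\<Prod>i<r. u i powi (-1)) ^ k) \<in> laurent r"
    by (intro fun_algebra_power[OF L] fun_algebra_prod[OF L] laurent_coord) auto
  ultimately have "(\<lambda>u. q (diag_of r u) * (\<Prod>i<r. u i powi (-1)) ^ k) \<in> laurent r"
    by (rule fun_algebraD(3)[OF L])
  then show ?thesis
    by (rule laurent_cong)
       (use q in \<open>auto simp: diag_of_mem det_diag_of power_int_minus prod_inversef[symmetric] o_def\<close>)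
qed

lemma is_torus_imp_torus_param:
  assumes "is_torus n T" "subgroup T (GL n)"
  shows "\<exists>r \<psi>. torus_param n T r \<psi>"
proof -
  obtain r \<phi> \<psi> where iso: "algebraic_hom n T r (diagonal_group r) \<phi>"
      "algebraic_hom r (diagonal_group r) n T \<psi>"
      "\<forall>A\<in>T. \<psi> (\<phi> A) = A" "\<forall>B\<in>diagonal_group r. \<phi> (\<psi> B) = B"
    using assms(1) unfolding is_torus_def algebraic_isomorphic_def by blast
  have \<phi>: "\<phi> A \<in> diagonal_group r" if "A \<in> T" for A
    using iso(1) that unfolding algebraic_hom_def hom_def by auto
  have \<psi>: "\<psi> B \<in> T" if "B \<in> diagonal_group r" for B
    using iso(2) that unfolding algebraic_hom_def hom_def by auto
  have \<psi>_mult: "\<psi> (A * B) = \<psi> A * \<psi> B" if "A \<in> diagonal_group r" "B \<in> diagonal_group r" for A B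
    using iso(2) that unfolding algebraic_hom_def hom_def by auto
  have "torus_param n T r (\<lambda>u. \<psi> (diag_of r u))"
    unfolding torus_param_def
  proof (intro conjI allI impI ballI assms(2))
    show "(\<lambda>u. \<psi> (diag_of r u)) ` torus_points r = T"
    proof (intro equalityI subsetI)
      fix A assume "A \<in> T"
      then show "A \<in> (\<lambda>u. \<psi> (diag_of r u)) ` torus_points r"
        using \<phi> iso(3) by (metis diagonal_groupE image_eqI)
    qed (auto simp: \<psi> diag_of_mem)
    show "\<psi> (diag_of r (\<lambda>i. u i * v i)) = \<psi> (diag_of r u) * \<psi> (diag_of r v)"
      if "u \<in> torus_points r" "v \<in> torus_points r" for u v
      using \<psi>_mult[of "diag_of r u" "diag_of r v"] that by (simp add: diag_of_mem diag_of_mult)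
    show "(\<lambda>u. \<psi> (diag_of r u) $$ (i, j)) \<in> laurent r" if "i < n" "j < n" for i j
      by (rule laurent_regular_on_diagonal) (use iso(2) that in \<open>auto simp: algebraic_hom_def\<close>)
  qed
  then show ?thesis
    by blast
qed

context
  fixes n r :: nat and T :: "'a::field mat set" and \<psi>
  assumes T: "torus_param n T r \<psi>"
begin

lemma torus_param_mem: "u \<in> torus_points r \<Longrightarrow> \<psi> u \<in> T"
  using T unfolding torus_param_def by blast

lemma torus_param_GL: "u \<in> torus_points r \<Longrightarrow> \<psi> u \<in> carrier (GL n)"
  using T torus_param_mem unfolding torus_param_def by (auto dest: subgroup.mem_carrier)

lemma torus_param_carrier: "u \<in> torus_points r \<Longrightarrow> \<psi> u \<in> carrier_mat n n"
  using torus_param_GL carrier_GL_subset by blast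

lemma torus_paramE:
  assumes "A \<in> T"
  obtains u where "u \<in> torus_points r" "A = \<psi> u"
  using assms T unfolding torus_param_def by blast

lemma torus_param_mult:
  "u \<in> torus_points r \<Longrightarrow> v \<in> torus_points r \<Longrightarrow> \<psi> (\<lambda>i. u i * v i) = \<psi> u * \<psi> v"
  using T unfolding torus_param_def by blast

lemma torus_param_inverse:
  assumes "u \<in> torus_points r"
  shows "\<psi> u * \<psi> (\<lambda>i. inverse (u i)) = 1\<^sub>m n"
proof -
  interpret group "GL n :: 'a mat monoid"
    by (rule group_GL)
  \<comment> \<open>\<open>e\<close> need not be constantly 1, since \<open>u i\<close> may vanish for \<open>i \<ge> r\<close>; but it is idempotent.\<close>
  define e where "e = (\<lambda>i. u i * inverse (u i))"
  have e: "e \<in> torus_points r" "(\<lambda>i. e i * e i) = e"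
    using assms by (auto simp: e_def torus_points_def fun_eq_iff field_simps)
  then have "\<psi> e * \<psi> e = \<psi> e"
    using torus_param_mult[OF e(1) e(1)] by simp
  then have "\<psi> e = 1\<^sub>m n"
    using torus_param_GL[OF e(1)] r_cancel_one[of "\<psi> e" "\<psi> e"] by simp
  then show ?thesis
    using torus_param_mult[OF assms torus_points_inverse[OF assms]] by (simp add: e_def)
qed

lemma laurent_torus_param:
  assumes "q \<in> mat_polynomials n" "B \<in> carrier_mat n n"
  shows "(\<lambda>u. q (\<psi> u * B)) \<in> laurent r"
proof (rule mat_polynomials_compose[OF fun_algebra_laurent assms(1) laurent_cong,
      where X = "torus_points r"])
  fix i j assume ij: "i < n" "j < n"
  have "(\<lambda>u. \<Sum>k<n. \<psi> u $$ (i, k) * B $$ (k, j)) \<in> laurent r"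
    by (rule fun_algebra_matrix_mult[OF fun_algebra_laurent])
       (use T ij fun_algebraD(1)[OF fun_algebra_laurent] in \<open>auto simp: torus_param_def\<close>)
  then show "(\<lambda>u. (\<psi> u * B) $$ (i, j)) \<in> laurent r"
    by (rule laurent_cong) (use assms ij torus_param_carrier in
        \<open>auto simp: index_mult_mat_sum[of _ n n _ n] simp del: index_mult_mat\<close>)
qed (use assms torus_param_carrier in \<open>auto intro: mult_carrier_mat\<close>)

text \<open>The inverse of the determinant of \<open>\<psi> u\<close> is the determinant at the
  inverse point, and inverting the coordinates preserves Laurent polynomials.\<close>

lemma laurent_regular_torus_param:
  assumes "regular_on n G f" "T \<subseteq> G"
  shows "(\<lambda>u. f (\<psi> u)) \<in> laurent r"
proof -
  note L = fun_algebra_laurent[of r]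
  obtain q k where q: "q \<in> mat_poly_funs n" "\<forall>A\<in>G. f A = q A * inverse (det A) ^ k"
    using assms unfolding regular_on_def by blast
  have 1: "(\<lambda>u. q (\<psi> u)) \<in> laurent r"
    by (rule laurent_cong[OF laurent_torus_param[OF mat_poly_funs_subset[OF q(1)] one_carrier_mat]])
       (simp add: right_mult_one_mat[OF torus_param_carrier])
  have "(\<lambda>u. det (\<psi> u)) \<in> laurent r"
    by (rule laurent_cong[OF laurent_torus_param[OF det_mat_polynomials one_carrier_mat]])
       (simp add: right_mult_one_mat[OF torus_param_carrier])
  then have "(\<lambda>u. q (\<psi> u) * det (\<psi> (\<lambda>i. inverse (u i))) ^ k) \<in> laurent r"
    by (intro fun_algebraD(3)[OF L] 1 fun_algebra_power[OF L] laurent_inverse_arg)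
  then show ?thesis
  proof (rule laurent_cong)
    fix u :: "nat \<Rightarrow> 'a" assume u: "u \<in> torus_points r"
    have "det (\<psi> u) * det (\<psi> (\<lambda>i. inverse (u i))) = 1"
      using det_mult[of "\<psi> u" n "\<psi> (\<lambda>i. inverse (u i))"] torus_param_inverse[OF u] torus_param_carrier[OF u]
        torus_param_carrier[OF torus_points_inverse[OF u]] by simp
    then have "det (\<psi> (\<lambda>i. inverse (u i))) = inverse (det (\<psi> u))"
      by (simp add: inverse_unique)
    then show "f (\<psi> u) = q (\<psi> u) * det (\<psi> (\<lambda>i. inverse (u i))) ^ k"
      using q(2) torus_param_mem[OF u] assms(2) by auto
  qed
qed

end

section \<open>Extensions of finite groups by tori\<close>

text \<open>Right multiplication by \<open>a\<close> permutes the right cosets of \<open>P\<close>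
  and maps each one bijectively onto its image.\<close>

lemma (in group) sum_prod_rcosets_translate:
  fixes L :: "'a \<Rightarrow> 'c::comm_semiring_1"
  assumes P: "subgroup P G" and a: "a \<in> carrier G"
  shows "(\<Sum>D\<in>rcosets P. \<Prod>C\<in>D. L (C \<otimes> a)) = (\<Sum>D\<in>rcosets P. \<Prod>C\<in>D. L C)"
proof -
  have sub: "D \<subseteq> carrier G" if "D \<in> rcosets P" for D
    using rcosets_subset_PowG[OF P] that by blast
  have mem: "D #> b \<in> rcosets P" if "D \<in> rcosets P" "b \<in> carrier G" for D b
    using that subgroup.subset[OF P] by (auto simp: RCOSETS_def coset_mult_assoc)
  have "(\<Prod>C\<in>D. L (C \<otimes> a)) = (\<Prod>C\<in>D #> a. L C)" if "D \<in> rcosets P" for D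
  proof -
    have "D #> a = (\<lambda>C. C \<otimes> a) ` D"
      by (auto simp: r_coset_def)
    moreover have "inj_on (\<lambda>C. C \<otimes> a) D"
      using sub[OF that] a by (intro inj_onI) (auto simp: subset_iff)
    ultimately show ?thesis
      by (simp add: prod.reindex)
  qed
  then have "(\<Sum>D\<in>rcosets P. \<Prod>C\<in>D. L (C \<otimes> a)) = (\<Sum>D\<in>rcosets P. \<Prod>C\<in>D #> a. L C)"
    by (intro sum.cong) auto
  also have "\<dots> = (\<Sum>D\<in>rcosets P. \<Prod>C\<in>D. L C)"
    by (rule sum.reindex_bij_witness[of _ "\<lambda>D. D #> inv a" "\<lambda>D. D #> a"])
       (use a mem sub in \<open>auto simp: coset_mult_assoc\<close>)
  finally show ?thesis .
qed

text \<open>This keeps the number of cosets of \<open>P\<close> nonzero in the field, hence the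
  value of the invariant at \<open>v\<close>.\<close>

lemma (in group) sylow_index_not_dvd:
  assumes "sylow_subgroup p P G" "finite (carrier G)" "p > 1"
  shows "\<not> p dvd card (rcosets P)"
proof
  assume "p dvd card (rcosets P)"
  then have "p * card P dvd Coset.order G"
    using lagrange[of P] assms(1) unfolding sylow_subgroup_def by (metis dvd_refl mult_dvd_mono)
  then have "p ^ Suc (multiplicity p (Coset.order G)) dvd Coset.order G"
    using assms(1) unfolding sylow_subgroup_def by simp
  moreover have "Coset.order G \<noteq> 0"
    using assms(2) by (auto simp: Coset.order_def)
  ultimately show False
    using power_dvd_iff_le_multiplicity[of "Coset.order G" p "Suc (multiplicity p (Coset.order G))"] assms(3) by simp
qed

section \<open>The algebra of regular functions on a matrix group\<close>

lemma regular_on_iff: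
  assumes "G \<subseteq> carrier_mat n n"
  shows "regular_on n G f \<longleftrightarrow>
    (\<exists>q\<in>mat_polynomials n. \<exists>k. \<forall>A\<in>G. f A = q A * inverse (det A) ^ k)"
proof
  assume "\<exists>q\<in>mat_polynomials n. \<exists>k. \<forall>A\<in>G. f A = q A * inverse (det A) ^ k"
  then obtain q k where q: "q \<in> mat_polynomials n" "\<forall>A\<in>G. f A = q A * inverse (det A) ^ k"
    by blast
  then show "regular_on n G f"
    unfolding regular_on_def using restrict_mat_polynomials[OF q(1)] assms
    by (intro bexI[of _ "restrict q (carrier_mat n n)"] exI[of _ k]) (auto simp: subset_iff)
qed (auto simp: regular_on_def dest: mat_poly_funs_subset)

lemma regular_on_cong:
  "regular_on n G f \<Longrightarrow> (\<And>A. A \<in> G \<Longrightarrow> g A = f A) \<Longrightarrow> regular_on n G g"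
  unfolding regular_on_def by auto

text \<open>Sums and products are written over the common denominator
  \<open>det A ^ (k + k')\<close>; the determinant is nonzero on \<open>G\<close>.\<close>

lemma fun_algebra_regular_on:
  fixes G :: "'a::field mat set"
  assumes G: "G \<subseteq> carrier (GL n)"
  shows "fun_algebra {f. regular_on n G f}"
proof -
  have G': "G \<subseteq> carrier_mat n n"
    using G carrier_GL_subset by blast
  note M = fun_algebra_mat_polynomials[of n]
  have "regular_on n G (\<lambda>_. c)" for c
    unfolding regular_on_iff[OF G'] using fun_algebraD(1)[OF M, of c]
    by (intro bexI[of _ "\<lambda>_. c"] exI[of _ 0]) auto
  moreover have "regular_on n G (\<lambda>A. f A + g A)" "regular_on n G (\<lambda>A. f A * g A)"
    if fg: "regular_on n G f" "regular_on n G g" for f g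
  proof -
    obtain q k q' k' where q: "q \<in> mat_polynomials n" "\<forall>A\<in>G. f A = q A * inverse (det A) ^ k"
        "q' \<in> mat_polynomials n" "\<forall>A\<in>G. g A = q' A * inverse (det A) ^ k'"
      using fg unfolding regular_on_iff[OF G'] by blast
    have det: "det A \<noteq> 0" if "A \<in> G" for A
      using G that by (auto simp: carrier_GL_iff)
    have "(\<lambda>A. q A * det A ^ k' + q' A * det A ^ k) \<in> mat_polynomials n"
      by (intro fun_algebraD(2,3)[OF M] fun_algebra_power[OF M] q det_mat_polynomials)
    moreover have "f A + g A = (q A * det A ^ k' + q' A * det A ^ k) * inverse (det A) ^ (k + k')"
      if A: "A \<in> G" for A
    proof -
      have e: "det A ^ j * inverse (det A) ^ j = 1" for j
        using det[OF A] by (simp add: power_mult_distrib[symmetric])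
      have "f A + g A = q A * inverse (det A) ^ k * (det A ^ k' * inverse (det A) ^ k') +
          q' A * inverse (det A) ^ k' * (det A ^ k * inverse (det A) ^ k)"
        using q A unfolding e by simp
      also have "\<dots> = (q A * det A ^ k' + q' A * det A ^ k) * inverse (det A) ^ (k + k')"
        by (simp only: power_add algebra_simps)
      finally show ?thesis .
    qed
    ultimately show "regular_on n G (\<lambda>A. f A + g A)"
      unfolding regular_on_iff[OF G']
      by (intro bexI[of _ "\<lambda>A. q A * det A ^ k' + q' A * det A ^ k"] exI[of _ "k + k'"]) auto
    have "(\<lambda>A. q A * q' A) \<in> mat_polynomials n"
      by (intro fun_algebraD(3)[OF M] q)
    then show "regular_on n G (\<lambda>A. f A * g A)"
      unfolding regular_on_iff[OF G']
      by (rule bexI[rotated]) (use q det in \<open>auto intro!: exI[of _ "k + k'"] simp: power_add\<close>)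
  qed
  ultimately show ?thesis
    unfolding fun_algebra_def by auto
qed

lemma regular_on_mat_polynomials:
  "G \<subseteq> carrier_mat n n \<Longrightarrow> q \<in> mat_polynomials n \<Longrightarrow> regular_on n G q"
  by (auto simp: regular_on_iff intro!: bexI[of _ q] exI[of _ 0])

lemma cofactor_mat_polynomials:
  assumes "i < n" "j < n"
  shows "(\<lambda>A :: 'a::field mat. cofactor A i j) \<in> mat_polynomials n"
proof -
  note M = fun_algebra_mat_polynomials[of n, where 'a = 'a]
  have "(\<lambda>A :: 'a mat. det (mat_delete A i j)) \<in> mat_polynomials n"
  proof (rule mat_polynomials_cong[OF fun_algebra_det[OF M, of "n - 1" "\<lambda>A. mat_delete A i j"]])
    fix k l assume kl: "k < n - 1" "l < n - 1"
    have "(\<lambda>A. A $$ (insert_index i k, insert_index j l)) \<in> mat_polynomials n"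
      using kl by (intro entry_mat_polynomials) (auto simp: insert_index_def)
    then show "(\<lambda>A :: 'a mat. mat_delete A i j $$ (k, l)) \<in> mat_polynomials n"
    proof (rule mat_polynomials_cong)
      fix A :: "'a mat" assume A: "A \<in> carrier_mat n n"
      show "mat_delete A i j $$ (k, l) = A $$ (insert_index i k, insert_index j l)"
        using mat_delete_index[of A "n - 1" i j k l] A assms kl by simp
    qed
  next
    fix A :: "'a mat" assume "A \<in> carrier_mat n n"
    then show "det (mat_delete A i j) = (\<Sum>p | p permutes {0..<n - 1}.
        signof p * (\<Prod>k = 0..<n - 1. mat_delete A i j $$ (k, p k)))"
      by (intro det_def' mat_delete_carrier)
  qed
  then show ?thesis
    unfolding cofactor_def by (intro fun_algebraD(1,3)[OF M])
qed

lemma regular_on_compose_inv: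
  fixes G :: "'a::field mat set"
  assumes G: "G \<subseteq> carrier (GL n)" and q: "q \<in> mat_polynomials n"
  shows "regular_on n G (\<lambda>A. q (inv\<^bsub>GL n\<^esub> A))"
proof -
  interpret group "GL n :: 'a mat monoid"
    by (rule group_GL)
  have G': "G \<subseteq> carrier_mat n n"
    using G carrier_GL_subset by blast
  have "(\<lambda>A. q (inv\<^bsub>GL n\<^esub> A)) \<in> {f. regular_on n G f}"
  proof (rule mat_polynomials_compose[OF fun_algebra_regular_on[OF G] q, where X = G])
    show "g \<in> {f. regular_on n G f}"
      if "f \<in> {f. regular_on n G f}" "\<And>A. A \<in> G \<Longrightarrow> g A = f A" for f g
      using that regular_on_cong by blast
    show "inv\<^bsub>GL n\<^esub> A \<in> carrier_mat n n" if "A \<in> G" for A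
      using that G inv_closed[of A] carrier_GL_subset by blast
    fix i j assume ij: "i < n" "j < n"
    have "regular_on n G (\<lambda>A. cofactor A j i * inverse (det A))"
      unfolding regular_on_iff[OF G']
      by (rule bexI[OF _ cofactor_mat_polynomials[OF ij(2,1)]]) (auto intro: exI[of _ 1])
    then have "regular_on n G (\<lambda>A. (inv\<^bsub>GL n\<^esub> A) $$ (i, j))"
    proof (rule regular_on_cong)
      fix A assume "A \<in> G"
      then have A: "A \<in> carrier (GL n)" "A \<in> carrier_mat n n"
        using G G' by auto
      then show "(inv\<^bsub>GL n\<^esub> A) $$ (i, j) = cofactor A j i * inverse (det A)"
        unfolding inv_GL[OF A(1)] using ij by (auto simp: adj_mat_def)
    qed
    then show "(\<lambda>A. (inv\<^bsub>GL n\<^esub> A) $$ (i, j)) \<in> {f. regular_on n G f}"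
      by simp
  qed
  then show ?thesis
    by simp
qed

text \<open>Topology enters the rest of the argument only through the closedness of \<open>T\<close>
  and the finiteness of the quotient, here turned into assumptions on an arbitrary normal subgroup
  with a torus parametrization.\<close>

locale finite_by_torus =
  fixes n :: nat and G T :: "'a::alg_closed_field mat set" and r :: nat and \<psi>
  assumes subgroup_G: "subgroup G (GL n)"
    and normal_T: "T \<lhd> subgroup_of_GL n G"
    and closed_T: "closedin (zariski n) T"
    and finite_quotient: "finite (carrier (subgroup_of_GL n G Mod T))"
    and torus: "torus_param n T r \<psi>"
begin

abbreviation quotient :: "'a mat set monoid" where
  "quotient \<equiv> subgroup_of_GL n G Mod T"

definition coset_of :: "'a mat \<Rightarrow> 'a mat set" where
  "coset_of A = T #>\<^bsub>subgroup_of_GL n G\<^esub> A"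

definition rep_of :: "'a mat set \<Rightarrow> 'a mat" where
  "rep_of C = (SOME A. A \<in> G \<and> coset_of A = C)"

sublocale T: normal T "subgroup_of_GL n G"
  by (rule normal_T)

sublocale Q: group quotient
  by (rule T.factorgroup_is_group)

sublocale GLn: group "GL n :: 'a mat monoid"
  by (rule group_GL)

lemma mem_G:
  assumes "A \<in> G"
  shows "A \<in> carrier (GL n)" "A \<in> carrier_mat n n" "inv\<^bsub>GL n\<^esub> A \<in> G"
  using subgroup.mem_carrier[OF subgroup_G assms] carrier_GL_subset
    subgroup.m_inv_closed[OF subgroup_G assms] by auto

lemma mult_G: "A \<in> G \<Longrightarrow> B \<in> G \<Longrightarrow> A * B \<in> G"
  using subgroup.m_closed[OF subgroup_G, of A B] by simp

lemma one_G: "1\<^sub>m n \<in> G"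
  using subgroup.one_closed[OF subgroup_G] by simp

lemma T_subset: "T \<subseteq> G"
  using T.subset by simp

lemma carrier_quotient: "carrier quotient = coset_of ` G"
  by (auto simp: FactGroup_def RCOSETS_def coset_of_def)

lemma coset_of_mem: "A \<in> G \<Longrightarrow> coset_of A \<in> carrier quotient"
  by (simp add: carrier_quotient)

lemma coset_of_mult: "A \<in> G \<Longrightarrow> B \<in> G \<Longrightarrow> coset_of A \<otimes>\<^bsub>quotient\<^esub> coset_of B = coset_of (A * B)"
  using T.rcos_sum[of A B] by (simp add: coset_of_def FactGroup_def)

lemma mem_coset_of_iff: "B \<in> coset_of A \<longleftrightarrow> (\<exists>t\<in>T. B = t * A)"
  by (auto simp: coset_of_def r_coset_def)

lemma coset_of_eq: "A \<in> G \<Longrightarrow> B \<in> coset_of A \<Longrightarrow> coset_of B = coset_of A"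
  using T.repr_independence[of B T A] T.subgroup_axioms by (simp add: coset_of_def)

lemma coset_of_self: "A \<in> G \<Longrightarrow> A \<in> coset_of A"
  using T.rcos_self[of A T] T.subgroup_axioms by (simp add: coset_of_def)

lemma rep_of: "C \<in> carrier quotient \<Longrightarrow> rep_of C \<in> G \<and> coset_of (rep_of C) = C"
  unfolding rep_of_def carrier_quotient by (rule someI_ex) blast

lemma param_G: "u \<in> torus_points r \<Longrightarrow> \<psi> u \<in> G"
  using torus_param_mem[OF torus] T_subset by blast

lemma param_one: "\<psi> (\<lambda>_. 1) = 1\<^sub>m n"
proof -
  have "(\<lambda>_. 1) \<in> torus_points r"
    by (simp add: torus_points_def)
  then show ?thesis
    using torus_param_inverse[OF torus, of "\<lambda>_. 1"] torus_param_mult[OF torus, of "\<lambda>_. 1" "\<lambda>_. 1"]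
    by simp
qed

lemma rational_repD:
  assumes "rational_rep n G m \<rho>"
  shows "A \<in> G \<Longrightarrow> \<rho> A \<in> carrier_mat m m"
    and "A \<in> G \<Longrightarrow> B \<in> G \<Longrightarrow> \<rho> (A * B) = \<rho> A * \<rho> B"
    and "i < m \<Longrightarrow> j < m \<Longrightarrow> regular_on n G (\<lambda>A. \<rho> A $$ (i, j))"
  using assms carrier_GL_subset[of m]
  unfolding rational_rep_def algebraic_hom_def hom_def by auto

section \<open>Upper bound: an invariant of degree |P|\<close>

text \<open>Sum the i-th coordinate of \<open>\<rho> (\<psi> t) w\<close> over torsion points
  \<open>t\<close>, where the i-th coordinate of \<open>v\<close> is nonzero. Since \<open>v\<close>
  is fixed, the value at \<open>v\<close> is this coordinate times the number \<open>N ^ r\<close>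
  of torsion points.\<close>

lemma exists_torus_invariant_functional:
  assumes \<rho>: "rational_rep n G m \<rho>" and v: "v \<in> fixed_vecs G m \<rho>" "v \<noteq> 0\<^sub>v m"
  shows "\<exists>a. (\<forall>t\<in>T. \<forall>w\<in>carrier_vec m.
      (\<Sum>j<m. a j * (\<rho> t *\<^sub>v w) $ j) = (\<Sum>j<m. a j * w $ j)) \<and> (\<Sum>j<m. a j * v $ j) \<noteq> 0"
proof -
  have v_carrier: "v \<in> carrier_vec m" and v_fixed: "\<And>A. A \<in> G \<Longrightarrow> \<rho> A *\<^sub>v v = v"
    using v(1) by (auto simp: fixed_vecs_def)
  obtain i where i: "i < m" "v $ i \<noteq> 0"
    using v(2) v_carrier by (metis carrier_vecD eq_vecI index_zero_vec(1) index_zero_vec(2))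
  have "\<forall>j. \<exists>B c. j < m \<longrightarrow> (\<forall>N>B. of_nat N \<noteq> (0::'a) \<longrightarrow> (\<forall>s\<in>torus_points r.
      (\<Sum>t\<in>torsion_points r N. \<rho> (\<psi> (\<lambda>i. t i * s i)) $$ (i, j)) = of_nat (N ^ r) * c))"
  proof
    fix j
    show "\<exists>B c. j < m \<longrightarrow> (\<forall>N>B. of_nat N \<noteq> (0::'a) \<longrightarrow> (\<forall>s\<in>torus_points r.
      (\<Sum>t\<in>torsion_points r N. \<rho> (\<psi> (\<lambda>i. t i * s i)) $$ (i, j)) = of_nat (N ^ r) * c))"
    proof (cases "j < m")
      case True
      have "(\<lambda>u. \<rho> (\<psi> u) $$ (i, j)) \<in> laurent r"
        by (rule laurent_regular_torus_param[OF torus rational_repD(3)[OF \<rho> i(1) True] T_subset])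
      from laurent_average_invariant[OF this] show ?thesis
        by blast
    qed auto
  qed
  then obtain B c where Bc: "\<And>j N s. j < m \<Longrightarrow> N > B j \<Longrightarrow> of_nat N \<noteq> (0::'a) \<Longrightarrow>
      s \<in> torus_points r \<Longrightarrow>
      (\<Sum>t\<in>torsion_points r N. \<rho> (\<psi> (\<lambda>i. t i * s i)) $$ (i, j)) = of_nat (N ^ r) * c j"
    unfolding choice_iff by blast
  \<comment> \<open>One \<open>N\<close> beyond the bounds of all entries of row \<open>i\<close>,
    so that the same average works for the whole functional.\<close>
  obtain N where N: "N > Max (insert 0 (B ` {..<m}))" "of_nat N \<noteq> (0::'a)"
    using ex_large_of_nat_nonzero by blast
  have N_gt: "N > B j" if "j < m" for j
    using N(1) that by simp
  have "N > 0"
    using N(1) by auto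
  define a where "a j = of_nat (N ^ r) * c j" for j
  define l where "l w = (\<Sum>j<m. a j * w $ j)" for w
  \<comment> \<open>The base point \<open>s\<close> may be chosen freely. Comparing the base point 1
    at \<open>\<rho> t w\<close> with the base point of \<open>t\<close> at \<open>w\<close> yields
    invariance under \<open>t\<close>.\<close>
  have l: "l w = (\<Sum>t\<in>torsion_points r N. (\<rho> (\<psi> (\<lambda>i. t i * s i)) *\<^sub>v w) $ i)"
    if s: "s \<in> torus_points r" and w: "w \<in> carrier_vec m" for s w
  proof -
    have "l w = (\<Sum>j<m. (\<Sum>t\<in>torsion_points r N. \<rho> (\<psi> (\<lambda>i. t i * s i)) $$ (i, j)) * w $ j)"
      unfolding l_def a_def using Bc[OF _ N_gt N(2) s] by (intro sum.cong) auto
    also have "\<dots> = (\<Sum>t\<in>torsion_points r N. \<Sum>j<m. \<rho> (\<psi> (\<lambda>i. t i * s i)) $$ (i, j) * w $ j)"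
      by (subst sum.swap) (simp add: sum_distrib_right)
    also have "\<dots> = (\<Sum>t\<in>torsion_points r N. (\<rho> (\<psi> (\<lambda>i. t i * s i)) *\<^sub>v w) $ i)"
    proof (intro sum.cong refl)
      fix t :: "nat \<Rightarrow> 'a" assume "t \<in> torsion_points r N"
      then have "\<rho> (\<psi> (\<lambda>i. t i * s i)) \<in> carrier_mat m m"
        by (intro rational_repD(1)[OF \<rho>] param_G torus_points_mult s torsion_points_subset[OF \<open>N > 0\<close>])
      then show "(\<Sum>j<m. \<rho> (\<psi> (\<lambda>i. t i * s i)) $$ (i, j) * w $ j) =
          (\<rho> (\<psi> (\<lambda>i. t i * s i)) *\<^sub>v w) $ i"
        using i w by (auto simp: scalar_prod_def atLeast0LessThan intro!: sum.cong)
    qed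
    finally show ?thesis .
  qed
  have one: "(\<lambda>_. 1) \<in> torus_points r"
    by (simp add: torus_points_def)
  have "l (\<rho> t *\<^sub>v w) = l w" if t: "t \<in> T" and w: "w \<in> carrier_vec m" for t w
  proof -
    obtain s where s: "s \<in> torus_points r" "t = \<psi> s"
      using torus_paramE[OF torus t] by blast
    have \<rho>s: "\<rho> (\<psi> s) \<in> carrier_mat m m"
      by (intro rational_repD(1)[OF \<rho>] param_G s)
    then have "\<rho> t *\<^sub>v w \<in> carrier_vec m"
      using s w by auto
    then have "l (\<rho> t *\<^sub>v w) =
        (\<Sum>u\<in>torsion_points r N. (\<rho> (\<psi> (\<lambda>i. u i * 1)) *\<^sub>v (\<rho> t *\<^sub>v w)) $ i)"
      by (rule l[OF one])
    also have "\<dots> = (\<Sum>u\<in>torsion_points r N. (\<rho> (\<psi> (\<lambda>i. u i * s i)) *\<^sub>v w) $ i)"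
    proof (intro sum.cong refl)
      fix u :: "nat \<Rightarrow> 'a" assume "u \<in> torsion_points r N"
      then have u: "u \<in> torus_points r"
        by (intro torsion_points_subset[OF \<open>N > 0\<close>])
      have "\<rho> (\<psi> u) \<in> carrier_mat m m"
        by (intro rational_repD(1)[OF \<rho>] param_G u)
      then show "(\<rho> (\<psi> (\<lambda>i. u i * 1)) *\<^sub>v (\<rho> t *\<^sub>v w)) $ i = (\<rho> (\<psi> (\<lambda>i. u i * s i)) *\<^sub>v w) $ i"
        using s u w \<rho>s rational_repD(2)[OF \<rho> param_G[OF u] param_G[OF s(1)]]
        by (simp add: torus_param_mult[OF torus])
    qed
    also have "\<dots> = l w"
      by (rule l[OF s(1) w, symmetric])
    finally show ?thesis .
  qed
  moreover have "l v = of_nat (N ^ r) * v $ i"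
  proof -
    have "l v = (\<Sum>t\<in>torsion_points r N. (\<rho> (\<psi> (\<lambda>i. t i * 1)) *\<^sub>v v) $ i)"
      by (rule l[OF one v_carrier])
    also have "\<dots> = (\<Sum>t\<in>(torsion_points r N :: (nat \<Rightarrow> 'a) set). v $ i)"
      using param_G[OF torsion_points_subset[OF \<open>N > 0\<close>]] by (intro sum.cong) (auto simp: v_fixed)
    finally show ?thesis
      by (simp add: card_torsion_points[OF N(2)])
  qed
  ultimately show ?thesis
    using i(2) N(2) unfolding l_def by (intro exI[of _ a]) auto
qed

theorem exists_invariant_of_sylow_degree:
  assumes char: "CHAR('a) = p" "p > 0" and P: "sylow_subgroup p P quotient"
    and \<rho>: "rational_rep n G m \<rho>" and v: "v \<in> fixed_vecs G m \<rho>" "v \<noteq> 0\<^sub>v m"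
  shows "\<exists>f\<in>const_term_zero m (invariants_le n G m \<rho> (card P)). f v \<noteq> 0"
proof -
  have subP: "subgroup P quotient"
    using P by (simp add: sylow_subgroup_def)
  have v_carrier: "v \<in> carrier_vec m" and v_fixed: "\<And>A. A \<in> G \<Longrightarrow> \<rho> A *\<^sub>v v = v"
    using v(1) by (auto simp: fixed_vecs_def)
  obtain a where a: "\<And>t w. t \<in> T \<Longrightarrow> w \<in> carrier_vec m \<Longrightarrow>
      (\<Sum>j<m. a j * (\<rho> t *\<^sub>v w) $ j) = (\<Sum>j<m. a j * w $ j)" "(\<Sum>j<m. a j * v $ j) \<noteq> 0"
    using exists_torus_invariant_functional[OF \<rho> v] by blast
  define l where "l w = (\<Sum>j<m. a j * w $ j)" for w
  define L where "L C w = l (\<rho> (rep_of C) *\<^sub>v w)" for C w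
  \<comment> \<open>Two representatives of a coset differ by a left factor in \<open>T\<close>,
    which \<open>l\<close> does not see; hence the choice made by \<open>rep_of\<close> is
    irrelevant.\<close>
  have L_class: "L (coset_of A) w = l (\<rho> A *\<^sub>v w)" if A: "A \<in> G" and w: "w \<in> carrier_vec m" for A w
  proof -
    have rep: "rep_of (coset_of A) \<in> G" "coset_of (rep_of (coset_of A)) = coset_of A"
      using rep_of[OF coset_of_mem[OF A]] by auto
    then obtain t where t: "t \<in> T" "rep_of (coset_of A) = t * A"
      using coset_of_self[OF rep(1)] by (auto simp: mem_coset_of_iff)
    have "t \<in> G"
      using t T_subset by blast
    then have "\<rho> (rep_of (coset_of A)) *\<^sub>v w = \<rho> t *\<^sub>v (\<rho> A *\<^sub>v w)"
      using rational_repD(1)[OF \<rho> \<open>t \<in> G\<close>] rational_repD(1)[OF \<rho> A] rational_repD(2)[OF \<rho> \<open>t \<in> G\<close> A] t w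
      by simp
    moreover have "\<rho> A *\<^sub>v w \<in> carrier_vec m"
      using rational_repD(1)[OF \<rho> A] w by auto
    ultimately show ?thesis
      unfolding L_def l_def using a(1)[OF t(1)] by simp
  qed
  \<comment> \<open>The group permutes the functionals \<open>L C\<close> by right multiplication on
    the index, which is why right cosets of \<open>P\<close> are summed.\<close>
  have L_translate: "L C (\<rho> A *\<^sub>v w) = L (C \<otimes>\<^bsub>quotient\<^esub> coset_of A) w"
    if C: "C \<in> carrier quotient" and A: "A \<in> G" and w: "w \<in> carrier_vec m" for C A w
  proof -
    obtain B where B: "B \<in> G" "C = coset_of B"
      using C by (auto simp: carrier_quotient)
    have "\<rho> A *\<^sub>v w \<in> carrier_vec m"
      using rational_repD(1)[OF \<rho> A] w by auto
    then have "L C (\<rho> A *\<^sub>v w) = l (\<rho> B *\<^sub>v (\<rho> A *\<^sub>v w))"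
      using L_class B by simp
    also have "\<dots> = l (\<rho> (B * A) *\<^sub>v w)"
      using rational_repD(1)[OF \<rho> A] rational_repD(1)[OF \<rho> B(1)] rational_repD(2)[OF \<rho> B(1) A] w
      by simp
    also have "\<dots> = L (C \<otimes>\<^bsub>quotient\<^esub> coset_of A) w"
      using L_class[OF mult_G[OF B(1) A] w] coset_of_mult[OF B(1) A] B by simp
    finally show ?thesis .
  qed
  have L_v: "L C v = l v" if "C \<in> carrier quotient" for C
    unfolding L_def using rep_of[OF that] v_fixed by simp
  have rcos_sub: "D \<subseteq> carrier quotient" if "D \<in> rcosets\<^bsub>quotient\<^esub> P" for D
    using Q.rcosets_subset_PowG[OF subP] that by blast
  have rcos_card: "card D = card P" if "D \<in> rcosets\<^bsub>quotient\<^esub> P" for D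
    using Q.card_rcosets_equal[OF that subgroup.subset[OF subP]] by simp
  define F where "F w = (\<Sum>D\<in>rcosets\<^bsub>quotient\<^esub> P. \<Prod>C\<in>D. L C w)" for w
  define f where "f = restrict F (carrier_vec m)"
  have F_inv: "F (\<rho> A *\<^sub>v w) = F w" if "A \<in> G" "w \<in> carrier_vec m" for A w
  proof -
    have "F (\<rho> A *\<^sub>v w) =
        (\<Sum>D\<in>rcosets\<^bsub>quotient\<^esub> P. \<Prod>C\<in>D. L (C \<otimes>\<^bsub>quotient\<^esub> coset_of A) w)"
      unfolding F_def using rcos_sub that by (intro sum.cong prod.cong refl L_translate) auto
    also have "\<dots> = F w"
      unfolding F_def by (rule Q.sum_prod_rcosets_translate[OF subP coset_of_mem[OF that(1)]])
    finally show ?thesis .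
  qed
  let ?lin = "\<lambda>d. lincomb {\<alpha>. sum \<alpha> {..<m} \<le> d} (monom_fun {..<m} (\<lambda>i v. v $ i)) (carrier_vec m)"
  have L_lin: "?lin (Suc 0) (L C)" if C: "C \<in> carrier quotient" for C
  proof -
    have \<rho>C: "\<rho> (rep_of C) \<in> carrier_mat m m"
      using rational_repD(1)[OF \<rho>] rep_of[OF C] by blast
    have coord: "?lin (Suc 0) (\<lambda>w. c * w $ k)" if "k < m" for k c
    proof -
      have "?lin (0 + Suc 0) (\<lambda>w. c * w $ k)"
        by (intro lincomb_monom_mult lincomb_monom_const
            lincomb_monom_coord[where x = "\<lambda>i v. v $ i", simplified]) (use that in auto)
      then show ?thesis
        by simp
    qed
    have "?lin (Suc 0) (\<lambda>w. \<Sum>j<m. \<Sum>k<m. (a j * \<rho> (rep_of C) $$ (j, k)) * w $ k)"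
      by (intro lincomb_sum coord) auto
    then show ?thesis
    proof (rule lincomb_cong)
      fix w :: "'a vec" assume w: "w \<in> carrier_vec m"
      have "(\<rho> (rep_of C) *\<^sub>v w) $ j = (\<Sum>k<m. \<rho> (rep_of C) $$ (j, k) * w $ k)" if "j < m" for j
        using \<rho>C w that by (auto simp: scalar_prod_def atLeast0LessThan intro!: sum.cong)
      then show "L C w = (\<Sum>j<m. \<Sum>k<m. (a j * \<rho> (rep_of C) $$ (j, k)) * w $ k)"
        unfolding L_def l_def by (auto simp: sum_distrib_left mult_ac intro!: sum.cong)
    qed
  qed
  have "?lin (card P) F"
    unfolding F_def
  proof (rule lincomb_sum)
    fix D assume D: "D \<in> rcosets\<^bsub>quotient\<^esub> P"
    have "?lin (card D) (\<lambda>w. \<Prod>C\<in>D. L C w)"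
      using rcos_sub[OF D] by (intro lincomb_monom_prod L_lin) auto
    then show "?lin (card P) (\<lambda>w. \<Prod>C\<in>D. L C w)"
      by (simp add: rcos_card[OF D])
  qed
  then have "?lin (card P) f"
    by (rule lincomb_cong) (simp add: f_def)
  then have f_deg: "f \<in> vec_poly_funs_le m (card P)"
    unfolding vec_poly_funs_le_def poly_funs_le_iff by (simp add: f_def)
  have "fun_action n m \<rho> A f = f" if A: "A \<in> G" for A
  proof -
    have A': "inv\<^bsub>GL n\<^esub> A \<in> G"
      using mem_G[OF A] by blast
    have "\<rho> (inv\<^bsub>GL n\<^esub> A) *\<^sub>v w \<in> carrier_vec m" if "w \<in> carrier_vec m" for w
      using rational_repD(1)[OF \<rho> A'] that by auto
    then show ?thesis
      unfolding fun_action_def f_def using F_inv[OF A'] by (auto simp: restrict_def fun_eq_iff)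
  qed
  then have f_inv: "f \<in> invariants_le n G m \<rho> (card P)"
    unfolding invariants_le_def Defs.invariants_def vec_poly_funs_def using f_deg by auto
  have pos: "card P > 0"
    using P char(2) by (simp add: sylow_subgroup_def)
  \<comment> \<open>Used twice: at \<open>v\<close> with \<open>c = l v\<close>, and at the origin
    with \<open>c = 0\<close>, where \<open>card P > 0\<close> makes the power vanish.\<close>
  have F_const: "F w = of_nat (card (rcosets\<^bsub>quotient\<^esub> P)) * c ^ card P"
    if "\<And>C. C \<in> carrier quotient \<Longrightarrow> L C w = c" for w c
  proof -
    have "F w = (\<Sum>D\<in>rcosets\<^bsub>quotient\<^esub> P. c ^ card P)"
      unfolding F_def
    proof (intro sum.cong refl)
      fix D assume D: "D \<in> rcosets\<^bsub>quotient\<^esub> P"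
      have "(\<Prod>C\<in>D. L C w) = (\<Prod>C\<in>D. c)"
        using that rcos_sub[OF D] by (intro prod.cong) auto
      then show "(\<Prod>C\<in>D. L C w) = c ^ card P"
        by (simp add: rcos_card[OF D])
    qed
    then show ?thesis
      by simp
  qed
  have "L C (0\<^sub>v m) = 0" if "C \<in> carrier quotient" for C
  proof -
    have "\<rho> (rep_of C) *\<^sub>v 0\<^sub>v m = 0\<^sub>v m"
      using rational_repD(1)[OF \<rho>, of "rep_of C"] rep_of[OF that] by (intro eq_vecI) auto
    then show ?thesis
      by (simp add: L_def l_def)
  qed
  then have "f (0\<^sub>v m) = 0"
    using F_const[of "0\<^sub>v m" 0] pos by (simp add: f_def)
  moreover have "f v \<noteq> 0"
  proof -
    have "of_nat (card (rcosets\<^bsub>quotient\<^esub> P)) \<noteq> (0::'a)"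
      using Q.sylow_index_not_dvd[OF P finite_quotient] char CHAR_not_1[where 'a = 'a]
      by (simp add: of_nat_eq_0_iff_char_dvd)
    then show ?thesis
      using F_const[of v "l v", OF L_v] a(2) v_carrier by (simp add: f_def l_def)
  qed
  ultimately show ?thesis
    using f_inv by (auto simp: const_term_zero_def)
qed

section \<open>Regularity of coset indicators\<close>

lemma closedin_coset_of:
  assumes x: "x \<in> G"
  shows "closedin (zariski n) (coset_of x)"
proof -
  have x': "x \<in> carrier (GL n)" "inv\<^bsub>GL n\<^esub> x \<in> carrier (GL n)"
    using mem_G[OF x] GLn.inv_closed by auto
  have "closedin (zariski n) {A \<in> topspace (zariski n). A * inv\<^bsub>GL n\<^esub> x \<in> T}"
    using continuous_map_mult_right[OF x'(2)] closed_T unfolding continuous_map_closedin by blast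
  moreover have "{A \<in> topspace (zariski n). A * inv\<^bsub>GL n\<^esub> x \<in> T} = coset_of x"
  proof (intro equalityI subsetI)
    fix A assume "A \<in> {A \<in> topspace (zariski n). A * inv\<^bsub>GL n\<^esub> x \<in> T}"
    then have A: "A \<in> carrier (GL n)" "A * inv\<^bsub>GL n\<^esub> x \<in> T"
      by (auto simp: topspace_zariski)
    have "A = (A * inv\<^bsub>GL n\<^esub> x) * x"
      using GLn.m_assoc[OF A(1) x'(2,1)] GLn.l_inv[OF x'(1)] GLn.r_one[OF A(1)] by simp
    then show "A \<in> coset_of x"
      using A(2) by (auto simp: mem_coset_of_iff)
  next
    fix A assume "A \<in> coset_of x"
    then obtain t where t: "t \<in> T" "A = t * x"
      by (auto simp: mem_coset_of_iff)
    have t': "t \<in> carrier (GL n)"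
      using t T_subset mem_G by blast
    have "A * inv\<^bsub>GL n\<^esub> x = t"
      using GLn.m_assoc[OF t' x'] GLn.r_inv[OF x'(1)] GLn.r_one[OF t'] t by simp
    then show "A \<in> {A \<in> topspace (zariski n). A * inv\<^bsub>GL n\<^esub> x \<in> T}"
      using t t' x' GLn.m_closed[OF t' x'(1)] by (simp add: topspace_zariski)
  qed
  ultimately show ?thesis
    by simp
qed

text \<open>Start from a polynomial \<open>q\<close> that vanishes on \<open>T x\<close> but not at
  \<open>y\<close>. Averaging makes it a multiple of a character along \<open>T y\<close>; the
  substitution of \<open>y A^{-1} y\<close> for \<open>A\<close> preserves \<open>T y\<close> and
  inverts that character, so the product of the two functions is a nonzero constant there.\<close>

lemma exists_regular_separating_cosets:
  assumes x: "x \<in> G" and y: "y \<in> G" and neq: "coset_of x \<noteq> coset_of y"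
  shows "\<exists>f. regular_on n G f \<and> (\<forall>A\<in>coset_of x. f A = 0) \<and> (\<forall>A\<in>coset_of y. f A = 1)"
proof -
  note M = fun_algebra_mat_polynomials[of n]
  have y': "y \<in> carrier (GL n)" "inv\<^bsub>GL n\<^esub> y \<in> carrier (GL n)" "y \<in> carrier_mat n n"
    using mem_G[OF y] GLn.inv_closed by auto
  have "y \<notin> coset_of x"
    using coset_of_eq[OF x, of y] neq by blast
  then obtain q where q: "q \<in> mat_polynomials n" "\<And>A. A \<in> coset_of x \<Longrightarrow> q A = 0" "q y \<noteq> 0"
    using closedin_coset_of[OF x] y'(1) unfolding closedin_zariski_iff by blast
  have one: "(\<lambda>_. 1) \<in> torus_points r"
    by (simp add: torus_points_def)
  have "(\<lambda>u. q (\<psi> u * y)) \<in> laurent r"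
    by (rule laurent_torus_param[OF torus q(1) y'(3)])
  moreover have "q (\<psi> (\<lambda>_. 1) * y) \<noteq> 0"
    using q(3) y'(3) by (simp add: param_one)
  ultimately obtain \<beta> B c where c: "c \<noteq> 0" "\<forall>N>B. of_nat N \<noteq> (0::'a) \<longrightarrow> (\<forall>s\<in>torus_points r.
      (\<Sum>t\<in>torsion_points r N. laurent_monom r (\<lambda>i. - \<beta> i) t * q (\<psi> (\<lambda>i. t i * s i) * y)) =
        of_nat (N ^ r) * c * laurent_monom r \<beta> s)"
    using laurent_average_weight[OF _ one] by blast
  obtain N where N: "N > B" "of_nat N \<noteq> (0::'a)"
    using ex_large_of_nat_nonzero by blast
  have "N > 0"
    using N(1) by auto
  define \<kappa> where "\<kappa> = of_nat (N ^ r) * c"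
  have \<kappa>: "\<kappa> \<noteq> 0"
    using N(2) c(1) by (simp add: \<kappa>_def)
  define q' where "q' A = (\<Sum>t\<in>torsion_points r N. laurent_monom r (\<lambda>i. - \<beta> i) t * q (\<psi> t * A))" for A
  have tors: "t \<in> torus_points r" "\<psi> t \<in> carrier_mat n n" if "t \<in> torsion_points r N" for t
    using torsion_points_subset[OF \<open>N > 0\<close> that] torus_param_carrier[OF torus] by auto
  have q'_poly: "q' \<in> mat_polynomials n"
    unfolding q'_def
    by (intro fun_algebra_sum[OF M] fun_algebraD(1,3)[OF M] mat_polynomials_mult_left q tors)
  \<comment> \<open>Averaging keeps the zeros on the coset of \<open>x\<close>, which is stable
    under left multiplication by \<open>T\<close>.\<close>
  have q'_x: "q' A = 0" if A: "A \<in> coset_of x" for A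
    unfolding q'_def
  proof (intro sum.neutral ballI)
    fix t :: "nat \<Rightarrow> 'a" assume "t \<in> torsion_points r N"
    then have t: "\<psi> t \<in> T"
      using torus_param_mem[OF torus] tors by blast
    obtain s where s: "s \<in> T" "A = s * x"
      using A by (auto simp: mem_coset_of_iff)
    have "\<psi> t * A = (\<psi> t * s) * x"
      using s t T_subset mem_G(2) x by (metis assoc_mult_mat subsetD)
    moreover have "\<psi> t * s \<in> T"
      using subgroup.m_closed[OF T.subgroup_axioms t s(1)] by simp
    ultimately have "\<psi> t * A \<in> coset_of x"
      by (auto simp: mem_coset_of_iff)
    then show "laurent_monom r (\<lambda>i. - \<beta> i) t * q (\<psi> t * A) = 0"
      using q(2) by simp
  qed
  have q'_y: "q' (\<psi> s * y) = \<kappa> * laurent_monom r \<beta> s" if s: "s \<in> torus_points r" for s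
  proof -
    have "\<psi> t * (\<psi> s * y) = \<psi> (\<lambda>i. t i * s i) * y" if "t \<in> torsion_points r N" for t
      using torus_param_mult[OF torus tors(1)[OF that] s] tors(2)[OF that]
        torus_param_carrier[OF torus s] y'(3) by simp
    then show ?thesis
      unfolding q'_def \<kappa>_def using c(2) N s by simp
  qed
  \<comment> \<open>The second factor need not vanish on the coset of \<open>x\<close>; the first
    one does. The last factor normalizes the value on the coset of \<open>y\<close> to 1.\<close>
  define f where "f A = q' A * q' (y * inv\<^bsub>GL n\<^esub> A * y) * inverse (\<kappa> * \<kappa>)" for A
  have G_GL: "G \<subseteq> carrier (GL n)" "G \<subseteq> carrier_mat n n"
    using mem_G by auto
  note R = fun_algebra_regular_on[OF G_GL(1)]
  have "(\<lambda>B. q' (y * B * y)) \<in> mat_polynomials n"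
    using mat_polynomials_mult_left[OF mat_polynomials_mult_right[OF q'_poly y'(3)] y'(3)] .
  then have "regular_on n G (\<lambda>A. q' (y * inv\<^bsub>GL n\<^esub> A * y))"
    by (rule regular_on_compose_inv[OF G_GL(1)])
  moreover have "regular_on n G q'"
    by (rule regular_on_mat_polynomials[OF G_GL(2) q'_poly])
  ultimately have "f \<in> {f. regular_on n G f}"
    unfolding f_def by (intro fun_algebraD(1,3)[OF R]) auto
  then have "regular_on n G f"
    by simp
  moreover have "f A = 0" if "A \<in> coset_of x" for A
    using q'_x[OF that] by (simp add: f_def)
  moreover have "f A = 1" if "A \<in> coset_of y" for A
  proof -
    obtain t where t: "t \<in> T" "A = t * y"
      using \<open>A \<in> coset_of y\<close> by (auto simp: mem_coset_of_iff)
    obtain s where "s \<in> torus_points r" "t = \<psi> s"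
      by (rule torus_paramE[OF torus t(1)])
    with t have s: "s \<in> torus_points r" "A = \<psi> s * y"
      by auto
    let ?s = "\<lambda>i. inverse (s i)"
    have s': "?s \<in> torus_points r"
      by (rule torus_points_inverse[OF s(1)])
    have GL: "\<psi> s \<in> carrier (GL n)" "\<psi> ?s \<in> carrier (GL n)"
      using torus_param_GL[OF torus] s(1) s' by auto
    have "\<psi> s \<otimes>\<^bsub>GL n\<^esub> \<psi> ?s = \<one>\<^bsub>GL n\<^esub>"
      using torus_param_inverse[OF torus s(1)] by simp
    then have inv_s: "inv\<^bsub>GL n\<^esub> (\<psi> s) = \<psi> ?s"
      using GL GLn.inv_comm GLn.inv_equality by blast
    have "inv\<^bsub>GL n\<^esub> A = inv\<^bsub>GL n\<^esub> y * \<psi> ?s"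
      using GLn.inv_mult_group[OF GL(1) y'(1)] inv_s s(2) by simp
    then have "y * inv\<^bsub>GL n\<^esub> A = (y * inv\<^bsub>GL n\<^esub> y) * \<psi> ?s"
      using GLn.m_assoc[OF y'(1,2) GL(2)] by simp
    also have "\<dots> = \<psi> ?s"
      using GLn.r_inv[OF y'(1)] GLn.l_one[OF GL(2)] by simp
    finally have "y * inv\<^bsub>GL n\<^esub> A * y = \<psi> ?s * y"
      by simp
    then have "f A = (\<kappa> * laurent_monom r \<beta> s) * (\<kappa> * inverse (laurent_monom r \<beta> s)) * inverse (\<kappa> * \<kappa>)"
      unfolding f_def using q'_y[OF s(1)] q'_y[OF s'] s(2) by (simp add: laurent_monom_inverse)
    then show ?thesis
      using \<kappa> laurent_monom_nonzero[OF s(1), of \<beta>] by (simp add: field_simps)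
  qed
  ultimately show ?thesis
    by blast
qed

text \<open>Product of the separating functions over the finitely many other cosets: each of these
  is killed by its own factor, and every factor is 1 on the coset of \<open>y\<close>.\<close>

lemma regular_on_coset_indicator:
  assumes y: "y \<in> G"
  shows "regular_on n G (\<lambda>A. if coset_of A = coset_of y then 1 else 0)"
proof -
  let ?S = "carrier quotient - {coset_of y}"
  have "\<exists>f. regular_on n G f \<and> (\<forall>A\<in>C. f A = 0) \<and> (\<forall>A\<in>coset_of y. f A = 1)" if C: "C \<in> ?S" for C
  proof -
    obtain x where "x \<in> G" "C = coset_of x" "coset_of x \<noteq> coset_of y"
      using C by (auto simp: carrier_quotient)
    then show ?thesis
      using exists_regular_separating_cosets[OF _ y, of x] by simp
  qed
  then have "\<forall>C\<in>?S. \<exists>f. regular_on n G f \<and> (\<forall>A\<in>C. f A = 0) \<and> (\<forall>A\<in>coset_of y. f A = 1)"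
    by blast
  then obtain f where
    "\<forall>C\<in>?S. regular_on n G (f C) \<and> (\<forall>A\<in>C. f C A = 0) \<and> (\<forall>A\<in>coset_of y. f C A = 1)"
    by (rule bchoice[THEN exE])
  then have f: "\<And>C. C \<in> ?S \<Longrightarrow> regular_on n G (f C)"
      "\<And>C A. C \<in> ?S \<Longrightarrow> A \<in> C \<Longrightarrow> f C A = 0" "\<And>C A. C \<in> ?S \<Longrightarrow> A \<in> coset_of y \<Longrightarrow> f C A = 1"
    by blast+
  have "(\<lambda>A. \<Prod>C\<in>?S. f C A) \<in> {f. regular_on n G f}"
    using f(1) by (intro fun_algebra_prod[OF fun_algebra_regular_on]) (auto intro: mem_G)
  then have "regular_on n G (\<lambda>A. \<Prod>C\<in>?S. f C A)"
    by simp
  then show ?thesis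
  proof (rule regular_on_cong)
    fix A assume A: "A \<in> G"
    show "(if coset_of A = coset_of y then 1 else 0) = (\<Prod>C\<in>?S. f C A)"
    proof (cases "coset_of A = coset_of y")
      case True
      then have "A \<in> coset_of y"
        using coset_of_self[OF A] by simp
      then show ?thesis
        using True f(3) by simp
    next
      case False
      then have S: "coset_of A \<in> ?S"
        using coset_of_mem[OF A] by simp
      then have "f (coset_of A) A = 0"
        using f(2) coset_of_self[OF A] by blast
      then have "(\<Prod>C\<in>?S. f C A) = 0"
        using S finite_quotient by (intro prod_zero) auto
      then show ?thesis
        using False by simp
    qed
  qed
qed

end


section \<open>Invariants of free permutation representations of \<open>p\<close>-groups\<close>

text \<open>A finite field could not hold the \<open>N\<close> distinct N-th roots of unity for
  large admissible \<open>N\<close>.\<close>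

lemma infinite_UNIV_alg_closed_field: "infinite (UNIV :: 'a::alg_closed_field set)"
proof
  assume fin: "finite (UNIV :: 'a set)"
  obtain N where N: "N > card (UNIV :: 'a set)" "of_nat N \<noteq> (0::'a)"
    using ex_large_of_nat_nonzero by blast
  have "card (unity_roots N :: 'a set) \<le> card (UNIV :: 'a set)"
    by (rule card_mono[OF fin]) auto
  then show False
    using N card_unity_roots[OF N(2)] by simp
qed

section \<open>Digits in base b and independence of monomials\<close>

lemma sum_digits_less:
  fixes \<alpha> :: "nat \<Rightarrow> nat"
  assumes "\<And>i. i < m \<Longrightarrow> \<alpha> i < b"
  shows "(\<Sum>i<m. \<alpha> i * b ^ i) < b ^ m"
  using assms
proof (induction m)
  case (Suc m)
  have "(\<Sum>i<Suc m. \<alpha> i * b ^ i) < b ^ m + \<alpha> m * b ^ m"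
    using Suc by simp
  also have "\<dots> = Suc (\<alpha> m) * b ^ m"
    by simp
  also have "\<dots> \<le> b * b ^ m"
    using Suc.prems[of m] by (intro mult_le_mono1) auto
  finally show ?case
    by simp
qed simp

lemma sum_digits_inject:
  fixes \<alpha> \<beta> :: "nat \<Rightarrow> nat"
  assumes "\<And>i. i < m \<Longrightarrow> \<alpha> i < b" "\<And>i. i < m \<Longrightarrow> \<beta> i < b"
    and "(\<Sum>i<m. \<alpha> i * b ^ i) = (\<Sum>i<m. \<beta> i * b ^ i)" and "i < m"
  shows "\<alpha> i = \<beta> i"
  using assms
proof (induction m)
  case (Suc m)
  have less: "(\<Sum>i<m. \<alpha> i * b ^ i) < b ^ m" "(\<Sum>i<m. \<beta> i * b ^ i) < b ^ m"
    using Suc.prems by (auto intro: sum_digits_less)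
  have div: "(s + a * l) div l = a" if "s < l" for s a l :: nat
    using that by (cases "l = 0") auto
  have "\<alpha> m = \<beta> m"
    using Suc.prems(3) div[OF less(1), of "\<alpha> m"] div[OF less(2), of "\<beta> m"] by simp
  then show ?case
    using Suc by (cases "i = m") auto
qed simp

text \<open>Kronecker's substitution \<open>x\<^sub>i = t\<^bsup>b^i\<^esup>\<close> reduces this to polynomials in one variable.\<close>

lemma monomials_independent:
  fixes c :: "(nat \<Rightarrow> nat) \<Rightarrow> 'a::alg_closed_field"
  assumes A: "finite A" "\<And>\<alpha> i. \<alpha> \<in> A \<Longrightarrow> i \<ge> m \<Longrightarrow> \<alpha> i = 0"
    and zero: "\<And>x. (\<Sum>\<alpha>\<in>A. c \<alpha> * (\<Prod>i<m. x i ^ \<alpha> i)) = 0"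
    and \<alpha>: "\<alpha> \<in> A"
  shows "c \<alpha> = 0"
proof -
  \<comment> \<open>The base exceeds every exponent that occurs, so that \<open>k \<beta>\<close>
    has the exponents as its digits and determines \<open>\<beta>\<close>.\<close>
  define b where "b = Suc (Max ((\<lambda>(\<alpha>, i). \<alpha> i) ` (A \<times> {..<m}) \<union> {0}))"
  have b: "\<beta> i < b" if "\<beta> \<in> A" "i < m" for \<beta> i
  proof -
    have "\<beta> i \<in> (\<lambda>(\<alpha>, i). \<alpha> i) ` (A \<times> {..<m}) \<union> {0}"
      using that by (intro UnI1 image_eqI[of _ _ "(\<beta>, i)"]) auto
    then show ?thesis
      unfolding b_def using A(1) by (intro le_imp_less_Suc Max_ge) auto
  qed
  define k where "k \<beta> = (\<Sum>i<m. \<beta> i * b ^ i)" for \<beta> :: "nat \<Rightarrow> nat"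
  have inj: "\<beta> = \<gamma>" if "\<beta> \<in> A" "\<gamma> \<in> A" "k \<beta> = k \<gamma>" for \<beta> \<gamma>
  proof
    fix i
    show "\<beta> i = \<gamma> i"
    proof (cases "i < m")
      case True
      then show ?thesis
        using sum_digits_inject[of m \<beta> b \<gamma> i] b that unfolding k_def by blast
    next
      case False
      then show ?thesis
        using A(2)[OF that(1), of i] A(2)[OF that(2), of i] by simp
    qed
  qed
  define q where "q = (\<Sum>\<beta>\<in>A. monom (c \<beta>) (k \<beta>))"
  have "poly q t = 0" for t
  proof -
    have "poly q t = (\<Sum>\<beta>\<in>A. c \<beta> * (\<Prod>i<m. (t ^ (b ^ i)) ^ \<beta> i))"
      unfolding q_def poly_sum poly_monom k_def power_sum power_mult[symmetric]
      by (simp add: mult.commute)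
    then show ?thesis
      using zero[of "\<lambda>i. t ^ (b ^ i)"] by simp
  qed
  then have "q = 0"
    using poly_roots_finite[of q] infinite_UNIV_alg_closed_field[where 'a = 'a] by auto
  then have "0 = coeff q (k \<alpha>)"
    by simp
  also have "\<dots> = (\<Sum>\<beta>\<in>A. if \<beta> = \<alpha> then c \<beta> else 0)"
    unfolding q_def coeff_sum using inj \<alpha> by (intro sum.cong) (auto simp: coeff_monom)
  also have "\<dots> = c \<alpha>"
    using A(1) \<alpha> by simp
  finally show ?thesis
    by simp
qed

section \<open>Sums over orbits of p-groups and coefficients of invariants\<close>

text \<open>Orbits have p-power length and \<open>c\<close> is constant on them, so an orbit with
  more than one element contributes a multiple of \<open>p\<close>, which is zero. Such an orbit
  contains no fixed point either.\<close>

lemma (in group_action) sum_eq_sum_fixed_points: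
  fixes c :: "_ \<Rightarrow> 'k::comm_ring_1"
  assumes "finite E" and p: "prime p" "CHAR('k) = p" and order: "Coset.order G = p ^ k"
    and inv: "\<And>g x. g \<in> carrier G \<Longrightarrow> x \<in> E \<Longrightarrow> c (\<phi> g x) = c x"
  shows "(\<Sum>x\<in>E. c x) = (\<Sum>x\<in>E. if \<forall>g\<in>carrier G. \<phi> g x = x then c x else 0)"
proof -
  define c' where "c' x = (if \<forall>g\<in>carrier G. \<phi> g x = x then c x else 0)" for x
  have "(\<Sum>x\<in>orb. c x) = (\<Sum>x\<in>orb. c' x)" if orb: "orb \<in> orbits G E \<phi>" for orb
  proof -
    obtain x where x: "x \<in> E" "orb = Group_Action.orbit G \<phi> x"
      using orb by (auto simp: orbits_def)
    have orb_sub: "orb \<subseteq> E"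
      using orbits_coverture orb by blast
    have "finite orb"
      using orb_sub assms(1) finite_subset by blast
    have "card orb dvd p ^ k"
      using orbit_stabilizer_theorem[OF x(1)] order x(2) by (metis dvd_triv_left)
    then obtain j where j: "card orb = p ^ j"
      using divides_primepow_nat[OF p(1)] by blast
    have "c y = c x" if "y \<in> orb" for y
      using that x inv unfolding orbit_def by auto
    then have sum_c: "(\<Sum>y\<in>orb. c y) = of_nat (card orb) * c x"
      by simp
    show ?thesis
    proof (cases "j = 0")
      case True
      then obtain y where "orb = {y}"
        using j by (auto simp: card_1_singleton_iff)
      then have "orb = {x}"
        using orbit_refl[OF x(1)] x(2) by auto
      then have "\<forall>g\<in>carrier G. \<phi> g x = x"
        using x(2) unfolding orbit_def by auto
      then show ?thesis
        using \<open>orb = {x}\<close> by (simp add: c'_def)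
    next
      case False
      then have "p dvd card orb"
        using j by simp
      then have "(\<Sum>y\<in>orb. c y) = 0"
        unfolding sum_c using of_nat_eq_0_iff_char_dvd[where 'a = 'k, of "card orb"] p(2) by simp
      moreover have "c' y = 0" if y: "y \<in> orb" for y
      proof -
        have "\<not> (\<forall>g\<in>carrier G. \<phi> g y = y)"
        proof
          assume fixed: "\<forall>g\<in>carrier G. \<phi> g y = y"
          have "y \<in> E"
            using y orb_sub by blast
          then have "x \<in> Group_Action.orbit G \<phi> y"
            using orbit_sym[OF x(1)] y x(2) by simp
          then have "x = y"
            using fixed unfolding orbit_def by auto
          then have "orb = {x}"
            using fixed x orbit_refl[OF x(1)] unfolding orbit_def by auto
          then have "p ^ j = 1"
            using j by simp
          then show False
            using False p(1) by (metis less_irrefl one_less_power prime_gt_1_nat neq0_conv)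
        qed
        then show ?thesis
          unfolding c'_def by (rule if_not_P)
      qed
      ultimately show ?thesis
        by simp
    qed
  qed
  then have "(\<Sum>orb\<in>orbits G E \<phi>. \<Sum>x\<in>orb. c x) = (\<Sum>orb\<in>orbits G E \<phi>. \<Sum>x\<in>orb. c' x)"
    by (rule sum.cong[OF refl])
  then show ?thesis
    unfolding disjoint_sum[OF assms(1)] c'_def .
qed

text \<open>Zero from \<open>m\<close> on: this makes the set finite and the expansion of a
  polynomial function unique.\<close>

definition exponents_le :: "nat \<Rightarrow> nat \<Rightarrow> (nat \<Rightarrow> nat) set" where
  "exponents_le m d = {\<alpha>. (\<forall>i\<ge>m. \<alpha> i = 0) \<and> sum \<alpha> {..<m} \<le> d}"

lemma finite_exponents_le: "finite (exponents_le m d)"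
proof (rule finite_subset)
  show "exponents_le m d \<subseteq> {\<alpha>. \<forall>i. (i \<in> {..<m} \<longrightarrow> \<alpha> i \<in> {..d}) \<and> (i \<notin> {..<m} \<longrightarrow> \<alpha> i = 0)}"
  proof
    fix \<alpha> assume \<alpha>: "\<alpha> \<in> exponents_le m d"
    have "\<alpha> i \<le> d" if "i < m" for i
      using member_le_sum[of i "{..<m}" \<alpha>] that \<alpha> by (auto simp: exponents_le_def)
    then show "\<alpha> \<in> {\<alpha>. \<forall>i. (i \<in> {..<m} \<longrightarrow> \<alpha> i \<in> {..d}) \<and> (i \<notin> {..<m} \<longrightarrow> \<alpha> i = 0)}"
      using \<alpha> by (auto simp: exponents_le_def)
  qed
  show "finite {\<alpha>. \<forall>i. (i \<in> {..<m} \<longrightarrow> \<alpha> i \<in> {..d}) \<and> (i \<notin> {..<m} \<longrightarrow> \<alpha> i = (0::nat))}"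
    by (intro finite_set_of_finite_funs) auto
qed

text \<open>Exponents in \<open>poly_funs_le\<close> are arbitrary outside the index set. Cutting
  them off at \<open>m\<close> leaves the monomial functions unchanged and gives all functions of
  degree at most \<open>d\<close> one common index set.\<close>

lemma vec_poly_funs_le_expansion:
  assumes "f \<in> vec_poly_funs_le m d"
  shows "\<exists>c. \<forall>w\<in>carrier_vec m. f w = (\<Sum>\<alpha>\<in>exponents_le m d. c \<alpha> * (\<Prod>i<m. w $ i ^ \<alpha> i))"
proof -
  let ?\<phi> = "monom_fun {..<m} (\<lambda>i v. v $ i)"
  obtain A c where A: "finite A" "A \<subseteq> {\<alpha>. sum \<alpha> {..<m} \<le> d}"
      "\<forall>w\<in>carrier_vec m. f w = (\<Sum>\<alpha>\<in>A. c \<alpha> * ?\<phi> \<alpha> w)"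
    using assms unfolding vec_poly_funs_le_def poly_funs_le_iff lincomb_def by blast
  have "lincomb (exponents_le m d) ?\<phi> (carrier_vec m) (\<lambda>w. \<Sum>\<alpha>\<in>A. c \<alpha> * ?\<phi> \<alpha> w)"
  proof (rule lincomb_sum)
    fix \<alpha> assume \<alpha>: "\<alpha> \<in> A"
    let ?\<alpha> = "\<lambda>i. if i < m then \<alpha> i else 0"
    have "lincomb (exponents_le m d) ?\<phi> (carrier_vec m) (\<lambda>w. c \<alpha> * ?\<phi> ?\<alpha> w)"
      by (rule lincomb_base) (use A(2) \<alpha> in \<open>auto simp: exponents_le_def\<close>)
    then show "lincomb (exponents_le m d) ?\<phi> (carrier_vec m) (\<lambda>w. c \<alpha> * ?\<phi> \<alpha> w)"
      by (rule lincomb_cong) (simp add: monom_fun_def)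
  qed
  then have "lincomb (exponents_le m d) ?\<phi> (carrier_vec m) f"
    by (rule lincomb_cong) (use A(3) in simp)
  then obtain B c' where B: "finite B" "B \<subseteq> exponents_le m d"
      "\<forall>w\<in>carrier_vec m. f w = (\<Sum>\<alpha>\<in>B. c' \<alpha> * ?\<phi> \<alpha> w)"
    unfolding lincomb_def by blast
  have "f w = (\<Sum>\<alpha>\<in>exponents_le m d. (if \<alpha> \<in> B then c' \<alpha> else 0) * (\<Prod>i<m. w $ i ^ \<alpha> i))"
    if "w \<in> carrier_vec m" for w
  proof -
    have "f w = (\<Sum>\<alpha>\<in>B. c' \<alpha> * ?\<phi> \<alpha> w)"
      using B(3) that by blast
    also have "\<dots> = (\<Sum>\<alpha>\<in>exponents_le m d. (if \<alpha> \<in> B then c' \<alpha> else 0) * (\<Prod>i<m. w $ i ^ \<alpha> i))"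
      by (rule sum.mono_neutral_cong_left)
         (use B finite_exponents_le in \<open>auto simp: monom_fun_def\<close>)
    finally show ?thesis .
  qed
  then show ?thesis
    by (intro exI[of _ "\<lambda>\<alpha>. if \<alpha> \<in> B then c' \<alpha> else 0"] ballI)
qed

lemma free_p_group_invariant_at_ones:
  fixes c :: "(nat \<Rightarrow> nat) \<Rightarrow> 'a::alg_closed_field" and K (structure)
  assumes K: "group K" and p: "prime p" "CHAR('a) = p"
    and order: "Coset.order K = p ^ k" and d: "d < p ^ k"
    and \<sigma>: "\<And>a i. a \<in> carrier K \<Longrightarrow> i < m \<Longrightarrow> \<sigma> a i < m"
      "\<And>a b i. a \<in> carrier K \<Longrightarrow> b \<in> carrier K \<Longrightarrow> i < m \<Longrightarrow> \<sigma> (a \<otimes> b) i = \<sigma> a (\<sigma> b i)"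
      "\<And>i. i < m \<Longrightarrow> \<sigma> \<one> i = i"
    and free: "\<And>i. i < m \<Longrightarrow> inj_on (\<lambda>a. \<sigma> a i) (carrier K)"
    and F: "\<And>x. F x = (\<Sum>\<alpha>\<in>exponents_le m d. c \<alpha> * (\<Prod>i<m. x i ^ \<alpha> i))"
    and inv: "\<And>a x. a \<in> carrier K \<Longrightarrow> F (\<lambda>i. x (\<sigma> a i)) = F x"
  shows "F (\<lambda>_. 1) = F (\<lambda>_. 0)"
proof -
  interpret K: group K
    by (rule K)
  let ?E = "exponents_le m d"
  \<comment> \<open>Precomposition with \<open>\<sigma> a\<close> reverses products, see
    \<open>act_act\<close>; \<open>\<phi>\<close> below inserts the inverse to obtain an
    action.\<close>
  define act where "act a \<alpha> = (\<lambda>i. if i < m then \<alpha> (\<sigma> a i) else 0)" for a and \<alpha> :: "nat \<Rightarrow> nat"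
  have bij: "bij_betw (\<sigma> a) {..<m} {..<m}" if a: "a \<in> carrier K" for a
  proof (rule bij_betw_byWitness[of _ "\<sigma> (inv a)"])
    show "\<forall>i\<in>{..<m}. \<sigma> (inv a) (\<sigma> a i) = i" "\<forall>i\<in>{..<m}. \<sigma> a (\<sigma> (inv a) i) = i"
      using a \<sigma>(2)[of "inv a" a] \<sigma>(2)[of a "inv a"] \<sigma>(3) by auto
  qed (use a \<sigma>(1) in auto)
  have act_mem: "act a \<alpha> \<in> ?E" if a: "a \<in> carrier K" and \<alpha>: "\<alpha> \<in> ?E" for a \<alpha>
  proof -
    have "sum (act a \<alpha>) {..<m} = (\<Sum>i<m. \<alpha> (\<sigma> a i))"
      by (simp add: act_def)
    also have "\<dots> = sum \<alpha> {..<m}"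
      by (rule sum.reindex_bij_betw[OF bij[OF a]])
    finally show ?thesis
      using \<alpha> by (auto simp: exponents_le_def act_def)
  qed
  have act_act: "act b (act a \<alpha>) = act (a \<otimes> b) \<alpha>"
    if "a \<in> carrier K" "b \<in> carrier K" for a b \<alpha>
    using that \<sigma>(1,2) by (auto simp: act_def fun_eq_iff)
  have act_one: "act \<one> \<alpha> = \<alpha>" if "\<alpha> \<in> ?E" for \<alpha>
    using that \<sigma>(3) by (auto simp: act_def fun_eq_iff exponents_le_def)
  have act_inv: "act a (act (inv a) \<alpha>) = \<alpha>" "act (inv a) (act a \<alpha>) = \<alpha>"
    if "a \<in> carrier K" "\<alpha> \<in> ?E" for a \<alpha>
    using that by (auto simp: act_act act_one)
  \<comment> \<open>Invariance of the values of \<open>F\<close> is turned into invariance of its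
    coefficients by the independence of monomials.\<close>
  have c_inv: "c (act a \<beta>) = c \<beta>" if a: "a \<in> carrier K" and \<beta>: "\<beta> \<in> ?E" for a \<beta>
  proof -
    have "(\<Sum>\<alpha>\<in>?E. (c (act a \<alpha>) - c \<alpha>) * (\<Prod>i<m. x i ^ \<alpha> i)) = 0" for x
    proof -
      have mon: "(\<Prod>i<m. x (\<sigma> a i) ^ act a \<alpha> i) = (\<Prod>i<m. x i ^ \<alpha> i)" for \<alpha>
        using prod.reindex_bij_betw[OF bij[OF a], of "\<lambda>i. x i ^ \<alpha> i"] by (simp add: act_def)
      have "F x = F (\<lambda>i. x (\<sigma> a i))"
        by (rule inv[OF a, symmetric])
      also have "\<dots> = (\<Sum>\<alpha>\<in>?E. c \<alpha> * (\<Prod>i<m. x (\<sigma> a i) ^ \<alpha> i))"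
        by (rule F)
      also have "\<dots> = (\<Sum>\<alpha>\<in>?E. c (act a \<alpha>) * (\<Prod>i<m. x (\<sigma> a i) ^ act a \<alpha> i))"
        by (rule sum.reindex_bij_witness[of _ "act a" "act (inv a)"])
           (use a act_mem act_inv in auto)
      also have "\<dots> = (\<Sum>\<alpha>\<in>?E. c (act a \<alpha>) * (\<Prod>i<m. x i ^ \<alpha> i))"
        by (simp only: mon)
      finally show ?thesis
        unfolding F by (simp add: left_diff_distrib sum_subtractf)
    qed
    then have "c (act a \<beta>) - c \<beta> = 0"
      by (intro monomials_independent[OF finite_exponents_le _ _ \<beta>]) (auto simp: exponents_le_def)
    then show ?thesis
      by simp
  qed
  define \<phi> where "\<phi> a = (\<lambda>\<alpha>\<in>?E. act (inv a) \<alpha>)" for a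
  have \<phi>_Bij: "\<phi> a \<in> Bij ?E" if a: "a \<in> carrier K" for a
  proof -
    have "bij_betw (act (inv a)) ?E ?E"
      by (rule bij_betw_byWitness[of _ "act a"]) (use a act_mem act_inv in auto)
    then have "bij_betw (\<phi> a) ?E ?E"
      unfolding \<phi>_def by (subst bij_betw_restrict_eq)
    then show ?thesis
      by (simp add: Bij_def \<phi>_def)
  qed
  have "\<phi> \<in> hom K (BijGroup ?E)"
  proof (rule homI)
    show "\<phi> a \<in> carrier (BijGroup ?E)" if "a \<in> carrier K" for a
      using \<phi>_Bij[OF that] by (simp add: BijGroup_def)
    show "\<phi> (a \<otimes> b) = \<phi> a \<otimes>\<^bsub>BijGroup ?E\<^esub> \<phi> b" if ab: "a \<in> carrier K" "b \<in> carrier K" for a b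
    proof -
      have "\<phi> (a \<otimes> b) = compose ?E (\<phi> a) (\<phi> b)"
        using ab act_mem act_act by (auto simp: \<phi>_def compose_def fun_eq_iff K.inv_mult_group)
      then show ?thesis
        using ab by (simp add: BijGroup_def \<phi>_Bij)
    qed
  qed
  then interpret action: group_action K ?E \<phi>
    unfolding group_action_def group_hom_def group_hom_axioms_def
    using K group_BijGroup by blast
  have zero_mem: "(\<lambda>_. 0) \<in> ?E"
    by (simp add: exponents_le_def)
  have fixed_iff: "(\<forall>a\<in>carrier K. \<phi> a \<alpha> = \<alpha>) \<longleftrightarrow> \<alpha> = (\<lambda>_. 0)" if \<alpha>: "\<alpha> \<in> ?E" for \<alpha>
  proof
    assume fixed: "\<forall>a\<in>carrier K. \<phi> a \<alpha> = \<alpha>"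
    have const: "\<alpha> (\<sigma> a i) = \<alpha> i" if "a \<in> carrier K" "i < m" for a i
    proof -
      have "\<phi> (inv a) \<alpha> = \<alpha>"
        using fixed that by simp
      then have "act a \<alpha> = \<alpha>"
        using \<alpha> that by (simp add: \<phi>_def)
      then show ?thesis
        using that by (auto simp: act_def fun_eq_iff) metis
    qed
    show "\<alpha> = (\<lambda>_. 0)"
    proof (rule ccontr)
      assume "\<alpha> \<noteq> (\<lambda>_. 0)"
      then obtain i where i: "\<alpha> i \<noteq> 0"
        by auto
      then have "i < m"
        using \<alpha> by (auto simp: exponents_le_def not_less[symmetric])
      \<comment> \<open>By freeness the orbit of the coordinate \<open>i\<close> has
        \<open>p ^ k\<close> elements, and a fixed \<open>\<alpha>\<close> is constant and at least
        1 on it.\<close>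
      let ?O = "(\<lambda>a. \<sigma> a i) ` carrier K"
      have "p ^ k = card ?O"
        using card_image[OF free[OF \<open>i < m\<close>]] order by (simp add: Coset.order_def)
      also have "\<dots> = (\<Sum>j\<in>?O. 1)"
        by simp
      also have "\<dots> \<le> (\<Sum>j\<in>?O. \<alpha> j)"
        using i const \<open>i < m\<close> by (intro sum_mono) auto
      also have "\<dots> \<le> sum \<alpha> {..<m}"
        using \<sigma>(1) \<open>i < m\<close> by (intro sum_mono2) auto
      also have "\<dots> \<le> d"
        using \<alpha> by (simp add: exponents_le_def)
      finally show False
        using d by simp
    qed
  next
    assume "\<alpha> = (\<lambda>_. 0)"
    then show "\<forall>a\<in>carrier K. \<phi> a \<alpha> = \<alpha>"
      using zero_mem by (auto simp: \<phi>_def act_def)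
  qed
  have "F (\<lambda>_. 1) = (\<Sum>\<alpha>\<in>?E. c \<alpha>)"
    by (simp add: F)
  also have "\<dots> = (\<Sum>\<alpha>\<in>?E. if \<forall>a\<in>carrier K. \<phi> a \<alpha> = \<alpha> then c \<alpha> else 0)"
    by (rule action.sum_eq_sum_fixed_points[OF finite_exponents_le p order])
       (use c_inv in \<open>auto simp: \<phi>_def\<close>)
  also have "\<dots> = (\<Sum>\<alpha>\<in>?E. if \<alpha> = (\<lambda>_. 0) then c (\<lambda>_. 0) else 0)"
    using fixed_iff by (intro sum.cong) auto
  also have "\<dots> = c (\<lambda>_. 0)"
    using zero_mem finite_exponents_le by simp
  also have "\<dots> = (\<Sum>\<alpha>\<in>?E. if \<alpha> = (\<lambda>_. 0) then c (\<lambda>_. 0) else 0)"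
    using zero_mem finite_exponents_le by simp
  \<comment> \<open>At the origin only the constant term survives, with all its factors
    \<open>0 ^ 0\<close> equal to 1.\<close>
  also have "\<dots> = F (\<lambda>_. 0)"
    unfolding F
  proof (intro sum.cong refl)
    fix \<alpha> assume \<alpha>: "\<alpha> \<in> ?E"
    show "(if \<alpha> = (\<lambda>_. 0) then c (\<lambda>_. 0) else 0) = c \<alpha> * (\<Prod>i<m. 0 ^ \<alpha> i)"
    proof (cases "\<alpha> = (\<lambda>_. 0)")
      case False
      then obtain i where "\<alpha> i \<noteq> 0"
        by auto
      moreover from this have "i < m"
        using \<alpha> by (auto simp: exponents_le_def not_less[symmetric])
      ultimately have "(\<Prod>i<m. (0::'a) ^ \<alpha> i) = 0"
        by (intro prod_zero) (auto intro!: bexI[of _ i])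
      then show ?thesis
        using False by simp
    qed simp
  qed
  finally show ?thesis .
qed


section \<open>The regular representation of the component group\<close>

context finite_by_torus
begin

theorem exists_rep_without_small_invariants:
  assumes char: "CHAR('a) = p" "p > 0" and P: "sylow_subgroup p P quotient"
  shows "\<exists>m \<rho> v. rational_rep n G m \<rho> \<and> v \<in> fixed_vecs G m \<rho> \<and> v \<noteq> 0\<^sub>v m \<and>
    (\<forall>d f. d < card P \<longrightarrow> f \<in> const_term_zero m (invariants_le n G m \<rho> d) \<longrightarrow> f v = 0)"
proof -
  have subP: "subgroup P quotient" and cardP: "card P = p ^ multiplicity p (Coset.order quotient)"
    using P by (auto simp: sylow_subgroup_def)
  define m where "m = card (carrier quotient)"
  \<comment> \<open>The coordinates of the regular representation are the elements of the quotient,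
    numbered by \<open>e\<close>; \<open>\<sigma>\<close> is left multiplication on the
    numbers.\<close>
  obtain e where "bij_betw e {0..<m} (carrier quotient)"
    unfolding m_def using ex_bij_betw_nat_finite[OF finite_quotient] by blast
  then have e: "bij_betw e {..<m} (carrier quotient)"
    by (simp add: atLeast0LessThan)
  define idx where "idx = inv_into {..<m} e"
  have e_mem: "e i \<in> carrier quotient" if "i < m" for i
    using bij_betwE[OF e] that by blast
  have idx: "idx C < m" "e (idx C) = C" if "C \<in> carrier quotient" for C
    using that e bij_betw_inv_into_right[OF e] inv_into_into[of C e "{..<m}"]
    by (auto simp: idx_def bij_betw_def)
  have e_eq: "e i = e j \<longleftrightarrow> i = j" if "i < m" "j < m" for i j
    using that e by (auto simp: bij_betw_def inj_on_def)
  define \<sigma> where "\<sigma> a i = idx (a \<otimes>\<^bsub>quotient\<^esub> e i)" for a i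
  have \<sigma>_less: "\<sigma> a i < m" and e_\<sigma>: "e (\<sigma> a i) = a \<otimes>\<^bsub>quotient\<^esub> e i"
    if "a \<in> carrier quotient" "i < m" for a i
    using idx[OF Q.m_closed[OF that(1) e_mem[OF that(2)]]] by (auto simp: \<sigma>_def)
  have \<sigma>_eq: "e i = a \<otimes>\<^bsub>quotient\<^esub> e j \<longleftrightarrow> i = \<sigma> a j" if "a \<in> carrier quotient" "i < m" "j < m" for a i j
    using e_\<sigma>[OF that(1,3)] e_eq[OF that(2) \<sigma>_less[OF that(1,3)]] by auto
  define \<rho> where "\<rho> A = mat m m (\<lambda>(i, j). if e i = coset_of A \<otimes>\<^bsub>quotient\<^esub> e j then 1 else (0::'a))" for A
  have \<rho>_carrier: "\<rho> A \<in> carrier_mat m m" for A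
    by (simp add: \<rho>_def)
  have \<rho>_mult: "\<rho> (A * B) = \<rho> A * \<rho> B" if A: "A \<in> G" and B: "B \<in> G" for A B
  proof (rule eq_matI)
    fix i j assume "i < dim_row (\<rho> A * \<rho> B)" "j < dim_col (\<rho> A * \<rho> B)"
    then have ij: "i < m" "j < m"
      by (auto simp: \<rho>_def)
    have \<sigma>j: "\<sigma> (coset_of B) j < m"
      by (rule \<sigma>_less[OF coset_of_mem[OF B] ij(2)])
    have "(\<rho> A * \<rho> B) $$ (i, j) = (\<Sum>k<m. \<rho> A $$ (i, k) * \<rho> B $$ (k, j))"
      by (rule index_mult_mat_sum[OF \<rho>_carrier \<rho>_carrier ij])
    also have "\<dots> = (\<Sum>k<m. if k = \<sigma> (coset_of B) j then \<rho> A $$ (i, k) else 0)"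
      using ij \<sigma>_eq[OF coset_of_mem[OF B]] by (intro sum.cong) (auto simp: \<rho>_def)
    also have "\<dots> = \<rho> A $$ (i, \<sigma> (coset_of B) j)"
      using \<sigma>j by simp
    also have "\<dots> = \<rho> (A * B) $$ (i, j)"
      using ij \<sigma>j e_\<sigma>[OF coset_of_mem[OF B] ij(2)] coset_of_mult[OF A B, symmetric]
        Q.m_assoc[OF coset_of_mem[OF A] coset_of_mem[OF B] e_mem[OF ij(2)]]
      by (simp add: \<rho>_def)
    finally show "\<rho> (A * B) $$ (i, j) = (\<rho> A * \<rho> B) $$ (i, j)"
      by simp
  qed (auto simp: \<rho>_def)
  have coset_one: "coset_of (1\<^sub>m n) = \<one>\<^bsub>quotient\<^esub>"
  proof -
    have "coset_of (1\<^sub>m n) \<otimes>\<^bsub>quotient\<^esub> coset_of (1\<^sub>m n) = coset_of (1\<^sub>m n)"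
      using coset_of_mult[OF one_G one_G] by simp
    then show ?thesis
      using Q.r_cancel_one[OF coset_of_mem[OF one_G] coset_of_mem[OF one_G]] by simp
  qed
  have coset_inv: "coset_of (inv\<^bsub>GL n\<^esub> A) = inv\<^bsub>quotient\<^esub> coset_of A" if A: "A \<in> G" for A
  proof -
    have "coset_of (inv\<^bsub>GL n\<^esub> A) \<otimes>\<^bsub>quotient\<^esub> coset_of A = \<one>\<^bsub>quotient\<^esub>"
      using coset_of_mult[OF mem_G(3)[OF A] A] GLn.l_inv[OF mem_G(1)[OF A]] coset_one by simp
    then show ?thesis
      using Q.inv_equality[OF _ coset_of_mem[OF A] coset_of_mem[OF mem_G(3)[OF A]]] by simp
  qed
  have \<rho>_one: "\<rho> (1\<^sub>m n) = 1\<^sub>m m"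
  proof (rule eq_matI)
    fix i j assume ij: "i < dim_row (1\<^sub>m m)" "j < dim_col (1\<^sub>m m)"
    then have "e i = coset_of (1\<^sub>m n) \<otimes>\<^bsub>quotient\<^esub> e j \<longleftrightarrow> i = j"
      unfolding coset_one using Q.l_one[OF e_mem[of j]] e_eq[of i j] by (simp only: index_one_mat)
    then show "\<rho> (1\<^sub>m n) $$ (i, j) = 1\<^sub>m m $$ (i, j)"
      using ij by (simp add: \<rho>_def)
  qed (auto simp: \<rho>_def)
  have \<rho>_GL: "\<rho> A \<in> carrier (GL m)" if A: "A \<in> G" for A
  proof -
    have "\<rho> A * \<rho> (inv\<^bsub>GL n\<^esub> A) = 1\<^sub>m m"
      using \<rho>_mult[OF A mem_G(3)[OF A]] GLn.r_inv[OF mem_G(1)[OF A]] \<rho>_one by simp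
    then have "det (\<rho> A) * det (\<rho> (inv\<^bsub>GL n\<^esub> A)) = 1"
      using det_mult[OF \<rho>_carrier \<rho>_carrier, of A "inv\<^bsub>GL n\<^esub> A"] by simp
    then show ?thesis
      using \<rho>_carrier by (auto simp: carrier_GL_iff)
  qed
  have regular: "regular_on n G (\<lambda>A. \<rho> A $$ (i, j))" if ij: "i < m" "j < m" for i j
  proof -
    \<comment> \<open>The only coset on which the entry \<open>(i, j)\<close> is 1; each entry is
      thus a coset indicator.\<close>
    let ?C = "e i \<otimes>\<^bsub>quotient\<^esub> inv\<^bsub>quotient\<^esub> e j"
    have C: "?C \<in> carrier quotient"
      by (intro Q.m_closed Q.inv_closed e_mem ij)
    show ?thesis
    proof (rule regular_on_cong[OF regular_on_coset_indicator])
      show "rep_of ?C \<in> G"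
        using rep_of[OF C] by blast
      fix A assume A: "A \<in> G"
      have "e i = coset_of A \<otimes>\<^bsub>quotient\<^esub> e j \<longleftrightarrow> coset_of A = ?C"
        using Q.inv_solve_right[OF coset_of_mem[OF A] e_mem[OF ij(1)] e_mem[OF ij(2)]] by simp
      then show "\<rho> A $$ (i, j) = (if coset_of A = coset_of (rep_of ?C) then 1 else 0)"
        using ij rep_of[OF C] by (simp add: \<rho>_def)
    qed
  qed
  have rep: "rational_rep n G m \<rho>"
    unfolding rational_rep_def algebraic_hom_def hom_def using \<rho>_GL \<rho>_mult regular by auto
  \<comment> \<open>Column \<open>j\<close> has its 1 in row \<open>\<sigma> a j\<close>, so on
    coordinates the matrix acts by the inverse permutation.\<close>
  have \<rho>_vec: "\<rho> A *\<^sub>v w = vec m (\<lambda>i. w $ \<sigma> (inv\<^bsub>quotient\<^esub> coset_of A) i)"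
    if A: "A \<in> G" and w: "w \<in> carrier_vec m" for A w
  proof (rule eq_vecI)
    fix i assume "i < dim_vec (vec m (\<lambda>i. w $ \<sigma> (inv\<^bsub>quotient\<^esub> coset_of A) i))"
    then have i: "i < m"
      by simp
    let ?a = "coset_of A"
    have a: "?a \<in> carrier quotient"
      by (rule coset_of_mem[OF A])
    have iff: "e i = ?a \<otimes>\<^bsub>quotient\<^esub> e j \<longleftrightarrow> j = \<sigma> (inv\<^bsub>quotient\<^esub> ?a) i" if "j < m" for j
      using Q.inv_solve_left[OF e_mem[OF that] a e_mem[OF i]] \<sigma>_eq[OF Q.inv_closed[OF a] that i]
      by blast
    have "(\<rho> A *\<^sub>v w) $ i = (\<Sum>j<m. \<rho> A $$ (i, j) * w $ j)"
      using i w \<rho>_carrier[of A] by (auto simp: scalar_prod_def atLeast0LessThan intro!: sum.cong)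
    also have "\<dots> = (\<Sum>j<m. if j = \<sigma> (inv\<^bsub>quotient\<^esub> ?a) i then w $ j else 0)"
      using i iff by (intro sum.cong) (auto simp: \<rho>_def)
    also have "\<dots> = w $ \<sigma> (inv\<^bsub>quotient\<^esub> ?a) i"
      using \<sigma>_less[OF Q.inv_closed[OF a] i] by simp
    finally show "(\<rho> A *\<^sub>v w) $ i = vec m (\<lambda>i. w $ \<sigma> (inv\<^bsub>quotient\<^esub> coset_of A) i) $ i"
      using i by simp
  qed (use \<rho>_carrier in auto)
  define v where "v = vec m (\<lambda>_. 1 :: 'a)"
  have "m > 0"
    unfolding m_def using finite_quotient Q.one_closed card_gt_0_iff by blast
  then have "v $ 0 \<noteq> 0\<^sub>v m $ 0"
    by (simp add: v_def)
  then have v_nonzero: "v \<noteq> 0\<^sub>v m"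
    by auto
  have v_fixed: "v \<in> fixed_vecs G m \<rho>"
    unfolding fixed_vecs_def
    using \<rho>_vec[of _ v] \<sigma>_less[OF Q.inv_closed[OF coset_of_mem]]
    by (auto simp: v_def intro!: eq_vecI)
  have "f v = 0"
    if d: "d < card P" and f: "f \<in> const_term_zero m (invariants_le n G m \<rho> d)" for d f
  proof -
    have f': "f \<in> vec_poly_funs_le m d" "f (0\<^sub>v m) = 0"
      "\<And>A. A \<in> G \<Longrightarrow> fun_action n m \<rho> A f = f"
      using f by (auto simp: const_term_zero_def invariants_le_def Defs.invariants_def)
    obtain c where c: "\<And>w. w \<in> carrier_vec m \<Longrightarrow>
        f w = (\<Sum>\<alpha>\<in>exponents_le m d. c \<alpha> * (\<Prod>i<m. w $ i ^ \<alpha> i))"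
      using vec_poly_funs_le_expansion[OF f'(1)] by blast
    define F where "F x = (\<Sum>\<alpha>\<in>exponents_le m d. c \<alpha> * (\<Prod>i<m. x i ^ \<alpha> i))" for x
    have F_vec: "F x = f (vec m x)" for x
      by (simp add: c F_def)
    let ?K = "quotient\<lparr>carrier := P\<rparr>"
    have K: "group ?K"
      by (rule subgroup.subgroup_is_group[OF subP Q.group_axioms])
    have P_mem: "a \<in> carrier quotient" if "a \<in> P" for a
      using subgroup.mem_carrier[OF subP that] .
    \<comment> \<open>Only the invariance under \<open>P\<close> is exploited; \<open>P\<close>
      moves the coordinates freely by cancellation in the quotient.\<close>
    have "F (\<lambda>_. 1) = F (\<lambda>_. 0)"
    proof (rule free_p_group_invariant_at_ones[OF K, where \<sigma> = \<sigma> and m = m and d = d and c = c and p = p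
          and k = "multiplicity p (Coset.order quotient)"])
      show "prime p"
        using prime_CHAR_semidom[where 'a = 'a] char by simp
      show "Coset.order ?K = p ^ multiplicity p (Coset.order quotient)"
        using cardP by (simp add: Coset.order_def)
      show "d < p ^ multiplicity p (Coset.order quotient)"
        using d cardP by simp
      show "\<sigma> (a \<otimes>\<^bsub>?K\<^esub> b) i = \<sigma> a (\<sigma> b i)"
        if "a \<in> carrier ?K" "b \<in> carrier ?K" "i < m" for a b i
        using that P_mem e_\<sigma>[of b i] Q.m_assoc[of a b "e i"] e_mem by (simp add: \<sigma>_def)
      show "\<sigma> \<one>\<^bsub>?K\<^esub> i = i" if "i < m" for i
      proof -
        have "\<sigma> \<one>\<^bsub>quotient\<^esub> i = i"
          using \<sigma>_eq[OF Q.one_closed that that] Q.l_one[OF e_mem[OF that]] by metis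
        then show ?thesis
          by simp
      qed
      show "inj_on (\<lambda>a. \<sigma> a i) (carrier ?K)" if i: "i < m" for i
      proof (rule inj_onI)
        fix a b assume ab: "a \<in> carrier ?K" "b \<in> carrier ?K" "\<sigma> a i = \<sigma> b i"
        then have "a \<otimes>\<^bsub>quotient\<^esub> e i = b \<otimes>\<^bsub>quotient\<^esub> e i"
          using e_\<sigma>[of a i] e_\<sigma>[of b i] P_mem i by simp
        moreover have "a \<in> carrier quotient" "b \<in> carrier quotient"
          using ab P_mem by auto
        ultimately show "a = b"
          using Q.right_cancel[OF e_mem[OF i]] by blast
      qed
      \<comment> \<open>\<open>fun_action\<close> inverts the group element and
        \<open>\<rho>_vec\<close> inverts the permutation; the two inversions cancel.\<close>
      show "F (\<lambda>i. x (\<sigma> a i)) = F x" if a: "a \<in> carrier ?K" for a x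
      proof -
        have a': "a \<in> carrier quotient"
          using a P_mem by simp
        let ?A = "rep_of a"
        have A: "?A \<in> G" "coset_of ?A = a"
          using rep_of[OF a'] by auto
        have "\<rho> (inv\<^bsub>GL n\<^esub> ?A) *\<^sub>v vec m x = vec m (\<lambda>i. vec m x $ \<sigma> a i)"
          using \<rho>_vec[OF mem_G(3)[OF A(1)], of "vec m x"] coset_inv[OF A(1)] A(2) a' by simp
        also have "\<dots> = vec m (\<lambda>i. x (\<sigma> a i))"
          using \<sigma>_less[OF a'] by (intro eq_vecI) auto
        finally have "f (vec m (\<lambda>i. x (\<sigma> a i))) = fun_action n m \<rho> ?A f (vec m x)"
          by (simp add: fun_action_def)
        then show ?thesis
          unfolding F_vec f'(3)[OF A(1)] .
      qed
    qed (use F_def char \<sigma>_less P_mem in auto)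
    moreover have "vec m (\<lambda>_. 0) = (0\<^sub>v m :: 'a vec)"
      by (intro eq_vecI) auto
    ultimately show ?thesis
      using f'(2) by (simp add: F_vec v_def)
  qed
  with rep v_fixed v_nonzero show ?thesis
    by blast
qed

section \<open>The value of the delta number\<close>

text \<open>The nullcone contains the origin, so the upper bound concerns nonzero fixed vectors
  only. Conversely the invariant of degree |P| also certifies that the vector of the lower bound
  lies outside the nullcone; hence no smaller degree yields a delta set.\<close>

theorem delta_group_eq:
  assumes char: "CHAR('a) = p" "p > 0" and P: "sylow_subgroup p P quotient"
  shows "delta_group n G = enat (card P)"
proof (rule antisym)
  show "delta_group n G \<le> enat (card P)"
    unfolding delta_group_def
  proof (rule Sup_least)
    fix x assume "x \<in> {delta_rep n G m \<rho> |m \<rho>. rational_rep n G m \<rho>}"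
    then obtain m \<rho> where x: "x = delta_rep n G m \<rho>" and \<rho>: "rational_rep n G m \<rho>"
      by blast
    have "v \<noteq> 0\<^sub>v m" if "v \<in> fixed_vecs G m \<rho> - nullcone n G m \<rho>" for v
      using that by (auto simp: nullcone_def const_term_zero_def)
    then have "delta_set n G m \<rho> (invariants_le n G m \<rho> (card P))"
      unfolding delta_set_def using exists_invariant_of_sylow_degree[OF char P \<rho>]
      by (auto simp: invariants_le_def)
    then show "x \<le> enat (card P)"
      unfolding x delta_rep_def by (intro Inf_lower) blast
  qed
next
  obtain m \<rho> v where \<rho>: "rational_rep n G m \<rho>" and v: "v \<in> fixed_vecs G m \<rho>" "v \<noteq> 0\<^sub>v m"
    and small: "\<And>d f. d < card P \<Longrightarrow> f \<in> const_term_zero m (invariants_le n G m \<rho> d) \<Longrightarrow> f v = 0"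
    using exists_rep_without_small_invariants[OF char P] by blast
  obtain f where f: "f \<in> const_term_zero m (invariants_le n G m \<rho> (card P))" "f v \<noteq> 0"
    using exists_invariant_of_sylow_degree[OF char P \<rho> v] by blast
  then have "v \<notin> nullcone n G m \<rho>"
    by (auto simp: nullcone_def const_term_zero_def invariants_le_def)
  then have "card P \<le> d" if "delta_set n G m \<rho> (invariants_le n G m \<rho> d)" for d
    using that v(1) small[of d] unfolding delta_set_def by (meson DiffI not_less)
  then have "enat (card P) \<le> delta_rep n G m \<rho>"
    unfolding delta_rep_def by (intro Inf_greatest) auto
  also have "\<dots> \<le> delta_group n G"
    unfolding delta_group_def using \<rho> by (intro Sup_upper) blast
  finally show "enat (card P) \<le> delta_group n G" .
qed

end

theorem theorem1p3:
  fixes G :: "'a::alg_closed_field mat set" and n p :: nat and P :: "'a mat set set"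
  assumes "CHAR('a) = p" and "p > 0"
    and "reductive n G"
    and "is_torus n (identity_component n G) \<or> identity_component n G = {1\<^sub>m n}"
    and "sylow_subgroup p P (subgroup_of_GL n G Mod identity_component n G)"
  shows "delta_group n G = enat (card P)"
proof -
  have G: "linear_algebraic_group n G"
    using assms(3) by (simp add: reductive_def)
  \<comment> \<open>Both alternatives for the identity component end in a parametrization, the
    trivial one with \<open>r = 0\<close>.\<close>
  obtain r \<psi> where "torus_param n (identity_component n G) r \<psi>"
    using assms(4) is_torus_imp_torus_param[OF _ subgroup_identity_component[OF G]]
      torus_param_trivial by metis
  then interpret finite_by_torus n G "identity_component n G" r \<psi>
    using G normal_identity_component[OF G] closedin_identity_component[OF G]
      finite_component_group[OF G]
    by (intro finite_by_torus.intro) (simp_all only: linear_algebraic_group_def)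
  show ?thesis
    by (rule delta_group_eq[OF assms(1,2,5)])
qed

end
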